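(* Let $L>0$ and $a,b,c\in\mathbb R$. Consider the system $$ \begin{cases} y_t + y_x + y_{xxx}=0, & (t,x)\in \mathbb R_+\times [0,L],\\ y(t,0) = y(t,L) = 0, & t\in \mathbb R_+,\\ y_x(t,L) = a z(t), & t\in\mathbb R_+,\\ y(0,x) = y_0(x), & x\in [0,L],\\ \dot z(t) = b z(t) + c\, y_x(t,0), & t\in \mathbb R_+,\\ z(0) = z_0. \end{cases} $$ For any initial condition $(y_0,z_0)\in H^3(0,L)\times \mathbb R$ satisfying the compatibility conditions $y_0(0) = y_0(L) = 0$ and $y_0'(L) = a z_0$, there exists a unique strong solution $y\in C(\mathbb R_+;H^3(0,L))\cap C^1(\mathbb R_+;L^2(0,L))$ of this system. Additionally, for any initial condition $(y_0,z_0)\in L^2(0,L)\times \mathbb R$ there exists a unique weak solution $y\in C(\mathbb R_+;L^2(0,L))$ of this system.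
   Context: Strong and weak solutions are understood in the sense of semigroup theory on the state space $L^2(0,L)\times\mathbb R$ (classical solutions for data in the domain of the generator, mild solutions for general data). *)

theory Defs
  imports "HOL-Analysis.Analysis"
begin

text \<open>All function spaces are over the interval [0,L] with Lebesgue measure.
  Elements of L^2(0,L) are represented by real functions; equality in L^2 is
  equality almost everywhere.\<close>

definition L2 :: "real \<Rightarrow> (real \<Rightarrow> real) \<Rightarrow> bool" where
  "L2 L f \<longleftrightarrow> f \<in> borel_measurable (lebesgue_on {0..L})
      \<and> integrable (lebesgue_on {0..L}) (\<lambda>x. (f x)\<^sup>2)"

definition L2_norm :: "real \<Rightarrow> (real \<Rightarrow> real) \<Rightarrow> real" where
  "L2_norm L f = sqrt (integral\<^sup>L (lebesgue_on {0..L}) (\<lambda>x. (f x)\<^sup>2))"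

definition L2_inner :: "real \<Rightarrow> (real \<Rightarrow> real) \<Rightarrow> (real \<Rightarrow> real) \<Rightarrow> real" where
  "L2_inner L f g = integral\<^sup>L (lebesgue_on {0..L}) (\<lambda>x. f x * g x)"

definition ae_eq :: "real \<Rightarrow> (real \<Rightarrow> real) \<Rightarrow> (real \<Rightarrow> real) \<Rightarrow> bool" where
  "ae_eq L f g \<longleftrightarrow> (AE x in lebesgue_on {0..L}. f x = g x)"

definition test_fun :: "real \<Rightarrow> (real \<Rightarrow> real) \<Rightarrow> bool" where
  "test_fun L \<phi> \<longleftrightarrow> (\<forall>n x. ((deriv ^^ n) \<phi>) differentiable (at x))
      \<and> (\<exists>p q. 0 < p \<and> p \<le> q \<and> q < L \<and> (\<forall>x. x \<notin> {p..q} \<longrightarrow> \<phi> x = 0))"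

definition weak_deriv :: "real \<Rightarrow> (real \<Rightarrow> real) \<Rightarrow> (real \<Rightarrow> real) \<Rightarrow> bool" where
  "weak_deriv L f g \<longleftrightarrow> L2 L f \<and> L2 L g \<and>
     (\<forall>\<phi>. test_fun L \<phi> \<longrightarrow>
        integral\<^sup>L (lebesgue_on {0..L}) (\<lambda>x. f x * deriv \<phi> x)
          = - integral\<^sup>L (lebesgue_on {0..L}) (\<lambda>x. g x * \<phi> x))"

definition H3_derivs :: "real \<Rightarrow> (real \<Rightarrow> real) \<Rightarrow> (real \<Rightarrow> real) \<Rightarrow> (real \<Rightarrow> real)
    \<Rightarrow> (real \<Rightarrow> real) \<Rightarrow> bool" where
  "H3_derivs L f g1 g2 g3 \<longleftrightarrow> weak_deriv L f g1 \<and> weak_deriv L g1 g2 \<and> weak_deriv L g2 g3"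

definition H3 :: "real \<Rightarrow> (real \<Rightarrow> real) \<Rightarrow> bool" where
  "H3 L f \<longleftrightarrow> (\<exists>g1 g2 g3. H3_derivs L f g1 g2 g3)"

text \<open>h is the (unique) continuously differentiable representative of f on [0,L],
  with derivative h'. Point values such as f(0), f'(L) of a Sobolev function
  are understood as values of this representative.\<close>
definition C1_rep :: "real \<Rightarrow> (real \<Rightarrow> real) \<Rightarrow> (real \<Rightarrow> real) \<Rightarrow> (real \<Rightarrow> real) \<Rightarrow> bool" where
  "C1_rep L f h h' \<longleftrightarrow> ae_eq L f h \<and> continuous_on {0..L} h' \<and>
     (\<forall>x\<in>{0..L}. (h has_real_derivative h' x) (at x within {0..L}))"

definition in_dom_A :: "real \<Rightarrow> real \<Rightarrow> (real \<Rightarrow> real) \<Rightarrow> real \<Rightarrow> bool" where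
  "in_dom_A L a f z \<longleftrightarrow> H3 L f \<and>
     (\<exists>h h'. C1_rep L f h h' \<and> h 0 = 0 \<and> h L = 0 \<and> h' L = a * z)"

definition L2_cont :: "real \<Rightarrow> (real \<Rightarrow> real \<Rightarrow> real) \<Rightarrow> bool" where
  "L2_cont L u \<longleftrightarrow> (\<forall>t\<ge>0. L2 L (u t)) \<and>
     (\<forall>t\<ge>0. ((\<lambda>s. L2_norm L (\<lambda>x. u s x - u t x)) \<longlongrightarrow> 0) (at t within {0..}))"

definition L2_deriv :: "real \<Rightarrow> (real \<Rightarrow> real \<Rightarrow> real) \<Rightarrow> (real \<Rightarrow> real \<Rightarrow> real) \<Rightarrow> bool" where
  "L2_deriv L u v \<longleftrightarrow>
     (\<forall>t\<ge>0. ((\<lambda>s. L2_norm L (\<lambda>x. (u s x - u t x) / (s - t) - v t x)) \<longlongrightarrow> 0)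
                (at t within {0..}))"

definition strong_sol :: "real \<Rightarrow> real \<Rightarrow> real \<Rightarrow> real \<Rightarrow> (real \<Rightarrow> real) \<Rightarrow> real
    \<Rightarrow> (real \<Rightarrow> real \<Rightarrow> real) \<Rightarrow> (real \<Rightarrow> real) \<Rightarrow> bool" where
  "strong_sol L a b c y0 z0 y z \<longleftrightarrow>
     (\<exists>v g1 g2 g3 zd.
        L2_cont L y \<and> L2_cont L g1 \<and> L2_cont L g2 \<and> L2_cont L g3 \<and>
        (\<forall>t\<ge>0. H3_derivs L (y t) (g1 t) (g2 t) (g3 t)) \<and>
        L2_cont L v \<and> L2_deriv L y v \<and>
        (\<forall>t\<ge>0. ae_eq L (\<lambda>x. v t x + g1 t x + g3 t x) (\<lambda>x. 0)) \<and>
        continuous_on {0..} zd \<and>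
        (\<forall>t\<ge>0. (z has_real_derivative zd t) (at t within {0..})) \<and>
        (\<forall>t\<ge>0. \<exists>h h'. C1_rep L (y t) h h' \<and> h 0 = 0 \<and> h L = 0 \<and> h' L = a * z t \<and>
             zd t = b * z t + c * h' 0) \<and>
        ae_eq L (y 0) y0 \<and> z 0 = z0)"

text \<open>Mild (weak) solution in the sense of semigroup theory:
  U = (y,z) \<in> C(R+; L^2 \<times> R), \<integral>_0^t U \<in> D(A) and U(t) - U(0) = A \<integral>_0^t U.
  The L^2-valued integral \<integral>_0^t y is characterised weakly by its pairings.\<close>
definition mild_sol :: "real \<Rightarrow> real \<Rightarrow> real \<Rightarrow> real \<Rightarrow> (real \<Rightarrow> real) \<Rightarrow> real
    \<Rightarrow> (real \<Rightarrow> real \<Rightarrow> real) \<Rightarrow> (real \<Rightarrow> real) \<Rightarrow> bool" where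
  "mild_sol L a b c y0 z0 y z \<longleftrightarrow>
     L2_cont L y \<and> continuous_on {0..} z \<and>
     (\<forall>t\<ge>0. \<exists>W w1 w2 w3 h h'.
        L2 L W \<and>
        (\<forall>\<phi>. L2 L \<phi> \<longrightarrow> L2_inner L W \<phi> = integral {0..t} (\<lambda>s. L2_inner L (y s) \<phi>)) \<and>
        H3_derivs L W w1 w2 w3 \<and>
        C1_rep L W h h' \<and> h 0 = 0 \<and> h L = 0 \<and> h' L = a * integral {0..t} z \<and>
        ae_eq L (\<lambda>x. y t x - y0 x) (\<lambda>x. - w1 x - w3 x) \<and>
        z t - z0 = b * integral {0..t} z + c * h' 0)"

end

theory Submission
  imports Defs "HOL-Computational_Algebra.Polynomial"
begin

text \<open>
  On \<open>L\<^sup>2(0,L) \<times> \<real>\<close> let \<open>A (y, z) = (- y' - y''', b z + c y'(0))\<close> with domain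
  \<open>y \<in> H\<^sup>3\<close>, \<open>y(0) = y(L) = 0\<close>, \<open>y'(L) = a z\<close>. Integration by parts gives
  \<open>\<langle>A U, U\<rangle> = (a z)\<^sup>2 / 2 - y'(0)\<^sup>2 / 2 + b z\<^sup>2 + c z y'(0) \<le> \<omega> \<bar>U\<bar>\<^sup>2\<close> for
  \<open>\<omega> = a\<^sup>2 / 2 + \<bar>b\<bar> + c\<^sup>2 / 2\<close>, so \<open>A - \<omega>\<close> is dissipative. The equation \<open>U - h A U = F\<close>
  is a linear boundary value problem of order three: its unknown initial data \<open>y'(0)\<close>, \<open>y''(0)\<close> and
  \<open>z\<close> solve a \<open>3 \<times> 3\<close> linear system, which dissipativity makes injective and hence solvable.

  A dissipative operator with this range property generates a semigroup: with \<open>J\<^sub>h = (1 - h A)\<^sup>-\<^sup>1\<close>, one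
  implicit Euler step of size \<open>h\<close> differs from two steps of size \<open>h / 2\<close> by at most
  \<open>h\<^sup>2 \<bar>A\<^sup>2 x\<bar> / 4\<close>, so the Euler approximations with dyadic step sizes converge for smooth data, and
  by density for all data in the domain. If \<open>u\<close> is the strong solution starting at \<open>J\<^sub>h x\<close>, then
  \<open>u - h u'\<close> is the mild solution starting at \<open>x\<close>. Uniqueness is Gronwall's inequality.
\<close>


section \<open>Generation theorem for quasi-dissipative operators\<close>

text \<open>A type cannot depend on the real number \<open>L\<close>, so the Hilbert space
  \<open>lsq\<close> is L^2 of the whole line. The generator acts on the restriction to [0,L] and
  vanishes on the part outside, where the semigroup is the identity; this keeps
  \<open>1 - h A\<close> onto the whole space, as the generation theorem demands. Operators are
  treated as subspaces of pairs, so that a domain is part of the membership statement. The other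
  obstacle is regularity. The definitions speak of weak derivatives and of point values of
  representatives, whereas boundary terms and differential equations call for genuine functions. The
  du Bois-Reymond lemma turns every weak derivative into a primitive and so links the two. Moreover
  a strong solution has to be continuous with values in H^3, while semigroup theory yields only
  continuity of U and A U. The gap is closed by bounding y' and y'' uniformly by the graph norm of
  the generator and applying the bound to differences between two times; y''' then follows from the
  equation.\<close>

text \<open>The vector is \<open>x\<close> minus its nearest point in \<open>S\<close>, which exists
  because minimizing sequences are Cauchy. It serves to prove that the domain of a dissipative
  operator is dense.\<close>

lemma closed_subspace_orthogonal_vector:
  fixes S :: "'a::{real_inner,complete_space} set"
  assumes S: "subspace S" "closed S" and x: "x \<notin> S"
  shows "\<exists>v. v \<noteq> 0 \<and> (\<forall>s\<in>S. inner v s = 0)"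
proof -
  define d where "d = infdist x S"
  have ne: "S \<noteq> {}" using S(1) subspace_0 by blast
  have d_le: "d \<le> dist x s" if "s \<in> S" for s
    using that infdist_le[of s S x] by (simp add: d_def)
  have d0: "d \<ge> 0" by (simp add: d_def infdist_nonneg)
  have "\<exists>s\<in>S. dist x s < d + 1 / real (Suc n)" for n
  proof (rule ccontr)
    assume "\<not> ?thesis"
    then have "\<And>s. s \<in> S \<Longrightarrow> d + 1 / real (Suc n) \<le> dist x s" by force
    then have "d + 1 / real (Suc n) \<le> infdist x S"
      unfolding infdist_notempty[OF ne] by (intro cINF_greatest ne)
    then have "1 / real (Suc n) \<le> 0" by (simp add: d_def)
    then show False by (simp add: divide_le_0_iff)
  qed
  then obtain s where s: "\<And>n. s n \<in> S" "\<And>n. dist x (s n) < d + 1 / real (Suc n)" by metis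
  \<comment> \<open>Parallelogram identity for \<open>x - s m\<close> and \<open>x - s n\<close>:
    the midpoint of \<open>s m\<close> and \<open>s n\<close> lies in \<open>S\<close>, hence at
    distance at least \<open>d\<close> from \<open>x\<close>.\<close>
  have bound: "(dist (s m) (s n))\<^sup>2 \<le> 2 * (dist x (s m))\<^sup>2 + 2 * (dist x (s n))\<^sup>2 - 4 * d\<^sup>2" for m n
  proof -
    have "(1/2) *\<^sub>R (s m + s n) \<in> S"
      using S(1) s(1) by (intro subspace_scale subspace_add)
    then have "d\<^sup>2 \<le> (norm (x - (1/2) *\<^sub>R (s m + s n)))\<^sup>2"
      using d_le d0 by (metis dist_norm power_mono)
    then show ?thesis
      unfolding dist_norm power2_norm_eq_inner
      by (simp add: inner_diff_left inner_diff_right inner_add_left inner_add_right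
          inner_commute algebra_simps)
  qed
  have lim: "(\<lambda>n. dist x (s n)) \<longlonglongrightarrow> d"
  proof (rule real_tendsto_sandwich[where f = "\<lambda>_. d" and h = "\<lambda>n. d + 1 / real (Suc n)"])
    show "(\<lambda>n. d + 1 / real (Suc n)) \<longlonglongrightarrow> d"
      using tendsto_add[OF tendsto_const LIMSEQ_inverse_real_of_nat, of d]
      by (simp only: inverse_eq_divide add_0_right)
    show "\<forall>\<^sub>F n in sequentially. d \<le> dist x (s n)" using s(1) d_le by simp
    show "\<forall>\<^sub>F n in sequentially. dist x (s n) \<le> d + 1 / real (Suc n)"
      using s(2) by (intro always_eventually allI less_imp_le)
  qed simp
  have "Cauchy s"
  proof (rule metric_CauchyI)
    fix e :: real assume e: "e > 0"
    have "(\<lambda>n. (dist x (s n))\<^sup>2) \<longlonglongrightarrow> d\<^sup>2" by (intro tendsto_intros lim)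
    then have "\<forall>\<^sub>F n in sequentially. (dist x (s n))\<^sup>2 < d\<^sup>2 + e\<^sup>2 / 4"
      by (rule order_tendstoD) (use e in simp)
    then obtain N where N: "\<And>n. n \<ge> N \<Longrightarrow> (dist x (s n))\<^sup>2 < d\<^sup>2 + e\<^sup>2 / 4"
      by (auto simp: eventually_sequentially)
    have "dist (s m) (s n) < e" if "m \<ge> N" "n \<ge> N" for m n
    proof -
      have "(dist (s m) (s n))\<^sup>2 < e\<^sup>2"
        using bound[of m n] N[OF that(1)] N[OF that(2)] by simp
      then show ?thesis using e by (simp add: power2_less_imp_less)
    qed
    then show "\<exists>M. \<forall>m\<ge>M. \<forall>n\<ge>M. dist (s m) (s n) < e" by blast
  qed
  then obtain p where p: "s \<longlonglongrightarrow> p"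
    using Cauchy_convergent convergent_def by blast
  have pS: "p \<in> S" using closed_sequentially[OF S(2) _ p] s(1) by blast
  have dp: "dist x p = d"
    using tendsto_dist[OF tendsto_const p, of x] lim LIMSEQ_unique by blast
  have "inner (x - p) t = 0" if t: "t \<in> S" for t
  proof (cases "t = 0")
    case False
    \<comment> \<open>This \<open>r\<close> minimizes the distance from \<open>x\<close> to
      \<open>p + r *\<^sub>R t\<close>. Since \<open>p\<close> is already nearest, the resulting
      gain \<open>(inner (x - p) t)\<^sup>2 / inner t t\<close> must be zero.\<close>
    define r where "r = inner (x - p) t / inner t t"
    have tt: "inner t t > 0" using False by simp
    have "p + r *\<^sub>R t \<in> S" using S(1) pS t by (intro subspace_add subspace_scale)
    then have "d\<^sup>2 \<le> (norm (x - (p + r *\<^sub>R t)))\<^sup>2"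
      using d_le d0 by (metis dist_norm power_mono)
    also have "\<dots> = (norm (x - p))\<^sup>2 - (inner (x - p) t)\<^sup>2 / inner t t"
      unfolding power2_norm_eq_inner r_def using tt
      by (simp add: inner_diff_left inner_diff_right inner_add_left inner_add_right
          inner_commute field_simps power2_eq_square)
    also have "(norm (x - p))\<^sup>2 = d\<^sup>2" using dp by (simp add: dist_norm)
    finally show ?thesis using tt by (simp add: field_simps)
  qed simp
  then show ?thesis using x pS by (intro exI[of _ "x - p"]) auto
qed

lemma subspace_closure:
  fixes S :: "'a::real_normed_vector set"
  assumes "subspace S"
  shows "subspace (closure S)"
proof (rule subspaceI)
  show "0 \<in> closure S" using subspace_0[OF assms] closure_subset by blast
  fix x y assume "x \<in> closure S" "y \<in> closure S"
  then obtain f g where "\<And>n::nat. f n \<in> S" "f \<longlonglongrightarrow> x" "\<And>n::nat. g n \<in> S" "g \<longlonglongrightarrow> y"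
    unfolding closure_sequential by blast
  then show "x + y \<in> closure S"
    unfolding closure_sequential
    by (intro exI[of _ "\<lambda>n. f n + g n"]) (auto intro: subspace_add[OF assms] tendsto_add)
next
  fix c :: real and x assume "x \<in> closure S"
  then obtain f where "\<And>n::nat. f n \<in> S" "f \<longlonglongrightarrow> x" unfolding closure_sequential by blast
  then show "c *\<^sub>R x \<in> closure S"
    unfolding closure_sequential
    by (intro exI[of _ "\<lambda>n. c *\<^sub>R f n"]) (auto intro: subspace_scale[OF assms] tendsto_scaleR)
qed

text \<open>The increments are summable. This is applied to Euler approximations under halving of
  the step, and pointwise in the completeness proof for L^2.\<close>

lemma convergent_of_geometric_steps:
  fixes X :: "nat \<Rightarrow> 'a::banach"
  assumes "\<And>k. norm (X (Suc k) - X k) \<le> C / 2 ^ k"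
  shows "convergent X"
proof -
  have "summable (\<lambda>k. X (Suc k) - X k)"
  proof (rule summable_comparison_test)
    show "\<exists>N. \<forall>n\<ge>N. norm (X (Suc n) - X n) \<le> C * (1/2) ^ n"
      using assms by (auto simp: power_divide)
    show "summable (\<lambda>n. C * (1/2) ^ n :: real)"
      by (intro summable_mult summable_geometric) simp
  qed
  then have "convergent (\<lambda>n. X n - X 0)"
    unfolding summable_iff_convergent sum_lessThan_telescope .
  then obtain l where "(\<lambda>n. X n - X 0) \<longlonglongrightarrow> l" by (auto simp: convergent_def)
  from tendsto_add[OF this tendsto_const[of "X 0"]] show ?thesis by (auto simp: convergent_def)
qed

text \<open>The weighted energy \<open>exp (- 2 * w * t) * inner (d t) (d t)\<close> has nonpositive
  derivative and starts from zero.\<close>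

lemma dissipative_gronwall:
  fixes d :: "real \<Rightarrow> 'a::real_inner"
  assumes der: "\<And>t. t \<ge> 0 \<Longrightarrow> (d has_vector_derivative e t) (at t within {0..})"
    and dis: "\<And>t. t \<ge> 0 \<Longrightarrow> inner (d t) (e t) \<le> w * inner (d t) (d t)"
    and d0: "d 0 = 0" and t: "t \<ge> 0"
  shows "d t = 0"
proof (cases "t = 0")
  case False
  define f where "f s = exp (- 2 * w * s) * inner (d s) (d s)" for s
  have f': "(f has_real_derivative
      exp (- 2 * w * s) * (2 * inner (d s) (e s) - 2 * w * inner (d s) (d s))) (at s within {0..})"
    if "s \<ge> 0" for s
    unfolding f_def has_real_derivative_iff_has_vector_derivative
    by (rule has_vector_derivative_eq_rhs,
        rule has_vector_derivative_mult[OF _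
          bounded_bilinear.has_vector_derivative[OF bounded_bilinear_inner der[OF that] der[OF that]]],
        rule has_real_derivative_iff_has_vector_derivative[THEN iffD1],
        (rule derivative_eq_intros refl)+)
      (simp add: inner_commute algebra_simps)
  have "f t \<le> f 0"
  proof (rule DERIV_nonpos_imp_decreasing_open[where f = f])
    show "0 \<le> t" by fact
    show "continuous_on {0..t} f"
      by (rule continuous_on_subset[of "{0..}"])
        (auto simp: continuous_on_eq_continuous_within intro: DERIV_continuous[OF f'])
    fix s assume "0 < s" "s < t"
    then show "\<exists>y. DERIV f s :> y \<and> y \<le> 0"
      using f'[of s] dis[of s] at_within_interior[of s "{0..}"]
      by (intro exI[of _ "exp (- 2 * w * s) * (2 * inner (d s) (e s) - 2 * w * inner (d s) (d s))"])
        (auto simp: mult_nonneg_nonpos)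
  qed
  then have "exp (- 2 * w * t) * inner (d t) (d t) \<le> 0" by (simp add: f_def d0)
  then have "inner (d t) (d t) \<le> 0" by (simp add: mult_le_0_iff)
  then show ?thesis by (meson inner_eq_zero_iff inner_ge_zero order_antisym)
qed (use d0 in simp)

text \<open>Halving the step size turns N completed steps into 2 N, plus possibly one extra half
  step that still fits before time \<open>t\<close>.\<close>

lemma nat_floor_double:
  assumes "0 \<le> (t::real)"
  shows "nat \<lfloor>t * 2 ^ Suc k\<rfloor> = 2 * nat \<lfloor>t * 2 ^ k\<rfloor> \<or> nat \<lfloor>t * 2 ^ Suc k\<rfloor> = Suc (2 * nat \<lfloor>t * 2 ^ k\<rfloor>)"
proof -
  have "\<lfloor>2 * (t * 2 ^ k)\<rfloor> = 2 * \<lfloor>t * 2 ^ k\<rfloor> \<or> \<lfloor>2 * (t * 2 ^ k)\<rfloor> = 2 * \<lfloor>t * 2 ^ k\<rfloor> + 1" by linarith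
  moreover have "t * 2 ^ Suc k = 2 * (t * 2 ^ k)" by simp
  moreover have "\<lfloor>t * 2 ^ k\<rfloor> \<ge> 0" using assms by simp
  ultimately show ?thesis by linarith
qed

lemma floor_dyadic_tendsto: "(\<lambda>k. real (nat \<lfloor>t * 2 ^ k\<rfloor>) * (1 / 2 ^ k)) \<longlonglongrightarrow> t" if "0 \<le> t"
proof (rule real_tendsto_sandwich)
  have "t - (1/2) ^ k \<le> real (nat \<lfloor>t * 2 ^ k\<rfloor>) * (1 / 2 ^ k)" for k
  proof -
    have "t * 2 ^ k - 1 \<le> real (nat \<lfloor>t * 2 ^ k\<rfloor>)" using that by linarith
    then have "(t * 2 ^ k - 1) / 2 ^ k \<le> real (nat \<lfloor>t * 2 ^ k\<rfloor>) / 2 ^ k"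
      by (rule divide_right_mono) simp
    then show ?thesis by (simp add: diff_divide_distrib power_divide)
  qed
  then show "\<forall>\<^sub>F k in sequentially. t - (1/2) ^ k \<le> real (nat \<lfloor>t * 2 ^ k\<rfloor>) * (1 / 2 ^ k)" by simp
  have "real (nat \<lfloor>t * 2 ^ k\<rfloor>) * (1 / 2 ^ k) \<le> t" for k
    using that by (simp add: field_simps)
  then show "\<forall>\<^sub>F k in sequentially. real (nat \<lfloor>t * 2 ^ k\<rfloor>) * (1 / 2 ^ k) \<le> t" by simp
  show "(\<lambda>k. t - (1/2) ^ k) \<longlonglongrightarrow> t"
    using tendsto_diff[OF tendsto_const LIMSEQ_realpow_zero[of "1/2"], of t] by simp
qed simp

text \<open>The expansion is given only forward in time, which yields a right derivative. For
  \<open>s < t\<close> one expands at \<open>s\<close> instead, and the Lipschitz bound on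
  \<open>v\<close> pays for replacing \<open>v s\<close> by \<open>v t\<close>; hence the constant
  \<open>2 * C\<close>.\<close>

lemma quadratic_remainder_derivative:
  fixes u v :: "real \<Rightarrow> 'b::real_normed_vector"
  assumes "\<And>s t. 0 \<le> t \<Longrightarrow> t \<le> s \<Longrightarrow> norm (u s - u t - (s - t) *\<^sub>R v t) \<le> C * (s - t)\<^sup>2"
    and "\<And>s t. 0 \<le> t \<Longrightarrow> t \<le> s \<Longrightarrow> norm (v s - v t) \<le> C * (s - t)" and "0 \<le> t"
  shows "(u has_vector_derivative v t) (at t within {0..})"
proof -
  have C: "C \<ge> 0" using order_trans[OF norm_ge_zero assms(2)[of 0 1]] by simp
  have *: "norm (u s - u t - (s - t) *\<^sub>R v t) \<le> 2 * C * (s - t)\<^sup>2" if "s \<ge> 0" for s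
  proof (cases "t \<le> s")
    case True
    then show ?thesis
      using assms(1)[OF assms(3) True] mult_nonneg_nonneg[OF C zero_le_power2[of "s - t"]] by linarith
  next
    case False
    have "norm (u s - u t - (s - t) *\<^sub>R v t)
        = norm ((t - s) *\<^sub>R (v t - v s) - (u t - u s - (t - s) *\<^sub>R v s))"
      by (simp add: algebra_simps)
    also have "\<dots> \<le> norm ((t - s) *\<^sub>R (v t - v s)) + norm (u t - u s - (t - s) *\<^sub>R v s)"
      by (rule norm_triangle_ineq4)
    also have "\<dots> \<le> (t - s) * (C * (t - s)) + C * (t - s)\<^sup>2"
      using assms(1,2)[OF that, of t] False by (intro add_mono) (auto simp: mult_left_mono)
    also have "\<dots> = 2 * C * (s - t)\<^sup>2" by (simp add: power2_eq_square algebra_simps)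
    finally show ?thesis .
  qed
  show ?thesis
    unfolding has_vector_derivative_def has_derivative_within_alt
  proof (intro conjI bounded_linear_scaleR_left allI impI)
    fix e :: real assume e: "e > 0"
    show "\<exists>d>0. \<forall>s\<in>{0..}. norm (s - t) < d \<longrightarrow>
        norm (u s - u t - (s - t) *\<^sub>R v t) \<le> e * norm (s - t)"
    proof (intro exI conjI ballI impI)
      show "0 < e / (2 * C + 1)" using e C by simp
      fix s assume s: "s \<in> {0..}" "norm (s - t) < e / (2 * C + 1)"
      have "2 * C * \<bar>s - t\<bar> \<le> (2 * C + 1) * \<bar>s - t\<bar>" by (simp add: mult_right_mono)
      also have "\<dots> \<le> e" using s(2) C by (simp add: field_simps)
      finally have "2 * C * \<bar>s - t\<bar> * \<bar>s - t\<bar> \<le> e * \<bar>s - t\<bar>"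
        by (rule mult_right_mono) simp
      then show "norm (u s - u t - (s - t) *\<^sub>R v t) \<le> e * norm (s - t)"
        using *[of s] s(1) by (simp add: power2_eq_square mult.assoc)
    qed
  qed
qed

section \<open>Dissipative graphs, their resolvents and density of the domain\<close>

locale linear_graph =
  fixes G :: "('a::real_vector \<times> 'a) set"
  assumes subspace_G: "subspace G"
begin

lemma G_add: "(x, y) \<in> G \<Longrightarrow> (x', y') \<in> G \<Longrightarrow> (x + x', y + y') \<in> G"
  using subspace_add[OF subspace_G, of "(x,y)" "(x',y')"] by simp

lemma G_diff: "(x, y) \<in> G \<Longrightarrow> (x', y') \<in> G \<Longrightarrow> (x - x', y - y') \<in> G"
  using subspace_diff[OF subspace_G, of "(x,y)" "(x',y')"] by simp

lemma G_scale: "(x, y) \<in> G \<Longrightarrow> (r *\<^sub>R x, r *\<^sub>R y) \<in> G"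
  using subspace_scale[OF subspace_G, of "(x,y)" r] by simp

end

text \<open>These are the Lumer-Phillips hypotheses for the graph of an operator:
  \<open>single\<close> says that the graph is single-valued. Density of the domain is derived
  below.\<close>

locale m_dissipative = linear_graph G
  for G :: "('a::{real_inner,banach} \<times> 'a) set" +
  assumes single: "(0, y) \<in> G \<Longrightarrow> y = 0"
    and dissipative: "(x, y) \<in> G \<Longrightarrow> inner x y \<le> 0"
    and range: "0 < h \<Longrightarrow> \<exists>x y. (x, y) \<in> G \<and> x - h *\<^sub>R y = f"
begin

lemma G_unique: "(x, y) \<in> G \<Longrightarrow> (x, y') \<in> G \<Longrightarrow> y = y'"
  using G_diff[of x y x y'] single[of "y - y'"] by simp

text \<open>In the expanded square the cross term \<open>- 2 * h * inner x y\<close> is nonnegative.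
  This gives both uniqueness of the solution of \<open>x - h *\<^sub>R y = f\<close> and
  contractivity of the resolvent.\<close>

lemma norm_le: 
  assumes "(x, y) \<in> G" "0 < h" 
  shows "norm x \<le> norm (x - h *\<^sub>R y)"
proof -
  have "(norm x)\<^sup>2 \<le> (norm (x - h *\<^sub>R y))\<^sup>2"
  proof -
    have "(norm (x - h *\<^sub>R y))\<^sup>2 = (norm x)\<^sup>2 - 2 * h * inner x y + h\<^sup>2 * (norm y)\<^sup>2"
      unfolding power2_norm_eq_inner
      by (simp add: inner_diff_left inner_diff_right inner_commute algebra_simps power2_eq_square)
    moreover have "h * inner x y \<le> 0"
      using assms dissipative by (simp add: mult_le_0_iff)
    moreover have "0 \<le> h\<^sup>2 * (norm y)\<^sup>2" by simp
    ultimately show ?thesis by linarith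
  qed
  then show ?thesis using norm_ge_zero power2_le_imp_le by blast
qed

definition J where "J h f = (THE x. \<exists>y. (x, y) \<in> G \<and> x - h *\<^sub>R y = f)"

lemma J_eq: 
  assumes "(x, y) \<in> G" "0 < h" 
  shows "J h (x - h *\<^sub>R y) = x"
  unfolding J_def
proof (rule the_equality)
  fix x' assume "\<exists>y'. (x', y') \<in> G \<and> x' - h *\<^sub>R y' = x - h *\<^sub>R y"
  then obtain y' where "(x', y') \<in> G" "x' - h *\<^sub>R y' = x - h *\<^sub>R y" by blast
  then show "x' = x"
    using norm_le[OF G_diff[OF _ assms(1)] assms(2), of x' y']
    by (simp add: algebra_simps)
qed (use assms in blast)

lemma J_graph: 
  assumes "0 < h" 
  shows "(J h f, (1 / h) *\<^sub>R (J h f - f)) \<in> G"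
proof -
  obtain x y where xy: "(x, y) \<in> G" "x - h *\<^sub>R y = f" using range[OF assms] by blast
  then have "J h f = x" using J_eq[OF xy(1) assms] by simp
  moreover have "(1 / h) *\<^sub>R (x - f) = y" using xy(2) assms by (auto simp: algebra_simps)
  ultimately show ?thesis using xy(1) by simp
qed

lemma J_diff: 
  assumes "0 < h" 
  shows "J h (f - g) = J h f - J h g"
  using J_eq[OF G_diff[OF J_graph[OF assms, of f] J_graph[OF assms, of g]] assms] assms
  by (simp add: algebra_simps)

lemma J_scale: 
  assumes "0 < h" 
  shows "J h (r *\<^sub>R f) = r *\<^sub>R J h f"
  using J_eq[OF G_scale[OF J_graph[OF assms, of f], of r] assms] assms
  by (simp add: algebra_simps)

lemma J_add: 
  assumes "0 < h" 
  shows "J h (f + g) = J h f + J h g"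
  using J_diff[OF assms, of f "- g"] J_scale[OF assms, of "-1" g] by simp

lemma J_norm: "0 < h \<Longrightarrow> norm (J h f) \<le> norm f"
  using norm_le[OF J_graph[of h f], of h] by simp

lemma J_bounded_linear: "0 < h \<Longrightarrow> bounded_linear (J h)"
  by (rule bounded_linear_intro[where K=1]) (auto simp: J_add J_scale J_norm)

lemma J_step: 
  assumes "(x, y) \<in> G" "0 < h" 
  shows "J h x - x = h *\<^sub>R J h y"
  using J_eq[OF assms] assms(2) by (simp add: J_diff J_scale algebra_simps)

text \<open>The resolvent commutes with the operator on its domain. Euler iterates of data in the
  domain of A, or of a power of A, therefore stay there, with no larger norms; the inductions on the
  number of steps rest on this.\<close>

lemma J_G: 
  assumes "(x, y) \<in> G" "0 < h" 
  shows "(J h x, J h y) \<in> G"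
  using J_graph[OF assms(2), of x] J_step[OF assms] assms(2) by simp

lemma J_commute: 
  assumes "0 < h" "0 < k" 
  shows "J h (J k f) = J k (J h f)"
  using J_eq[OF J_G[OF J_graph[OF assms(1), of f] assms(2)] assms(1)] assms
  by (simp add: J_scale J_diff)

lemma J_step_norm: 
  assumes "(x, y) \<in> G" "0 < h" 
  shows "norm (J h x - x) \<le> h * norm y"
  using J_step[OF assms] J_norm[OF assms(2), of y] assms(2) by simp

text \<open>Membership of \<open>(x, y)\<close> in \<open>G\<close> is equivalent to
  \<open>J 1 (x - y) = x\<close>, and \<open>J 1\<close> is continuous on the whole space.\<close>

lemma closed_G:
  assumes "X \<longlonglongrightarrow> x" "Y \<longlonglongrightarrow> y" "\<And>n. (X n, Y n) \<in> G"
  shows "(x, y) \<in> G"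
proof -
  have "(\<lambda>n. J 1 (X n - Y n)) \<longlonglongrightarrow> J 1 (x - y)"
    by (intro bounded_linear.tendsto[OF J_bounded_linear] tendsto_intros assms) simp
  moreover have "J 1 (X n - Y n) = X n" for n using J_eq[OF assms(3), of 1 n] by simp
  ultimately have "J 1 (x - y) = x" using assms(1) LIMSEQ_unique by auto
  then show ?thesis using J_graph[of 1 "x - y"] by simp
qed

text \<open>A vector \<open>v\<close> orthogonal to the domain is orthogonal to
  \<open>J 1 v\<close>. Dissipativity at \<open>J 1 v\<close> then forces \<open>J 1 v = 0\<close>,
  so \<open>(0, - v)\<close> lies in \<open>G\<close> and \<open>v = 0\<close>.\<close>

lemma dense_domain: "closure (fst ` G) = UNIV"
proof (rule ccontr)
  assume "closure (fst ` G) \<noteq> UNIV"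
  then obtain x where x: "x \<notin> closure (fst ` G)" by blast
  have "subspace (fst ` G)"
    by (intro linear_subspace_image subspace_G) (simp add: linear_iff)
  then have "subspace (closure (fst ` G))" by (rule subspace_closure)
  then obtain v where v: "v \<noteq> 0" "\<And>s. s \<in> closure (fst ` G) \<Longrightarrow> inner v s = 0"
    using closed_subspace_orthogonal_vector[OF _ closed_closure x] by blast
  have "inner v (J 1 v) = 0"
    by (rule v(2)) (use J_graph[of 1 v] closure_subset in force)
  moreover have "inner (J 1 v) (J 1 v - v) \<le> 0" using dissipative[OF J_graph[of 1 v]] by simp
  ultimately have "inner (J 1 v) (J 1 v) \<le> 0"
    by (simp add: inner_diff_right inner_commute)
  then have "J 1 v = 0" by (meson inner_eq_zero_iff inner_ge_zero order_antisym)
  then show False using J_graph[of 1 v] single[of "- v"] v(1) by simp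
qed

text \<open>On the domain the error is at most \<open>h\<close> times the norm of the image; density
  and contractivity extend the convergence to all \<open>x\<close>.\<close>

lemma J_tendsto: "(\<lambda>n. J (1 / real (Suc n)) x) \<longlonglongrightarrow> x"
proof (rule LIMSEQ_I)
  fix e :: real assume e: "e > 0"
  have "x \<in> closure (fst ` G)" using dense_domain by simp
  then obtain x' y' where xy: "(x', y') \<in> G" "dist x' x < e / 3"
    using e closure_approachable[of x "fst ` G"] 
    by (metis (no_types, lifting) divide_pos_pos imageE prod.collapse zero_less_numeral)
  have "(\<lambda>n. 1 / real (Suc n) * norm y') \<longlonglongrightarrow> 0 * norm y'"
    by (intro tendsto_mult tendsto_const)
      (use LIMSEQ_inverse_real_of_nat in \<open>simp add: inverse_eq_divide\<close>)
  then have "\<forall>\<^sub>F n in sequentially. 1 / real (Suc n) * norm y' < e / 3"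
    by (rule order_tendstoD) (use e in simp)
  then obtain N where N: "\<And>n. n \<ge> N \<Longrightarrow> 1 / real (Suc n) * norm y' < e / 3"
    unfolding eventually_sequentially by blast
  show "\<exists>N. \<forall>n\<ge>N. norm (J (1 / real (Suc n)) x - x) < e"
  proof (intro exI allI impI)
    fix n assume n: "n \<ge> N"
    define h where "h = 1 / real (Suc n)"
    have h: "h > 0" by (simp add: h_def)
    have "norm (J h x - x) = norm (J h (x - x') + (J h x' - x') + (x' - x))"
      using h by (simp add: J_diff)
    also have "\<dots> \<le> norm (J h (x - x')) + norm (J h x' - x') + norm (x' - x)"
      by (meson norm_triangle_ineq order_trans add_right_mono)
    also have "\<dots> < e / 3 + e / 3 + e / 3"
      using J_norm[OF h, of "x - x'"] J_step_norm[OF xy(1) h] N[OF n, folded h_def] xy(2)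
      unfolding dist_norm norm_minus_commute[of x x'] by linarith
    finally show "norm (J (1 / real (Suc n)) x - x) < e" by (simp add: h_def)
  qed
qed

section \<open>Implicit Euler approximations and their limits\<close>

lemma Jn_diff: "0 < h \<Longrightarrow> (J h ^^ n) (f - g) = (J h ^^ n) f - (J h ^^ n) g"
  by (induction n) (auto simp: J_diff)

lemma Jn_scale: "0 < h \<Longrightarrow> (J h ^^ n) (r *\<^sub>R f) = r *\<^sub>R (J h ^^ n) f"
  by (induction n) (auto simp: J_scale)

lemma Jn_norm: "0 < h \<Longrightarrow> norm ((J h ^^ n) f) \<le> norm f"
  by (induction n) (auto intro: order_trans[OF J_norm])

lemma Jn_G: "(x, y) \<in> G \<Longrightarrow> 0 < h \<Longrightarrow> ((J h ^^ n) x, (J h ^^ n) y) \<in> G"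
  by (induction n) (auto intro: J_G)

text \<open>Both one-step maps invert a perturbation of the identity, and
  \<open>(1 - h A / 2)\<^sup>2 - (1 - h A) = h\<^sup>2 A\<^sup>2 / 4\<close>.\<close>
lemma J_half_step_error:
  assumes "(x, y) \<in> G" "(y, w) \<in> G" "0 < h"
  shows "norm (J h x - J (h/2) (J (h/2) x)) \<le> h\<^sup>2 / 4 * norm w"
proof -
  have h2: "0 < h / 2" using assms by simp
  define Q where "Q f = J (h/2) (J (h/2) f)" for f
  have Qd: "Q (f - g) = Q f - Q g" and Qs: "Q (r *\<^sub>R f) = r *\<^sub>R Q f" and QJ: "J h (Q f) = Q (J h f)"
    for f g r using h2 assms(3) by (simp_all add: Q_def J_diff J_scale J_commute)
  have Qa: "Q (f + g) = Q f + Q g" for f g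
    using Qd[of f "- g"] Qs[of "-1" g] by simp
  have "J (h/2) (x - h *\<^sub>R y + (h\<^sup>2/4) *\<^sub>R w) = x - (h/2) *\<^sub>R y"
  proof -
    have "x - h *\<^sub>R y + (h\<^sup>2/4) *\<^sub>R w = (x - (h/2) *\<^sub>R y) - (h/2) *\<^sub>R (y - (h/2) *\<^sub>R w)"
      by (simp add: algebra_simps power2_eq_square flip: scaleR_add_left)
    then show ?thesis
      using J_eq[OF assms(1) h2] J_eq[OF assms(2) h2] by (simp only: J_diff[OF h2] J_scale[OF h2])
  qed
  then have "Q (x - h *\<^sub>R y + (h\<^sup>2/4) *\<^sub>R w) = x" using J_eq[OF assms(1) h2] by (simp add: Q_def)
  then have "J h (Q (x - h *\<^sub>R y)) + (h\<^sup>2/4) *\<^sub>R J h (Q w) = J h x"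
    using assms(3) by (metis J_add J_scale Qa Qs)
  moreover have "J h (Q (x - h *\<^sub>R y)) = Q x" using J_eq[OF assms(1,3)] by (simp add: QJ)
  ultimately have "J h x - Q x = (h\<^sup>2/4) *\<^sub>R J h (Q w)" by (metis add_diff_cancel_left')
  moreover have "norm (J h (Q w)) \<le> norm w"
    unfolding Q_def using h2 assms(3) by (meson J_norm order_trans)
  ultimately show ?thesis by (simp add: Q_def mult_left_mono)
qed

text \<open>The local errors of size \<open>h\<^sup>2 / 4 * norm w\<close> are carried along by
  contractions, so they simply add up. For bounded \<open>real n * h\<close> the total is of order
  \<open>h\<close>.\<close>

lemma Jn_half_step_error:
  assumes "(x, y) \<in> G" "(y, w) \<in> G" "0 < h"
  shows "norm ((J h ^^ n) x - (J (h/2) ^^ (2 * n)) x) \<le> real n * (h\<^sup>2 / 4 * norm w)"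
  using assms
proof (induction n arbitrary: x y w)
  case (Suc n)
  let ?Q = "J (h/2)"
  have h2: "0 < h / 2" using Suc.prems by simp
  have "(J h ^^ Suc n) x - (?Q ^^ (2 * Suc n)) x
      = ((J h ^^ n) (J h x) - (?Q ^^ (2 * n)) (J h x)) + (?Q ^^ (2 * n)) (J h x - ?Q (?Q x))"
    by (simp add: Jn_diff[OF h2] funpow_swap1)
  also have "norm \<dots> \<le> real n * (h\<^sup>2 / 4 * norm (J h w)) + norm (J h x - ?Q (?Q x))"
    by (intro order_trans[OF norm_triangle_ineq] add_mono Jn_norm h2
        Suc.IH[OF J_G[OF Suc.prems(1,3)] J_G[OF Suc.prems(2,3)] Suc.prems(3)])
  also have "\<dots> \<le> real n * (h\<^sup>2 / 4 * norm w) + h\<^sup>2 / 4 * norm w"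
    using Suc.prems by (intro add_mono J_half_step_error[OF Suc.prems] mult_left_mono J_norm) auto
  finally show ?case by (simp add: algebra_simps)
qed simp

lemma Jn_step_norm:
  assumes "(x, y) \<in> G" "0 < h"
  shows "norm ((J h ^^ n) x - x) \<le> real n * h * norm y"
  using assms
proof (induction n arbitrary: x y)
  case (Suc n)
  have "(J h ^^ Suc n) x - x = ((J h ^^ n) (J h x) - J h x) + (J h x - x)"
    by (simp add: funpow_swap1)
  also have "norm \<dots> \<le> real n * h * norm (J h y) + h * norm y"
    by (intro order_trans[OF norm_triangle_ineq] add_mono J_step_norm Suc.prems
        Suc.IH[OF J_G[OF Suc.prems] Suc.prems(2)])
  also have "\<dots> \<le> real n * h * norm y + h * norm y"
    using Suc.prems by (intro add_mono mult_left_mono J_norm) auto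
  finally show ?case by (simp add: algebra_simps)
qed simp

text \<open>A discrete Taylor formula whose bound depends on \<open>n\<close> and \<open>h\<close>
  only through the elapsed time \<open>real n * h\<close>. It therefore survives refinement of the
  grid and identifies the derivative of the limit.\<close>

lemma Jn_taylor:
  assumes "(x, y) \<in> G" "(y, w) \<in> G" "0 < h"
  shows "norm ((J h ^^ n) x - x - (real n * h) *\<^sub>R y) \<le> (real n * h)\<^sup>2 * norm w"
  using assms
proof (induction n arbitrary: x y w)
  case (Suc n)
  have "(J h ^^ Suc n) x - x - (real (Suc n) * h) *\<^sub>R y
     = ((J h ^^ n) (J h x) - J h x - (real n * h) *\<^sub>R J h y) + (real n * h + h) *\<^sub>R (J h y - y)"
    using J_step[OF Suc.prems(1,3)] by (simp add: funpow_swap1 algebra_simps)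
  also have "norm \<dots> \<le> (real n * h)\<^sup>2 * norm (J h w) + (real n * h + h) * (h * norm w)"
  proof (intro order_trans[OF norm_triangle_ineq] add_mono
      Suc.IH[OF J_G[OF Suc.prems(1,3)] J_G[OF Suc.prems(2,3)] Suc.prems(3)])
    show "norm ((real n * h + h) *\<^sub>R (J h y - y)) \<le> (real n * h + h) * (h * norm w)"
      using J_step_norm[OF Suc.prems(2,3)] Suc.prems(3) by (simp add: mult_left_mono)
  qed
  also have "\<dots> \<le> (real n * h)\<^sup>2 * norm w + (real n * h + h) * (h * norm w)"
    using Suc.prems by (intro add_mono mult_left_mono J_norm) auto
  \<comment> \<open>The two sides differ by \<open>real n * h\<^sup>2 * norm w\<close>; the constant
    1 in place of the sharp 1/2 leaves this room and keeps the induction simple.\<close>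
  also have "\<dots> \<le> (real (Suc n) * h)\<^sup>2 * norm w"
  proof -
    have "0 \<le> real n * h\<^sup>2 * norm w" by simp
    then show ?thesis by (simp add: algebra_simps power2_eq_square)
  qed
  finally show ?case .
qed simp

text \<open>Backward Euler with step \<open>1 / 2 ^ k\<close>, evaluated at the last grid point not
  after \<open>t\<close>. Grids are nested in \<open>k\<close>, which makes consecutive
  approximations comparable.\<close>

definition euler :: "'a \<Rightarrow> real \<Rightarrow> nat \<Rightarrow> 'a" where "euler x t k = (J (1 / 2 ^ k) ^^ nat \<lfloor>t * 2 ^ k\<rfloor>) x"

text \<open>The term with \<open>w\<close> is the accumulated error of halving the completed steps;
  the term with \<open>y\<close> is the one additional half step that may occur.\<close>

lemma euler_step:
  assumes "(x, y) \<in> G" "(y, w) \<in> G" "0 \<le> t"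
  shows "norm (euler x t (Suc k) - euler x t k) \<le> (t * norm w / 4 + norm y / 2) / 2 ^ k"
proof -
  define h :: real where "h = 1 / 2 ^ k"
  have h: "0 < h" "0 < h / 2" by (simp_all add: h_def)
  define N where "N = nat \<lfloor>t * 2 ^ k\<rfloor>"
  have Nh: "real N * h \<le> t" using assms(3) by (simp add: N_def h_def field_simps)
  let ?E = "(J (h/2) ^^ (2 * N)) x"
  have 1: "norm (euler x t (Suc k) - ?E) \<le> h / 2 * norm y"
  proof -
    consider "nat \<lfloor>t * 2 ^ Suc k\<rfloor> = 2 * N" | "nat \<lfloor>t * 2 ^ Suc k\<rfloor> = Suc (2 * N)"
      using nat_floor_double[OF assms(3), of k] by (auto simp: N_def)
    then show ?thesis
    proof cases
      case 1
      then show ?thesis unfolding euler_def 1 using h by (simp add: h_def mult.commute)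
    next
      case 2
      have "euler x t (Suc k) - ?E = (J (h/2) ^^ (2 * N)) (J (h/2) x - x)"
        unfolding euler_def 2 using h(2) by (simp add: Jn_diff funpow_swap1) (simp add: h_def mult.commute)
      then show ?thesis
        using order_trans[OF Jn_norm[OF h(2)] J_step_norm[OF assms(1) h(2)]] by simp
    qed
  qed
  have "norm (euler x t k - ?E) \<le> real N * (h\<^sup>2 / 4 * norm w)"
    using Jn_half_step_error[OF assms(1,2) h(1), of N] by (simp add: euler_def N_def h_def)
  also have "\<dots> = (real N * h) * (h / 4 * norm w)" by (simp add: power2_eq_square)
  also have "\<dots> \<le> t * (h / 4 * norm w)"
    using Nh h by (intro mult_right_mono) auto
  finally have 2: "norm (euler x t k - ?E) \<le> t * (h / 4 * norm w)" .
  have "norm (euler x t (Suc k) - euler x t k) \<le> h / 2 * norm y + t * (h / 4 * norm w)"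
    using norm_triangle_ineq4[of "euler x t (Suc k) - ?E" "euler x t k - ?E"] 1 2 by simp
  also have "\<dots> = (t * norm w / 4 + norm y / 2) / 2 ^ k" by (simp add: h_def field_simps)
  finally show ?thesis .
qed

lemma euler_tendsto:
  assumes "(x, y) \<in> G" "(y, w) \<in> G" "0 \<le> t"
  shows "euler x t \<longlonglongrightarrow> lim (euler x t)"
  using convergent_of_geometric_steps[of "euler x t", OF euler_step[OF assms]]
  by (simp add: convergent_LIMSEQ_iff)

text \<open>The steps up to time \<open>t\<close> form a contraction that factors out of the
  remainder, leaving the discrete Taylor estimate from time zero. Three levels of the domain are
  assumed so that the approximations starting at \<open>y\<close> converge as well.\<close>

lemma euler_limit_taylor:
  assumes G: "(x, y) \<in> G" "(y, w) \<in> G" "(w, q) \<in> G" and st: "0 \<le> t" "t \<le> s"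
  shows "norm (lim (euler x s) - lim (euler x t) - (s - t) *\<^sub>R lim (euler y t)) \<le> (s - t)\<^sup>2 * norm w"
proof -
  define d where "d k = real (nat \<lfloor>s * 2 ^ k\<rfloor>) * (1 / 2 ^ k) - real (nat \<lfloor>t * 2 ^ k\<rfloor>) * (1 / 2 ^ k)" for k :: nat
  have d: "d \<longlonglongrightarrow> s - t"
    unfolding d_def using st by (intro tendsto_diff floor_dyadic_tendsto) auto
  have *: "norm (euler x s k - euler x t k - d k *\<^sub>R euler y t k) \<le> (d k)\<^sup>2 * norm w" for k
  proof -
    define m n h where "m = nat \<lfloor>t * 2 ^ k\<rfloor>" and "n = nat \<lfloor>s * 2 ^ k\<rfloor>" and "h = 1 / (2::real) ^ k"
    have h: "h > 0" by (simp add: h_def)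
    have mn: "m \<le> n" using st by (auto simp: m_def n_def intro!: nat_mono floor_mono)
    have dk: "d k = real (n - m) * h" using mn by (simp add: d_def m_def n_def h_def algebra_simps of_nat_diff)
    have "(J h ^^ n) x = (J h ^^ m) ((J h ^^ (n - m)) x)"
      using mn by (metis comp_apply funpow_add le_add_diff_inverse)
    then have "euler x s k - euler x t k - d k *\<^sub>R euler y t k
        = (J h ^^ m) ((J h ^^ (n - m)) x - x - (real (n - m) * h) *\<^sub>R y)"
      by (simp add: euler_def dk Jn_diff[OF h] Jn_scale[OF h] flip: m_def n_def h_def)
    then show ?thesis
      using order_trans[OF Jn_norm[OF h] Jn_taylor[OF G(1,2) h]] by (simp add: dk)
  qed
  show ?thesis
  proof (rule tendsto_le[OF sequentially_bot])
    show "(\<lambda>k. (d k)\<^sup>2 * norm w) \<longlonglongrightarrow> (s - t)\<^sup>2 * norm w"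
      by (intro tendsto_intros d)
    show "(\<lambda>k. norm (euler x s k - euler x t k - d k *\<^sub>R euler y t k))
        \<longlonglongrightarrow> norm (lim (euler x s) - lim (euler x t) - (s - t) *\<^sub>R lim (euler y t))"
      using st by (intro tendsto_norm tendsto_diff tendsto_scaleR d
          euler_tendsto[OF G(1,2)] euler_tendsto[OF G(2,3)]) auto
  qed (simp add: *)
qed

lemma euler_limit_lipschitz:
  assumes G: "(x, y) \<in> G" "(y, w) \<in> G" and st: "0 \<le> t" "t \<le> s"
  shows "norm (lim (euler x s) - lim (euler x t)) \<le> norm y * (s - t)"
proof -
  define d where "d k = real (nat \<lfloor>s * 2 ^ k\<rfloor>) * (1 / 2 ^ k) - real (nat \<lfloor>t * 2 ^ k\<rfloor>) * (1 / 2 ^ k)" for k :: nat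
  have *: "norm (euler x s k - euler x t k) \<le> norm y * d k" for k
  proof -
    define m n h where "m = nat \<lfloor>t * 2 ^ k\<rfloor>" and "n = nat \<lfloor>s * 2 ^ k\<rfloor>" and "h = 1 / (2::real) ^ k"
    have h: "h > 0" by (simp add: h_def)
    have mn: "m \<le> n" using st by (auto simp: m_def n_def intro!: nat_mono floor_mono)
    have dk: "d k = real (n - m) * h" using mn by (simp add: d_def m_def n_def h_def algebra_simps of_nat_diff)
    have "(J h ^^ n) x = (J h ^^ m) ((J h ^^ (n - m)) x)"
      using mn by (metis comp_apply funpow_add le_add_diff_inverse)
    then have "euler x s k - euler x t k = (J h ^^ m) ((J h ^^ (n - m)) x - x)"
      by (simp add: euler_def Jn_diff[OF h] flip: m_def n_def h_def)
    then show ?thesis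
      using order_trans[OF Jn_norm[OF h] Jn_step_norm[OF G(1) h], of m "n - m"]
      by (simp add: dk ac_simps)
  qed
  show ?thesis
  proof (rule tendsto_le[OF sequentially_bot])
    show "(\<lambda>k. norm y * d k) \<longlonglongrightarrow> norm y * (s - t)"
      unfolding d_def using st by (intro tendsto_mult tendsto_const tendsto_diff floor_dyadic_tendsto) auto
    show "(\<lambda>k. norm (euler x s k - euler x t k)) \<longlonglongrightarrow> norm (lim (euler x s) - lim (euler x t))"
      using st by (intro tendsto_norm tendsto_diff euler_tendsto[OF G]) auto
  qed (simp add: *)
qed

section \<open>Strong solutions for data in the domain\<close>

text \<open>Solution and derivative are the Euler limits starting at \<open>x\<close> and at
  \<open>y\<close>. The bound on \<open>v\<close> is recorded because, applied to a difference of
  two solutions, it becomes the Cauchy estimate for approximation by smooth data.\<close>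

lemma smooth_solution:
  assumes G: "(x, y) \<in> G" "(y, w) \<in> G" "(w, q) \<in> G"
  shows "\<exists>u v. u 0 = x \<and> (\<forall>t\<ge>0. (u t, v t) \<in> G \<and> norm (v t) \<le> norm y \<and>
     (u has_vector_derivative v t) (at t within {0..})) \<and> continuous_on {0..} v"
proof (intro exI conjI allI impI)
  let ?u = "\<lambda>t. lim (euler x t)" and ?v = "\<lambda>t. lim (euler y t)"
  have "euler x 0 = (\<lambda>k. x)" by (simp add: euler_def fun_eq_iff)
  then show "?u 0 = x" by (simp add: limI)
  show "continuous_on {0..} ?v"
  proof (rule lipschitz_on_continuous_on)
    show "(norm w)-lipschitz_on {0..} ?v"
      by (rule lipschitz_on_leI)
        (use euler_limit_lipschitz[OF G(2,3)] in \<open>auto simp: dist_norm norm_minus_commute\<close>)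
  qed
  fix t :: real assume t: "t \<ge> 0"
  show "(?u t, ?v t) \<in> G"
    by (rule closed_G[OF euler_tendsto[OF G(1,2) t] euler_tendsto[OF G(2,3) t]])
      (simp add: euler_def Jn_G G)
  show "norm (?v t) \<le> norm y"
    by (rule Lim_bounded[OF tendsto_norm[OF euler_tendsto[OF G(2,3) t]], of 0])
      (auto simp: euler_def Jn_norm)
  show "(?u has_vector_derivative ?v t) (at t within {0..})"
    by (rule quadratic_remainder_derivative[where C = "norm w", OF _ _ t])
      (use euler_limit_taylor[OF G] euler_limit_lipschitz[OF G(2,3)] in \<open>auto simp: mult.commute\<close>)
qed

lemma strong_solution_unique:
  assumes u: "\<And>t. t \<ge> 0 \<Longrightarrow> (u t, v t) \<in> G"
      "\<And>t. t \<ge> 0 \<Longrightarrow> (u has_vector_derivative v t) (at t within {0..})"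
    and u': "\<And>t. t \<ge> 0 \<Longrightarrow> (u' t, v' t) \<in> G"
      "\<And>t. t \<ge> 0 \<Longrightarrow> (u' has_vector_derivative v' t) (at t within {0..})"
    and "u 0 = u' 0" "t \<ge> 0"
  shows "u t = u' t"
proof -
  have "u t - u' t = 0"
  proof (rule dissipative_gronwall[where w = 0 and d = "\<lambda>t. u t - u' t" and e = "\<lambda>t. v t - v' t"])
    fix t :: real assume t: "t \<ge> 0"
    show "((\<lambda>t. u t - u' t) has_vector_derivative v t - v' t) (at t within {0..})"
      by (intro has_vector_derivative_diff u(2) u'(2) t)
    show "inner (u t - u' t) (v t - v' t) \<le> 0 * inner (u t - u' t) (u t - u' t)"
      using dissipative[OF G_diff[OF u(1) u'(1), OF t t]] by simp
  qed (use assms in auto)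
  then show ?thesis by simp
qed

text \<open>Two resolvents send any vector into the domain of A^2. If \<open>(x, y) \<in> G\<close>,
  the images of \<open>x\<close> and \<open>y\<close> are again related by \<open>G\<close>, so the
  image of \<open>x\<close> lies in the domain of A^3, as \<open>smooth_solution\<close>
  demands.\<close>

lemma J_J_tendsto: "(\<lambda>n. J (1 / real (Suc n)) (J (1 / real (Suc n)) x)) \<longlonglongrightarrow> x"
proof -
  have "(\<lambda>n. J (1 / real (Suc n)) (J (1 / real (Suc n)) x - x)) \<longlonglongrightarrow> 0"
  proof (rule Lim_null_comparison)
    show "\<forall>\<^sub>F n in sequentially. norm (J (1 / real (Suc n)) (J (1 / real (Suc n)) x - x))
        \<le> norm (J (1 / real (Suc n)) x - x)"
      by (intro always_eventually allI J_norm) simp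
    show "(\<lambda>n. norm (J (1 / real (Suc n)) x - x)) \<longlonglongrightarrow> 0"
      using J_tendsto[of x] by (simp add: tendsto_norm_zero_iff LIM_zero_iff del: of_nat_Suc)
  qed
  from tendsto_add[OF this J_tendsto[of x]] show ?thesis by (simp add: J_diff del: of_nat_Suc)
qed

theorem strong_solution:
  assumes xy: "(x, y) \<in> G"
  shows "\<exists>u v. u 0 = x \<and> (\<forall>t\<ge>0. (u t, v t) \<in> G \<and>
     (u has_vector_derivative v t) (at t within {0..})) \<and> continuous_on {0..} v"
proof -
  define K where "K n f = J (1 / real (Suc n)) (J (1 / real (Suc n)) f)" for n f
  have KG: "(K n p, K n p') \<in> G" if "(p, p') \<in> G" for n p p'
    unfolding K_def using that by (intro J_G) auto
  have Kdom: "\<exists>w q. (K n p, w) \<in> G \<and> (w, q) \<in> G" for n p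
  proof -
    define h where "h = 1 / real (Suc n)"
    have h: "h > 0" by (simp add: h_def)
    have "(K n p, J h ((1 / h) *\<^sub>R (J h p - p))) \<in> G"
      unfolding K_def h_def[symmetric] by (intro J_G J_graph h)
    then show ?thesis using J_graph[OF h] by blast
  qed
  have Kx: "(\<lambda>n. K n p) \<longlonglongrightarrow> p" for p unfolding K_def by (rule J_J_tendsto)
  have ex: "\<exists>u v. u 0 = p \<and> (\<forall>t\<ge>0. (u t, v t) \<in> G \<and> norm (v t) \<le> norm p' \<and>
     (u has_vector_derivative v t) (at t within {0..})) \<and> continuous_on {0..} v"
    if "(p, p') \<in> G" "(p', w) \<in> G" "(w, q) \<in> G" for p p' w q
    using smooth_solution[OF that] .
  have "\<forall>n. \<exists>u v. u 0 = K n x \<and> (\<forall>t\<ge>0. (u t, v t) \<in> G \<and> norm (v t) \<le> norm (K n y) \<and>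
     (u has_vector_derivative v t) (at t within {0..})) \<and> continuous_on {0..} v"
    using ex[OF KG[OF xy]] Kdom by metis
  then obtain u v where u0: "\<And>n. u n 0 = K n x"
    and uvG: "\<And>n t. t \<ge> 0 \<Longrightarrow> (u n t, v n t) \<in> G"
    and der: "\<And>n t. t \<ge> 0 \<Longrightarrow> (u n has_vector_derivative v n t) (at t within {0..})"
    and cont: "\<And>n. continuous_on {0..} (v n)"
    by metis
  \<comment> \<open>The smooth solution \<open>a\<close> with the difference of the initial data
    equals \<open>u m - u n\<close> by uniqueness, so single-valuedness of \<open>G\<close> makes
    its derivative \<open>v m - v n\<close>.\<close>
  have vdiff: "norm (v m t - v n t) \<le> norm (K m y - K n y)" if "t \<ge> 0" for m n t
  proof -
    obtain w q where wq: "(K m y, w) \<in> G" "(w, q) \<in> G" using Kdom by blast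
    obtain w' q' where wq': "(K n y, w') \<in> G" "(w', q') \<in> G" using Kdom by blast
    obtain a b where ab: "a 0 = K m x - K n x"
      "\<And>t. t \<ge> 0 \<Longrightarrow> (a t, b t) \<in> G" "\<And>t. t \<ge> 0 \<Longrightarrow> norm (b t) \<le> norm (K m y - K n y)"
      "\<And>t. t \<ge> 0 \<Longrightarrow> (a has_vector_derivative b t) (at t within {0..})"
      using ex[OF G_diff[OF KG[OF xy] KG[OF xy]] G_diff[OF wq(1) wq'(1)] G_diff[OF wq(2) wq'(2)]]
      by metis
    have "a t = u m t - u n t"
      by (rule strong_solution_unique[OF ab(2,4), where u' = "\<lambda>t. u m t - u n t" and v' = "\<lambda>t. v m t - v n t"])
        (use that in \<open>auto simp: ab(1) u0 intro!: G_diff uvG has_vector_derivative_diff der\<close>)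
    then have "b t = v m t - v n t"
      using G_unique ab(2)[OF that] G_diff[OF uvG[OF that] uvG[OF that]] by metis
    then show ?thesis using ab(3)[OF that] by simp
  qed
  have Cy: "Cauchy (\<lambda>n. K n y)" using Kx LIMSEQ_imp_Cauchy by blast
  have "Cauchy (\<lambda>n. v n t)" if "t \<ge> 0" for t
    using Cy vdiff[OF that] unfolding Cauchy_def dist_norm by (meson order_le_less_trans)
  then have "\<forall>t. \<exists>l. t \<ge> 0 \<longrightarrow> (\<lambda>n. v n t) \<longlonglongrightarrow> l"
    using Cauchy_convergent convergent_def by blast
  then obtain V where V: "\<And>t. t \<ge> 0 \<Longrightarrow> (\<lambda>n. v n t) \<longlonglongrightarrow> V t" by metis
  \<comment> \<open>Let \<open>m\<close> tend to infinity in \<open>vdiff\<close>. The bound is free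
    of \<open>t\<close>, so the derivatives converge uniformly on the half line, which allows
    differentiation of the limit.\<close>
  have vV: "norm (v n t - V t) \<le> norm (K n y - y)" if "t \<ge> 0" for n t
    by (rule tendsto_le[OF sequentially_bot, of "\<lambda>m. norm (K n y - K m y)" _ "\<lambda>m. norm (v n t - v m t)"])
      (use that in \<open>auto intro!: tendsto_norm tendsto_diff V Kx vdiff always_eventually\<close>)
  have unif: "\<forall>\<^sub>F n in sequentially. \<forall>t\<in>{0..}. norm (v n t - V t) \<le> e" if "e > 0" for e
  proof -
    have "\<forall>\<^sub>F n in sequentially. dist (K n y) y < e" using Kx that by (rule tendstoD)
    then show ?thesis
    proof (rule eventually_mono, intro ballI)
      fix n and t :: real assume "dist (K n y) y < e" "t \<in> {0..}"
      then show "norm (v n t - V t) \<le> e" using vV[of t n] by (simp add: dist_norm)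
    qed
  qed
  have "\<exists>U. \<forall>t\<in>{0..}. (\<lambda>n. u n t) \<longlonglongrightarrow> U t \<and> (U has_derivative (\<lambda>h. h *\<^sub>R V t)) (at t within {0..})"
  proof (rule has_derivative_sequence[where f' = "\<lambda>n t h. h *\<^sub>R v n t" and ?x0.0 = 0 and l = x])
    show "(u n has_derivative (\<lambda>h. h *\<^sub>R v n t)) (at t within {0..})" if "t \<in> {0..}" for n t
      using der[of t n] that by (simp add: has_vector_derivative_def)
    fix e :: real assume "e > 0"
    from unif[OF this] show "\<forall>\<^sub>F n in sequentially. \<forall>t\<in>{0..}. \<forall>h. norm (h *\<^sub>R v n t - h *\<^sub>R V t) \<le> e * norm h"
    proof (rule eventually_mono, intro ballI allI)
      fix n and t h :: real assume "\<forall>t\<in>{0..}. norm (v n t - V t) \<le> e" "t \<in> {0..}"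
      then show "norm (h *\<^sub>R v n t - h *\<^sub>R V t) \<le> e * norm h"
        by (simp add: mult.commute[of e] mult_left_mono flip: scaleR_diff_right)
    qed
  qed (auto simp: u0 Kx)
  then obtain U where U: "\<And>t. t \<ge> 0 \<Longrightarrow> (\<lambda>n. u n t) \<longlonglongrightarrow> U t"
      "\<And>t. t \<ge> 0 \<Longrightarrow> (U has_vector_derivative V t) (at t within {0..})"
    unfolding has_vector_derivative_def by auto
  have "U 0 = x" using U(1)[of 0] Kx LIMSEQ_unique by (auto simp: u0)
  moreover have "(U t, V t) \<in> G" if "t \<ge> 0" for t
    using closed_G[OF U(1)[OF that] V[OF that] uvG[OF that]] .
  moreover have "continuous_on {0..} V"
  proof (rule uniform_limit_theorem[where f = v])
    show "uniform_limit {0..} v V sequentially"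
    proof (rule uniform_limitI)
      fix e :: real assume "e > 0"
      then have e: "e / 2 > 0" "e / 2 < e" by auto
      show "\<forall>\<^sub>F n in sequentially. \<forall>t\<in>{0..}. dist (v n t) (V t) < e"
        using unif[OF e(1)] by (rule eventually_mono) (use e(2) in \<open>simp only: dist_norm, blast intro: order_le_less_trans\<close>)
    qed
  qed (auto simp: cont)
  ultimately show ?thesis using U(2) by blast
qed

end

section \<open>Quasi-dissipative operators and mild solutions\<close>

lemma at_within_atLeast_neq_bot: "at t within {0..} \<noteq> bot" if "t \<ge> 0" for t :: real
proof -
  have "at_right t \<le> at t within {0..}" using that by (intro at_le) auto
  then show ?thesis using trivial_limit_at_right_real[of t] bot.extremum_uniqueI by metis
qed

lemma integral_has_vector_derivative_atLeast:
  fixes u :: "real \<Rightarrow> 'a::banach"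
  assumes u: "continuous_on {0..} u" and t: "t \<ge> 0"
  shows "((\<lambda>t. integral {0..t} u) has_vector_derivative u t) (at t within {0..})"
proof -
  have "((\<lambda>t. integral {0..t} u) has_vector_derivative u t) (at t within {0..t+1})"
    by (rule integral_has_vector_derivative) (use t in \<open>auto intro: continuous_on_subset[OF u]\<close>)
  moreover have "at t within {0..t+1} = at t within {0..}"
    by (rule at_within_nhd[of t "{..<t+1}"]) auto
  ultimately show ?thesis by simp
qed

locale quasi_m_dissipative = linear_graph G
  for G :: "('a::{real_inner,banach} \<times> 'a) set" +
  fixes w :: real
  assumes w_nonneg: "w \<ge> 0"
    and single: "(0, y) \<in> G \<Longrightarrow> y = 0"
    and quasi_dissipative: "(x, y) \<in> G \<Longrightarrow> inner x y \<le> w * inner x x"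
    and range: "0 < h \<Longrightarrow> h * w < 1 \<Longrightarrow> \<exists>x y. (x, y) \<in> G \<and> x - h *\<^sub>R y = f"
begin

text \<open>The graph of \<open>A - w\<close>, which is dissipative in the strict sense.\<close>

definition "shifted = {(x, y - w *\<^sub>R x) | x y. (x, y) \<in> G}"

lemma shifted_iff: "(x, y) \<in> shifted \<longleftrightarrow> (x, y + w *\<^sub>R x) \<in> G"
  unfolding shifted_def by force

sublocale shift: m_dissipative shifted
proof
  show "subspace shifted"
  proof (rule subspaceI)
    show "0 \<in> shifted" using subspace_0[OF subspace_G] by (simp add: shifted_iff zero_prod_def)
    show "p + q \<in> shifted" if "p \<in> shifted" "q \<in> shifted" for p q
      using that G_add by (cases p; cases q) (force simp: shifted_iff algebra_simps)
    show "r *\<^sub>R p \<in> shifted" if "p \<in> shifted" for r p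
      using that G_scale[of "fst p" "snd p + w *\<^sub>R fst p" r]
      by (cases p) (simp add: shifted_iff algebra_simps)
  qed
  show "y = 0" if "(0, y) \<in> shifted" for y using that single by (simp add: shifted_iff)
  show "inner x y \<le> 0" if "(x, y) \<in> shifted" for x y
    using quasi_dissipative[OF that[unfolded shifted_iff]] by (simp add: inner_add_right)
  fix h :: real and f :: 'a assume h: "0 < h"
  \<comment> \<open>Since \<open>x - h *\<^sub>R (y - w *\<^sub>R x) = (1 + h * w) *\<^sub>R (x - k
    *\<^sub>R y)\<close>, the equation for the shifted operator with any step \<open>h\<close>
    becomes one for \<open>G\<close> with a step satisfying \<open>k * w < 1\<close>.\<close>
  define k where "k = h / (1 + h * w)"
  have p: "0 < 1 + h * w" using h w_nonneg by (simp add: add_pos_nonneg)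
  have k: "0 < k" "k * w < 1" using h w_nonneg p by (auto simp: k_def field_simps)
  obtain x y where xy: "(x, y) \<in> G" "x - k *\<^sub>R y = (1 / (1 + h * w)) *\<^sub>R f" using range[OF k] by blast
  have "(1 + h * w) * k = h" using p by (simp add: k_def)
  then have "x - h *\<^sub>R (y - w *\<^sub>R x) = (1 + h * w) *\<^sub>R (x - k *\<^sub>R y)"
    by (simp add: scaleR_diff_right scaleR_add_left)
  also have "\<dots> = f" using p by (simp add: xy(2))
  finally show "\<exists>x y. (x, y) \<in> shifted \<and> x - h *\<^sub>R y = f"
    using xy(1) by (intro exI[of _ x] exI[of _ "y - w *\<^sub>R x"]) (simp add: shifted_iff)
qed

text \<open>If \<open>u\<close> solves the equation for \<open>A - w\<close>, then
  \<open>exp (w * t) *\<^sub>R u t\<close> solves the one for \<open>A\<close>.\<close>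

theorem strong_solution:
  assumes "(x, y) \<in> G"
  shows "\<exists>u v. u 0 = x \<and> (\<forall>t\<ge>0. (u t, v t) \<in> G \<and>
     (u has_vector_derivative v t) (at t within {0..})) \<and> continuous_on {0..} v"
proof -
  have "(x, y - w *\<^sub>R x) \<in> shifted" using assms by (simp add: shifted_iff)
  from shift.strong_solution[OF this] obtain u v where uv: "u 0 = x"
      "\<And>t. t \<ge> 0 \<Longrightarrow> (u t, v t) \<in> shifted"
      "\<And>t. t \<ge> 0 \<Longrightarrow> (u has_vector_derivative v t) (at t within {0..})" "continuous_on {0..} v"
    by blast
  have cu: "continuous_on {0..} u"
    unfolding continuous_on_eq_continuous_within
    using uv(3) has_vector_derivative_continuous by blast
  show ?thesis
  proof (intro exI conjI allI impI)
    show "exp (w * 0) *\<^sub>R u 0 = x" using uv(1) by simp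
    show "continuous_on {0..} (\<lambda>t. exp (w * t) *\<^sub>R (v t + w *\<^sub>R u t))"
      by (intro continuous_intros uv(4) cu)
    fix t :: real assume t: "t \<ge> 0"
    show "(exp (w * t) *\<^sub>R u t, exp (w * t) *\<^sub>R (v t + w *\<^sub>R u t)) \<in> G"
      using uv(2)[OF t] by (intro G_scale) (simp add: shifted_iff)
    have "((\<lambda>t. exp (w * t)) has_real_derivative exp (w * t) * w) (at t within {0..})"
      by (rule derivative_eq_intros refl)+ simp
    from has_vector_derivative_scaleR[OF this uv(3)[OF t]]
    show "((\<lambda>t. exp (w * t) *\<^sub>R u t) has_vector_derivative exp (w * t) *\<^sub>R (v t + w *\<^sub>R u t)) (at t within {0..})"
      by (simp add: algebra_simps)
  qed
qed

theorem strong_solution_zero: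
  assumes "\<And>t. t \<ge> 0 \<Longrightarrow> (u t, v t) \<in> G"
    and "\<And>t. t \<ge> 0 \<Longrightarrow> (u has_vector_derivative v t) (at t within {0..})"
    and "u 0 = 0" "t \<ge> 0"
  shows "u t = 0"
  by (rule dissipative_gronwall[OF assms(2) quasi_dissipative[OF assms(1)]]) (use assms in auto)

text \<open>A closed operator commutes with integration. Here this reduces to pulling the bounded
  operator \<open>shift.J 1\<close> through the integral, because \<open>G\<close> is determined by
  it.\<close>

lemma integral_G:
  fixes u v :: "real \<Rightarrow> 'a"
  assumes "continuous_on {0..} u" "continuous_on {0..} v" and G: "\<And>t. t \<ge> 0 \<Longrightarrow> (u t, v t) \<in> G"
  shows "(integral {0..t} u, integral {0..t} v) \<in> G"
proof -
  let ?f = "\<lambda>s. u s - (v s - w *\<^sub>R u s)"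
  have u: "u integrable_on {0..t}" and v: "v integrable_on {0..t}"
    using assms by (auto intro!: integrable_continuous_real intro: continuous_on_subset)
  have "shift.J 1 (integral {0..t} ?f) = integral {0..t} (shift.J 1 \<circ> ?f)"
    by (rule integral_linear[OF _ shift.J_bounded_linear, symmetric])
      (auto intro!: integrable_diff integrable_cmul u v)
  also have "\<dots> = integral {0..t} u"
  proof (rule integral_cong)
    fix s assume "s \<in> {0..t}"
    then have "(u s, v s - w *\<^sub>R u s) \<in> shifted" using G[of s] by (simp add: shifted_iff)
    from shift.J_eq[OF this, of 1] show "(shift.J 1 \<circ> ?f) s = u s" by simp
  qed
  finally have J: "shift.J 1 (integral {0..t} ?f) = integral {0..t} u" .
  have "integral {0..t} ?f = integral {0..t} u - (integral {0..t} v - w *\<^sub>R integral {0..t} u)"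
    by (simp add: Henstock_Kurzweil_Integration.integral_diff integrable_diff integrable_cmul u v)
  then show ?thesis
    using shift.J_graph[of 1 "integral {0..t} ?f"] J by (simp add: shifted_iff)
qed

text \<open>The primitive of \<open>u\<close> is a strong solution with zero initial value, hence
  vanishes identically; its derivative is \<open>u\<close>.\<close>

theorem mild_solution_zero:
  fixes u :: "real \<Rightarrow> 'a"
  assumes u: "continuous_on {0..} u" and G: "\<And>t. t \<ge> 0 \<Longrightarrow> (integral {0..t} u, u t) \<in> G"
    and t: "t \<ge> 0"
  shows "u t = 0"
proof -
  let ?W = "\<lambda>t. integral {0..t} u"
  note der = integral_has_vector_derivative_atLeast[OF u]
  have W: "?W t = 0" if "t \<ge> 0" for t
    by (rule strong_solution_zero[OF G der]) (use that in auto)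
  have "((\<lambda>t. 0) has_vector_derivative u t) (at t within {0..})"
    using has_vector_derivative_transform[OF _ _ der[OF t], of "\<lambda>t. 0"] W t by auto
  then show ?thesis
    using vector_derivative_unique_within[of t "{0..}" "\<lambda>t. 0" "u t" 0] t
      trivial_limit_within[of t "{0..}"] by (auto simp: at_within_atLeast_neq_bot)
qed

theorem mild_solution:
  "\<exists>u::real \<Rightarrow> 'a. continuous_on {0..} u \<and> u 0 = x \<and> (\<forall>t\<ge>0. (integral {0..t} u, u t - x) \<in> G)"
proof -
  \<comment> \<open>Any positive \<open>h\<close> with \<open>h * w < 1\<close> would do; this
    choice also covers \<open>w = 0\<close>.\<close>
  define h where "h = 1 / (w + 1)"
  have h: "0 < h" "h * w < 1" using w_nonneg by (auto simp: h_def field_simps)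
  obtain p p' where p: "(p, p') \<in> G" "p - h *\<^sub>R p' = x" using range[OF h] by blast
  obtain u v where uv: "u 0 = p" "\<And>t. t \<ge> 0 \<Longrightarrow> (u t, v t) \<in> G"
      "\<And>t. t \<ge> 0 \<Longrightarrow> (u has_vector_derivative v t) (at t within {0..})" "continuous_on {0..} v"
    using strong_solution[OF p(1)] by metis
  have cu: "continuous_on {0..} u"
    unfolding continuous_on_eq_continuous_within
    using uv(3) has_vector_derivative_continuous by blast
  have v0: "v 0 = p'"
    using single[of "v 0 - p'"] G_diff[OF uv(2)[of 0] p(1)] uv(1) by simp
  show ?thesis
  proof (intro exI conjI allI impI)
    show "continuous_on {0..} (\<lambda>t. u t - h *\<^sub>R v t)" by (intro continuous_intros uv(4) cu)
    show "u 0 - h *\<^sub>R v 0 = x" using p(2) uv(1) v0 by simp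
    fix t :: real assume t: "t \<ge> 0"
    have int: "u integrable_on {0..t}" "v integrable_on {0..t}"
      using cu uv(4) by (auto intro!: integrable_continuous_real intro: continuous_on_subset)
    have "(v has_integral (u t - u 0)) {0..t}"
      by (rule fundamental_theorem_of_calculus[OF t])
        (auto intro: has_vector_derivative_within_subset[OF uv(3)])
    then have iv: "integral {0..t} v = u t - p" using uv(1) by (simp add: integral_unique)
    have "integral {0..t} (\<lambda>t. u t - h *\<^sub>R v t) = integral {0..t} u - h *\<^sub>R (u t - p)"
      by (simp add: Henstock_Kurzweil_Integration.integral_diff integrable_cmul int iv)
    \<comment> \<open>The integrated equation for \<open>u\<close>, minus \<open>h\<close> times the
      difference of the equations at time \<open>t\<close> and at time zero.\<close>
    moreover have "(integral {0..t} u - h *\<^sub>R (u t - p), (u t - p) - h *\<^sub>R (v t - p')) \<in> G"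
      using integral_G[OF cu uv(4,2), of t] unfolding iv
      by (intro G_diff G_scale uv(2) p(1) t)
    moreover have "(u t - p) - h *\<^sub>R (v t - p') = u t - h *\<^sub>R v t - x"
      using p(2) by (simp add: algebra_simps)
    ultimately show "(integral {0..t} (\<lambda>t. u t - h *\<^sub>R v t), u t - h *\<^sub>R v t - x) \<in> G" by simp
  qed
qed

end

section \<open>The Hilbert space of square integrable functions\<close>

definition sqint :: "(real \<Rightarrow> real) \<Rightarrow> bool" where
  "sqint f \<longleftrightarrow> f \<in> borel_measurable lebesgue \<and> integrable lebesgue (\<lambda>x. (f x)\<^sup>2)"

lemma sqint_mult:
  assumes "sqint f" "sqint g"
  shows "integrable lebesgue (\<lambda>x. f x * g x)"
proof (rule Bochner_Integration.integrable_bound)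
  show "integrable lebesgue (\<lambda>x. (f x)\<^sup>2 + (g x)\<^sup>2)" using assms by (simp add: sqint_def)
  show "(\<lambda>x. f x * g x) \<in> borel_measurable lebesgue"
    using assms by (intro borel_measurable_times) (auto simp: sqint_def)
  have "\<bar>a * b\<bar> \<le> a\<^sup>2 + b\<^sup>2" for a b :: real
    using sum_squares_bound[of a b] sum_squares_bound[of a "-b"] zero_le_power2[of a] zero_le_power2[of b]
    unfolding abs_le_iff by auto
  then show "AE x in lebesgue. norm (f x * g x) \<le> norm ((f x)\<^sup>2 + (g x)\<^sup>2)" by simp
qed

lemma sqint_0: "sqint (\<lambda>x. 0)" by (simp add: sqint_def)

lemma sqint_add: "sqint f \<Longrightarrow> sqint g \<Longrightarrow> sqint (\<lambda>x. f x + g x)"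
  using sqint_mult[of f g]
  by (auto simp: sqint_def power2_sum mult.assoc intro!: borel_measurable_add)

lemma sqint_scale: "sqint f \<Longrightarrow> sqint (\<lambda>x. r * f x)"
  by (auto simp: sqint_def power_mult_distrib intro!: borel_measurable_times)

lemma sqint_uminus: "sqint f \<Longrightarrow> sqint (\<lambda>x. - f x)"
  by (simp add: sqint_def)

lemma sqint_diff: "sqint f \<Longrightarrow> sqint g \<Longrightarrow> sqint (\<lambda>x. f x - g x)"
  using sqint_add[of f "\<lambda>x. - g x"] sqint_uminus[of g] by simp

\<comment> \<open>Square integrability sits in the partial equivalence relation, so that other
  functions represent no element and classes are taken modulo null sets at once.\<close>
quotient_type lsq = "real \<Rightarrow> real" / partial: "\<lambda>f g. sqint f \<and> sqint g \<and> (AE x in lebesgue. f x = g x)"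
  morphisms rep_lsq abs_lsq
proof (rule part_equivpI)
  show "\<exists>f. sqint f \<and> sqint f \<and> (AE x in lebesgue. f x = f x)" using sqint_0 by auto
  show "symp (\<lambda>f g. sqint f \<and> sqint g \<and> (AE x in lebesgue. f x = g x))"
    by (auto intro!: sympI simp: eq_commute)
  show "transp (\<lambda>f g. sqint f \<and> sqint g \<and> (AE x in lebesgue. f x = g x))"
    by (rule transpI) (auto elim: eventually_elim2)
qed

instantiation lsq :: real_vector begin

lift_definition zero_lsq :: lsq is "\<lambda>x. 0" by (simp add: sqint_0)

lift_definition plus_lsq :: "lsq \<Rightarrow> lsq \<Rightarrow> lsq" is "\<lambda>f g x. f x + g x"
  by (auto intro: sqint_add elim: eventually_elim2)

lift_definition minus_lsq :: "lsq \<Rightarrow> lsq \<Rightarrow> lsq" is "\<lambda>f g x. f x - g x"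
  by (auto intro: sqint_diff elim: eventually_elim2)

lift_definition uminus_lsq :: "lsq \<Rightarrow> lsq" is "\<lambda>f x. - f x"
  by (auto intro: sqint_uminus)

lift_definition scaleR_lsq :: "real \<Rightarrow> lsq \<Rightarrow> lsq" is "\<lambda>r f x. r * f x"
  by (auto intro: sqint_scale elim: eventually_mono)

instance
  by (standard; transfer)
    (auto simp: algebra_simps sqint_0 intro: sqint_add sqint_scale sqint_uminus sqint_diff)

end

instantiation lsq :: real_inner begin

lift_definition inner_lsq :: "lsq \<Rightarrow> lsq \<Rightarrow> real" is "\<lambda>f g. integral\<^sup>L lebesgue (\<lambda>x. f x * g x)"
  by (rule integral_cong_AE) (auto simp: sqint_def elim: eventually_elim2)

definition norm_lsq :: "lsq \<Rightarrow> real" where "norm_lsq x = sqrt (inner x x)"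
definition sgn_lsq :: "lsq \<Rightarrow> lsq" where "sgn_lsq x = x /\<^sub>R norm x"
definition dist_lsq :: "lsq \<Rightarrow> lsq \<Rightarrow> real" where "dist_lsq x y = norm (x - y)"
definition uniformity_lsq :: "(lsq \<times> lsq) filter" where
  "uniformity_lsq = (INF e\<in>{0<..}. principal {(x, y). dist x y < e})"
definition open_lsq :: "lsq set \<Rightarrow> bool" where
  "open_lsq S \<longleftrightarrow> (\<forall>x\<in>S. \<forall>\<^sub>F (x', y) in uniformity. x' = x \<longrightarrow> y \<in> S)"

instance
proof
  fix x y z :: lsq and r :: real
  show "dist x y = norm (x - y)" by (simp add: dist_lsq_def)
  show "sgn x = x /\<^sub>R norm x" by (simp add: sgn_lsq_def)
  show "uniformity = (INF e\<in>{0<..}. principal {(x::lsq, y). dist x y < e})" by (simp add: uniformity_lsq_def)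
  show "open S \<longleftrightarrow> (\<forall>x\<in>S. \<forall>\<^sub>F (x', y) in uniformity. x' = x \<longrightarrow> y \<in> S)" for S :: "lsq set"
    by (simp add: open_lsq_def)
  show "norm x = sqrt (inner x x)" by (simp add: norm_lsq_def)
  show "inner x y = inner y x" by transfer (simp add: mult.commute)
  show "inner (x + y) z = inner x z + inner y z"
    by transfer (simp add: distrib_right sqint_mult)
  show "inner (r *\<^sub>R x) y = r * inner x y" by transfer (simp add: mult.assoc)
  show "0 \<le> inner x x" by transfer (simp add: integral_nonneg_AE)
  show "inner x x = 0 \<longleftrightarrow> x = 0"
  proof transfer
    fix f assume "sqint f \<and> sqint f \<and> (AE x in lebesgue. f x = f x)"
    then have f: "sqint f" by simp
    have "(integral\<^sup>L lebesgue (\<lambda>x. f x * f x) = 0) = (AE x in lebesgue. f x * f x = 0)"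
      by (rule integral_nonneg_eq_0_iff_AE) (auto simp: sqint_mult f)
    then show "(integral\<^sup>L lebesgue (\<lambda>x. f x * f x) = 0) =
        (sqint f \<and> sqint (\<lambda>x. 0) \<and> (AE x in lebesgue. f x = 0))"
      using f sqint_0 by simp
  qed
qed

end

lemma sqint_rep: "sqint (rep_lsq X)"
  using Quotient3_rep_reflp[OF Quotient3_lsq] by blast

lemma abs_rep_lsq [simp]: "abs_lsq (rep_lsq X) = X"
  using Quotient3_abs_rep[OF Quotient3_lsq] by blast

lemma abs_lsq_eq: "sqint f \<Longrightarrow> sqint g \<Longrightarrow> abs_lsq f = abs_lsq g \<longleftrightarrow> (AE x in lebesgue. f x = g x)"
  using Quotient3_rel[OF Quotient3_lsq, of f g] by blast

lemma rep_abs_lsq: "sqint f \<Longrightarrow> AE x in lebesgue. rep_lsq (abs_lsq f) x = f x"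
  using abs_lsq_eq[OF sqint_rep, of f "abs_lsq f"] by simp

lemma abs_lsq_simps:
  assumes "sqint f" "sqint g"
  shows "abs_lsq f + abs_lsq g = abs_lsq (\<lambda>x. f x + g x)"
    "abs_lsq f - abs_lsq g = abs_lsq (\<lambda>x. f x - g x)"
    "r *\<^sub>R abs_lsq f = abs_lsq (\<lambda>x. r * f x)"
    "inner (abs_lsq f) (abs_lsq g) = integral\<^sup>L lebesgue (\<lambda>x. f x * g x)"
  using assms by (simp_all add: plus_lsq.abs_eq minus_lsq.abs_eq scaleR_lsq.abs_eq inner_lsq.abs_eq)

lemma norm_abs_lsq:
  assumes "sqint f"
  shows "(norm (abs_lsq f))\<^sup>2 = integral\<^sup>L lebesgue (\<lambda>x. (f x)\<^sup>2)"
  unfolding power2_norm_eq_inner abs_lsq_simps(4)[OF assms assms] by (simp add: power2_eq_square)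

lemma nn_integral_square:
  assumes "sqint f"
  shows "(\<integral>\<^sup>+x. ennreal ((f x)\<^sup>2) \<partial>lebesgue) = ennreal ((norm (abs_lsq f))\<^sup>2)"
  unfolding norm_abs_lsq[OF assms]
  by (rule nn_integral_eq_integral) (use assms in \<open>auto simp: sqint_def\<close>)

text \<open>Riesz--Fischer: along a subsequence with \<open>\<parallel>f\<^sub>k\<^sub>+\<^sub>1 - f\<^sub>k\<parallel>\<^sup>2 \<le> 8\<^sup>-\<^sup>k\<close> the series
  \<open>\<Sum> 4\<^sup>k (f\<^sub>k\<^sub>+\<^sub>1 - f\<^sub>k)\<^sup>2\<close> is finite almost everywhere, which forces pointwise convergence.\<close>
lemma AE_convergent_if_fast_Cauchy:
  fixes f :: "nat \<Rightarrow> real \<Rightarrow> real"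
  assumes f: "\<And>n. sqint (f n)"
    and fast: "\<And>k. (norm (abs_lsq (f (Suc k)) - abs_lsq (f k)))\<^sup>2 \<le> (1/8) ^ k"
  shows "AE x in lebesgue. convergent (\<lambda>k. f k x)"
proof -
  define d where "d k x = f (Suc k) x - f k x" for k x
  have d: "sqint (d k)" for k unfolding d_def by (intro sqint_diff f)
  then have dm[measurable]: "d k \<in> borel_measurable lebesgue" for k by (simp add: sqint_def)
  have dn: "(\<integral>\<^sup>+x. ennreal ((d k x)\<^sup>2) \<partial>lebesgue) \<le> ennreal ((1/8) ^ k)" for k
    unfolding nn_integral_square[OF d]
    using fast[of k] by (simp add: d_def[abs_def] abs_lsq_simps f ennreal_leI)
  have "(\<integral>\<^sup>+x. (\<Sum>k. ennreal (4 ^ k * (d k x)\<^sup>2)) \<partial>lebesgue)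
      = (\<Sum>k. \<integral>\<^sup>+x. ennreal (4 ^ k * (d k x)\<^sup>2) \<partial>lebesgue)"
    by (rule nn_integral_suminf) measurable
  also have "\<dots> = (\<Sum>k. ennreal (4 ^ k) * (\<integral>\<^sup>+x. ennreal ((d k x)\<^sup>2) \<partial>lebesgue))"
    by (simp add: ennreal_mult nn_integral_cmult)
  also have "\<dots> \<le> (\<Sum>k. ennreal ((1/2) ^ k))"
  proof (rule suminf_le)
    fix k
    have "ennreal (4 ^ k) * (\<integral>\<^sup>+x. ennreal ((d k x)\<^sup>2) \<partial>lebesgue) \<le> ennreal (4 ^ k) * ennreal ((1/8) ^ k)"
      by (intro mult_left_mono dn) simp
    also have "\<dots> = ennreal ((1/2) ^ k)"
      by (simp add: ennreal_mult[symmetric] power_mult_distrib[symmetric])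
    finally show "ennreal (4 ^ k) * (\<integral>\<^sup>+x. ennreal ((d k x)\<^sup>2) \<partial>lebesgue) \<le> ennreal ((1/2) ^ k)" .
  qed auto
  also have "\<dots> < \<infinity>"
    by (subst suminf_ennreal2) (auto intro!: summable_geometric)
  finally have "AE x in lebesgue. (\<Sum>k. ennreal (4 ^ k * (d k x)\<^sup>2)) \<noteq> \<infinity>"
    by (intro nn_integral_PInf_AE) auto
  then show ?thesis
  proof eventually_elim
    fix x assume fin: "(\<Sum>k. ennreal (4 ^ k * (d k x)\<^sup>2)) \<noteq> \<infinity>"
    define g where "g k = ennreal (4 ^ k * (d k x)\<^sup>2)" for k
    define S where "S = enn2real (\<Sum>k. g k)"
    have S: "4 ^ k * (d k x)\<^sup>2 \<le> S" for k
    proof -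
      have "sum g {k} \<le> (\<Sum>k. g k)" by (rule sum_le_suminf) auto
      moreover have "(\<Sum>k. g k) = ennreal S" using fin by (simp add: S_def g_def)
      ultimately have "ennreal (4 ^ k * (d k x)\<^sup>2) \<le> ennreal S" by (simp add: g_def)
      then show ?thesis by (rule ennreal_le_iff[THEN iffD1, rotated]) (simp add: S_def)
    qed
    have "norm (f (Suc k) x - f k x) \<le> sqrt S / 2 ^ k" for k
    proof -
      have "(2 ^ k * \<bar>d k x\<bar>)\<^sup>2 = 4 ^ k * (d k x)\<^sup>2"
      proof -
        have "(2::real) ^ k * 2 ^ k = 4 ^ k" by (simp flip: power_mult_distrib)
        then have "((2::real) ^ k)\<^sup>2 = 4 ^ k" by (simp add: power2_eq_square)
        then show ?thesis by (simp add: power_mult_distrib)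
      qed
      then have "2 ^ k * \<bar>d k x\<bar> \<le> sqrt S" using S[of k] by (intro real_le_rsqrt) simp
      then show ?thesis by (simp add: field_simps d_def)
    qed
    then show "convergent (\<lambda>k. f k x)" by (rule convergent_of_geometric_steps)
  qed
qed

instance lsq :: banach
proof
  fix X :: "nat \<Rightarrow> lsq" assume C: "Cauchy X"
  have "\<exists>N. \<forall>m\<ge>N. \<forall>n\<ge>N. dist (X m) (X n) < (1/8) ^ k" for k
    using C[unfolded Cauchy_def] by simp
  then obtain N where N: "\<And>k m n. m \<ge> N k \<Longrightarrow> n \<ge> N k \<Longrightarrow> dist (X m) (X n) < (1/8) ^ k" by metis
  \<comment> \<open>The sum makes \<open>r k\<close> dominate \<open>N k\<close>, and the summand
    \<open>k\<close> makes \<open>r\<close> strictly increasing.\<close>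
  define r where "r k = (\<Sum>i\<le>k. N i) + k" for k
  have rN: "N k \<le> r k" for k
    using member_le_sum[of k "{..k}" N] by (simp add: r_def)
  have r: "strict_mono r" by (rule strict_monoI_Suc) (simp add: r_def)
  define f where "f k = rep_lsq (X (r k))" for k
  have f: "sqint (f k)" and fX: "abs_lsq (f k) = X (r k)" for k by (simp_all add: f_def sqint_rep)
  have fm[measurable]: "f k \<in> borel_measurable lebesgue" for k using f by (simp add: sqint_def)
  have rclose: "norm (X (r m) - X (r k)) < (1/8) ^ k" if "m \<ge> k" for m k
    using N[of k "r m" "r k"] rN[of k] strict_mono_less_eq[OF r, of k m] that by (simp add: dist_norm)
  have sq: "(norm (X (r m) - X (r k)))\<^sup>2 \<le> (1/8) ^ k" if "m \<ge> k" for m k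
  proof -
    have "(norm (X (r m) - X (r k)))\<^sup>2 \<le> ((1/8) ^ k)\<^sup>2"
      using rclose[OF that] by (intro power_mono) auto
    also have "\<dots> \<le> (1/8) ^ k * 1"
      unfolding power2_eq_square by (intro mult_left_mono) (auto simp: power_le_one)
    finally show ?thesis by simp
  qed
  have AE: "AE x in lebesgue. convergent (\<lambda>k. f k x)"
    by (rule AE_convergent_if_fast_Cauchy[OF f]) (use sq[of k "Suc k" for k] in \<open>simp add: fX\<close>)
  define g where "g x = lim (\<lambda>k. f k x)" for x
  have g[measurable]: "g \<in> borel_measurable lebesgue"
    unfolding g_def by (rule borel_measurable_lim_metric) measurable
  \<comment> \<open>Fatou's lemma in \<open>m\<close>: the pointwise limit inherits the bound on
    \<open>f m - f k\<close> valid for all \<open>m \<ge> k\<close>. This gives at once square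
    integrability of \<open>g\<close> and convergence in norm.\<close>
  have fat: "(\<integral>\<^sup>+x. ennreal ((g x - f k x)\<^sup>2) \<partial>lebesgue) \<le> ennreal ((1/8) ^ k)" for k
  proof -
    have "(\<integral>\<^sup>+x. ennreal ((g x - f k x)\<^sup>2) \<partial>lebesgue)
        = (\<integral>\<^sup>+x. liminf (\<lambda>m. ennreal ((f m x - f k x)\<^sup>2)) \<partial>lebesgue)"
      using AE
    proof (intro nn_integral_cong_AE, eventually_elim)
      fix x assume "convergent (\<lambda>k. f k x)"
      then have "(\<lambda>m. f m x) \<longlonglongrightarrow> g x" by (simp add: g_def convergent_LIMSEQ_iff)
      then have "(\<lambda>m. ennreal ((f m x - f k x)\<^sup>2)) \<longlonglongrightarrow> ennreal ((g x - f k x)\<^sup>2)"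
        by (intro tendsto_ennrealI tendsto_intros)
      then show "ennreal ((g x - f k x)\<^sup>2) = liminf (\<lambda>m. ennreal ((f m x - f k x)\<^sup>2))"
        by (intro lim_imp_Liminf[symmetric]) auto
    qed
    also have "\<dots> \<le> liminf (\<lambda>m. \<integral>\<^sup>+x. ennreal ((f m x - f k x)\<^sup>2) \<partial>lebesgue)"
      by (rule nn_integral_liminf) measurable
    also have "\<dots> \<le> ennreal ((1/8) ^ k)"
    proof (rule Liminf_le)
      show "\<forall>\<^sub>F m in sequentially. (\<integral>\<^sup>+x. ennreal ((f m x - f k x)\<^sup>2) \<partial>lebesgue) \<le> ennreal ((1/8) ^ k)"
        using eventually_ge_at_top[of k]
      proof eventually_elim
        fix m assume "m \<ge> k"
        then show "(\<integral>\<^sup>+x. ennreal ((f m x - f k x)\<^sup>2) \<partial>lebesgue) \<le> ennreal ((1/8) ^ k)"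
          unfolding nn_integral_square[OF sqint_diff[OF f f]]
          using sq by (simp add: abs_lsq_simps(2)[OF f f, symmetric] fX ennreal_leI)
      qed
    qed simp
    finally show ?thesis .
  qed
  have gf: "sqint (\<lambda>x. g x - f k x)" for k
    unfolding sqint_def
  proof (intro conjI integrableI_nonneg)
    show "(\<integral>\<^sup>+x. ennreal ((g x - f k x)\<^sup>2) \<partial>lebesgue) < \<infinity>"
      using fat[of k] by (rule order_le_less_trans) simp
  qed auto
  have gs: "sqint g" using sqint_add[OF gf[of 0] f[of 0]] by simp
  have close: "(norm (X (r k) - abs_lsq g))\<^sup>2 \<le> (1/8) ^ k" for k
  proof -
    have "ennreal ((norm (abs_lsq (\<lambda>x. g x - f k x)))\<^sup>2) \<le> ennreal ((1/8) ^ k)"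
      using fat[of k] unfolding nn_integral_square[OF gf] .
    then have "(norm (abs_lsq g - abs_lsq (f k)))\<^sup>2 \<le> (1/8) ^ k"
      by (simp add: abs_lsq_simps(2)[OF gs f])
    then show ?thesis by (simp add: fX norm_minus_commute)
  qed
  have "(\<lambda>k. (norm (X (r k) - abs_lsq g))\<^sup>2) \<longlonglongrightarrow> 0"
    by (rule Lim_null_comparison[OF always_eventually LIMSEQ_realpow_zero[of "1/8"]]) (use close in auto)
  then have "(\<lambda>k. sqrt ((norm (X (r k) - abs_lsq g))\<^sup>2)) \<longlonglongrightarrow> sqrt 0" by (rule tendsto_real_sqrt)
  then have "(X \<circ> r) \<longlonglongrightarrow> abs_lsq g"
    by (simp add: LIM_zero_iff tendsto_norm_zero_iff o_def)
  then show "convergent X"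
    using Cauchy_converges_subseq[OF C r] by (auto simp: convergent_def)
qed

section \<open>Functions on [0,L] inside the Hilbert space\<close>

definition restr :: "real \<Rightarrow> (real \<Rightarrow> real) \<Rightarrow> real \<Rightarrow> real" where
  "restr L f x = (if x \<in> {0..L} then f x else 0)"

lemma restr_eq_indicator: "restr L f x = indicator {0..L} x *\<^sub>R f x"
  by (simp add: restr_def)

lemma restr_simps:
  "restr L (\<lambda>x. f x + g x) = (\<lambda>x. restr L f x + restr L g x)"
  "restr L (\<lambda>x. f x - g x) = (\<lambda>x. restr L f x - restr L g x)"
  "restr L (\<lambda>x. r * f x) = (\<lambda>x. r * restr L f x)"
  "restr L (\<lambda>x. f x * g x) = (\<lambda>x. restr L f x * restr L g x)"
  "restr L (\<lambda>x. (f x)\<^sup>2) = (\<lambda>x. (restr L f x)\<^sup>2)"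
  by (simp_all add: restr_def fun_eq_iff)

lemma integrable_restr: "integrable (lebesgue_on {0..L}) f \<longleftrightarrow> integrable lebesgue (restr L f)"
  by (subst integrable_restrict_space) (simp_all add: restr_eq_indicator[abs_def])

lemma integral_restr: "integral\<^sup>L (lebesgue_on {0..L}) f = integral\<^sup>L lebesgue (restr L f)"
  by (subst integral_restrict_space) (simp_all add: restr_eq_indicator[abs_def])

lemma measurable_restr:
  "f \<in> borel_measurable (lebesgue_on {0..L}) \<longleftrightarrow> restr L f \<in> borel_measurable lebesgue"
  unfolding restr_def[abs_def] by (rule borel_measurable_if[symmetric]) simp

lemma ae_eq_restr: "ae_eq L f g \<longleftrightarrow> (AE x in lebesgue. restr L f x = restr L g x)"
  unfolding ae_eq_def
  by (subst AE_restrict_space_iff) (auto simp: restr_def intro!: arg_cong[of _ _ "almost_everywhere lebesgue"])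

lemma L2_iff_sqint: "L2 L f \<longleftrightarrow> sqint (restr L f)"
  unfolding L2_def sqint_def integrable_restr measurable_restr restr_simps ..

lemma L2_add: "L2 L f \<Longrightarrow> L2 L g \<Longrightarrow> L2 L (\<lambda>x. f x + g x)"
  by (simp add: L2_iff_sqint restr_simps sqint_add)

lemma L2_diff: "L2 L f \<Longrightarrow> L2 L g \<Longrightarrow> L2 L (\<lambda>x. f x - g x)"
  by (simp add: L2_iff_sqint restr_simps sqint_diff)

lemma L2_scale: "L2 L f \<Longrightarrow> L2 L (\<lambda>x. r * f x)"
  by (simp add: L2_iff_sqint restr_simps sqint_scale)

lemma L2_uminus: "L2 L f \<Longrightarrow> L2 L (\<lambda>x. - f x)"
  using L2_scale[of L f "-1"] by simp

lemma L2_continuous: "continuous_on {0..L} f \<Longrightarrow> L2 L f"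
  unfolding L2_def
  by (auto intro!: continuous_imp_measurable_on_sets_lebesgue continuous_imp_integrable_real continuous_intros)

lemma L2_mult_integrable: "L2 L f \<Longrightarrow> L2 L g \<Longrightarrow> integrable (lebesgue_on {0..L}) (\<lambda>x. f x * g x)"
  by (simp add: L2_iff_sqint integrable_restr restr_simps sqint_mult)

lemma L2_integrable: "L2 L f \<Longrightarrow> integrable (lebesgue_on {0..L}) f"
  using L2_mult_integrable[OF _ L2_continuous[of L "\<lambda>x. 1"]] by simp

lemma L2_absolutely_integrable: "L2 L f \<Longrightarrow> f absolutely_integrable_on {0..L}"
  using L2_integrable integrable_restrict_space[of "{0..L}" lebesgue f]
  by (simp add: set_integrable_def)

lemma sqint_cong_AE:
  assumes "sqint f" "AE x in lebesgue. f x = g x"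
  shows "sqint g"
proof -
  have g: "g \<in> borel_measurable lebesgue"
    using borel_measurable_AE[OF _ assms(2)] assms(1) by (simp add: sqint_def)
  moreover have "integrable lebesgue (\<lambda>x. (g x)\<^sup>2)"
  proof (rule integrable_cong_AE_imp)
    show "integrable lebesgue (\<lambda>x. (f x)\<^sup>2)" using assms(1) by (simp add: sqint_def)
    show "AE x in lebesgue. (f x)\<^sup>2 = (g x)\<^sup>2" using assms(2) by eventually_elim simp
    show "(\<lambda>x. (g x)\<^sup>2) \<in> borel_measurable lebesgue" by (intro borel_measurable_power g)
  qed
  ultimately show ?thesis by (simp add: sqint_def)
qed

lemma L2_cong_ae: "L2 L f \<Longrightarrow> ae_eq L f g \<Longrightarrow> L2 L g"
  unfolding L2_iff_sqint ae_eq_restr by (rule sqint_cong_AE)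

text \<open>The isometric embedding of L^2(0,L) into L^2 of the line by extension with zero.\<close>

definition emb :: "real \<Rightarrow> (real \<Rightarrow> real) \<Rightarrow> lsq" where
  "emb L f = abs_lsq (restr L f)"

lemma emb_add: "L2 L f \<Longrightarrow> L2 L g \<Longrightarrow> emb L (\<lambda>x. f x + g x) = emb L f + emb L g"
  by (simp add: emb_def L2_iff_sqint abs_lsq_simps restr_simps)

lemma emb_diff: "L2 L f \<Longrightarrow> L2 L g \<Longrightarrow> emb L (\<lambda>x. f x - g x) = emb L f - emb L g"
  by (simp add: emb_def L2_iff_sqint abs_lsq_simps restr_simps)

lemma emb_scale: "L2 L f \<Longrightarrow> emb L (\<lambda>x. r * f x) = r *\<^sub>R emb L f"
  by (simp add: emb_def L2_iff_sqint abs_lsq_simps restr_simps)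

lemma emb_eq_iff: "L2 L f \<Longrightarrow> L2 L g \<Longrightarrow> emb L f = emb L g \<longleftrightarrow> ae_eq L f g"
  by (simp add: emb_def L2_iff_sqint abs_lsq_eq ae_eq_restr)

lemma inner_emb: "L2 L f \<Longrightarrow> L2 L g \<Longrightarrow> inner (emb L f) (emb L g) = L2_inner L f g"
  by (simp add: emb_def L2_iff_sqint abs_lsq_simps L2_inner_def integral_restr restr_simps)

lemma norm_emb: "L2 L f \<Longrightarrow> norm (emb L f) = L2_norm L f"
  by (simp add: norm_eq_sqrt_inner inner_emb L2_norm_def L2_inner_def power2_eq_square)

lemma L2_rep: "L2 L (rep_lsq X)"
proof -
  have X: "sqint (rep_lsq X)" by (rule sqint_rep)
  have "integrable lebesgue (\<lambda>x. indicator {0..L} x *\<^sub>R (rep_lsq X x)\<^sup>2)"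
    by (rule integrable_mult_indicator) (use X in \<open>auto simp: sqint_def\<close>)
  then show ?thesis
    using X unfolding L2_def sqint_def
    by (auto simp: integrable_restrict_space intro: measurable_restrict_space1)
qed

lemma inner_emb_right:
  assumes "L2 L f"
  shows "inner X (emb L f) = L2_inner L (rep_lsq X) f"
proof -
  have "inner (abs_lsq (rep_lsq X)) (emb L f) = L2_inner L (rep_lsq X) f"
    unfolding emb_def using assms[unfolded L2_iff_sqint]
    by (subst abs_lsq_simps(4))
      (auto simp: sqint_rep L2_inner_def integral_restr restr_def intro!: Bochner_Integration.integral_cong)
  then show ?thesis by simp
qed

lemma rep_emb:
  assumes "L2 L f"
  shows "ae_eq L (rep_lsq (emb L f)) f"
proof -
  have "AE x in lebesgue. rep_lsq (emb L f) x = restr L f x"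
    unfolding emb_def by (rule rep_abs_lsq) (use assms in \<open>simp add: L2_iff_sqint\<close>)
  then show ?thesis unfolding ae_eq_restr by eventually_elim (simp add: restr_def)
qed

text \<open>The orthogonal projection onto the range of \<open>emb L\<close>.\<close>

definition cutoff :: "real \<Rightarrow> lsq \<Rightarrow> lsq" where "cutoff L X = emb L (rep_lsq X)"

lemma emb_cong: "L2 L f \<Longrightarrow> ae_eq L f g \<Longrightarrow> emb L f = emb L g"
  using emb_eq_iff L2_cong_ae by blast

lemma rep_simps:
  "ae_eq L (rep_lsq (X + Y)) (\<lambda>x. rep_lsq X x + rep_lsq Y x)"
  "ae_eq L (rep_lsq (X - Y)) (\<lambda>x. rep_lsq X x - rep_lsq Y x)"
  "ae_eq L (rep_lsq (r *\<^sub>R X)) (\<lambda>x. r * rep_lsq X x)"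
proof -
  have ae: "AE x in lebesgue. P x \<Longrightarrow> AE x in lebesgue_on {0..L}. P x" for P
    by (auto simp: AE_restrict_space_iff elim: eventually_mono)
  have "abs_lsq (rep_lsq (X + Y)) = abs_lsq (\<lambda>x. rep_lsq X x + rep_lsq Y x)"
    by (subst abs_lsq_simps(1)[symmetric]) (simp_all add: sqint_rep)
  then show "ae_eq L (rep_lsq (X + Y)) (\<lambda>x. rep_lsq X x + rep_lsq Y x)"
    unfolding ae_eq_def by (subst (asm) abs_lsq_eq) (auto intro: ae sqint_rep sqint_add)
  have "abs_lsq (rep_lsq (X - Y)) = abs_lsq (\<lambda>x. rep_lsq X x - rep_lsq Y x)"
    by (subst abs_lsq_simps(2)[symmetric]) (simp_all add: sqint_rep)
  then show "ae_eq L (rep_lsq (X - Y)) (\<lambda>x. rep_lsq X x - rep_lsq Y x)"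
    unfolding ae_eq_def by (subst (asm) abs_lsq_eq) (auto intro: ae sqint_rep sqint_diff)
  have "abs_lsq (rep_lsq (r *\<^sub>R X)) = abs_lsq (\<lambda>x. r * rep_lsq X x)"
    by (subst abs_lsq_simps(3)[OF sqint_rep sqint_rep, symmetric]) simp
  then show "ae_eq L (rep_lsq (r *\<^sub>R X)) (\<lambda>x. r * rep_lsq X x)"
    unfolding ae_eq_def by (subst (asm) abs_lsq_eq) (auto intro: ae sqint_rep sqint_scale)
qed

lemma cutoff_simps: "cutoff L (X + Y) = cutoff L X + cutoff L Y" "cutoff L (X - Y) = cutoff L X - cutoff L Y"
    "cutoff L (r *\<^sub>R X) = r *\<^sub>R cutoff L X"
  unfolding cutoff_def
  by (subst emb_cong[OF L2_rep rep_simps(1)] emb_cong[OF L2_rep rep_simps(2)]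
      emb_cong[OF L2_rep rep_simps(3)], simp add: emb_add emb_diff emb_scale L2_rep)+

lemma cutoff_emb: "L2 L f \<Longrightarrow> cutoff L (emb L f) = emb L f"
  unfolding cutoff_def by (rule emb_cong[OF L2_rep rep_emb])

lemma inner_cutoff: "L2 L f \<Longrightarrow> inner (cutoff L X) (emb L f) = inner X (emb L f)"
  unfolding cutoff_def by (simp only: inner_emb L2_rep inner_emb_right[of L f X])

lemma norm_cutoff_le: "norm (cutoff L X) \<le> norm X"
proof -
  have "(norm (cutoff L X))\<^sup>2 = inner X (cutoff L X)"
    using inner_cutoff[OF L2_rep, of L X X] by (simp add: cutoff_def power2_norm_eq_inner)
  also have "\<dots> \<le> norm X * norm (cutoff L X)" by (rule norm_cauchy_schwarz)
  finally show ?thesis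
    by (cases "cutoff L X = 0") (auto simp: power2_eq_square)
qed

lemma bounded_linear_cutoff: "bounded_linear (cutoff L)"
  by (rule bounded_linear_intro[where K = 1]) (auto simp: cutoff_simps norm_cutoff_le)

section \<open>Integration by parts and weak derivatives\<close>

text \<open>The positive and negative parts of \<open>h\<close> define finite measures that agree on
  all half lines, a generating family, hence everywhere. Measures with equal densities with respect
  to a sigma-finite measure have densities equal almost everywhere.\<close>

lemma integral_zero_imp_AE_zero:
  fixes h :: "real \<Rightarrow> real"
  assumes h: "integrable lebesgue h" and zero: "\<And>x. (LINT s:{x<..}|lebesgue. h s) = 0"
  shows "AE x in lebesgue. h x = 0"
proof -
  \<comment> \<open>A Borel representative is used because the comparison of measures on half lines
    takes place on the Borel sets.\<close>
  obtain k where k: "k \<in> borel_measurable lborel" "AE x in lborel. h x = k x"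
    using completion_ex_borel_measurable_real[of h lborel] h by (auto intro: borel_measurable_integrable)
  have hk: "AE x in lebesgue. h x = k x" using k(2) by (rule AE_completion)
  have km[measurable]: "k \<in> borel_measurable borel" using k(1) by simp
  have kl: "k \<in> borel_measurable lebesgue" using k(1) by (simp add: measurable_completion)
  have ki: "integrable lborel k"
  proof -
    have "integrable lebesgue k" using integrable_cong_AE_imp[OF h kl] hk by auto
    then show ?thesis using integrable_completion[OF k(1)] by simp
  qed
  have kz: "(LINT s|lborel. indicator {x<..} s * k s) = 0" for x
  proof -
    have "(LINT s|lborel. indicator {x<..} s * k s) = (LINT s|lebesgue. indicator {x<..} s * k s)"
      by (rule integral_completion[symmetric]) simp
    also have "\<dots> = (LINT s:{x<..}|lebesgue. h s)"
      unfolding set_lebesgue_integral_def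
    proof (rule integral_cong_AE)
      show "AE s in lebesgue. indicator {x<..} s * k s = indicator {x<..} s *\<^sub>R h s"
        using hk by eventually_elim simp
    qed (auto intro!: borel_measurable_times borel_measurable_scaleR kl borel_measurable_integrable[OF h]
        borel_measurable_indicator)
    finally show ?thesis using zero by simp
  qed
  have pos: "emeasure (density lborel (\<lambda>s. ennreal (f s))) {x<..} = ennreal (LINT s|lborel. indicator {x<..} s * f s)"
    if f: "integrable lborel f" "\<And>s. f s \<ge> 0" for f :: "real \<Rightarrow> real" and x
  proof -
    have "integrable lborel (\<lambda>s. indicator {x<..} s * f s)"
      using integrable_mult_indicator[OF _ f(1), of "{x<..}"] by simp
    then have "(\<integral>\<^sup>+s. ennreal (indicator {x<..} s * f s) \<partial>lborel) = ennreal (LINT s|lborel. indicator {x<..} s * f s)"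
      using f(2) by (intro nn_integral_eq_integral) auto
    moreover have "emeasure (density lborel (\<lambda>s. ennreal (f s))) {x<..}
        = (\<integral>\<^sup>+s. ennreal (indicator {x<..} s * f s) \<partial>lborel)"
      using borel_measurable_integrable[OF f(1)]
      by (subst emeasure_density) (auto intro!: nn_integral_cong split: split_indicator)
    ultimately show ?thesis by simp
  qed
  define p n where "p s = max 0 (k s)" and "n s = max 0 (- k s)" for s
  have pn: "integrable lborel p" "integrable lborel n" "\<And>s. p s \<ge> 0" "\<And>s. n s \<ge> 0"
    unfolding p_def n_def using ki by (auto intro!: integrable_max)
  have "(LINT s|lborel. indicator {x<..} s * p s) = (LINT s|lborel. indicator {x<..} s * n s)" for x
  proof -
    have "(LINT s|lborel. indicator {x<..} s * k s)
        = (LINT s|lborel. indicator {x<..} s * p s - indicator {x<..} s * n s)"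
      by (rule Bochner_Integration.integral_cong) (auto simp: p_def n_def split: split_indicator)
    also have "\<dots> = (LINT s|lborel. indicator {x<..} s * p s) - (LINT s|lborel. indicator {x<..} s * n s)"
      using integrable_mult_indicator[OF _ pn(1), of "{x<..}"] integrable_mult_indicator[OF _ pn(2), of "{x<..}"]
      by (intro Bochner_Integration.integral_diff) auto
    finally show ?thesis using kz[of x] by simp
  qed
  then have "density lborel (\<lambda>s. ennreal (p s)) = density lborel (\<lambda>s. ennreal (n s))"
    by (intro measure_eqI_lessThan) (auto simp: pos[OF pn(1,3)] pos[OF pn(2,4)])
  then have "AE s in lborel. ennreal (p s) = ennreal (n s)"
    using pn by (intro sigma_finite_measure.density_unique[OF sigma_finite_lborel]) auto
  then have "AE s in lborel. h s = 0" using k(2)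
    by eventually_elim (auto simp: p_def n_def max_def split: if_splits)
  then show ?thesis by (rule AE_completion)
qed

lemma integral_diff_interval:
  fixes f :: "real \<Rightarrow> real"
  assumes "f integrable_on {0..L}" "0 \<le> s" "s \<le> x" "x \<le> L"
  shows "integral {0..x} f - integral {0..s} f = integral {s..x} f"
proof -
  have "f integrable_on {0..x}" by (rule integrable_subinterval_real[OF assms(1)]) (use assms in auto)
  from Henstock_Kurzweil_Integration.integral_combine[OF assms(2,3) this] show ?thesis by simp
qed

text \<open>The defect \<open>\<integral>\<^sub>0\<^sup>x p g + \<integral>\<^sub>0\<^sup>x p' F - p F\<close> changes over \<open>[s, x]\<close> by at most
  \<open>2 M (x - s) \<integral>\<^sub>s\<^sup>x \<bar>g\<bar> = o(x - s)\<close>, so its derivative vanishes everywhere, although \<open>F\<close>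
  need only be differentiable almost everywhere.\<close>
lemma integration_by_parts_primitive:
  fixes p p' g F :: "real \<Rightarrow> real"
  assumes L: "0 \<le> L"
    and p: "\<And>x. x \<in> {0..L} \<Longrightarrow> (p has_real_derivative p' x) (at x within {0..L})"
    and p': "continuous_on {0..L} p'"
    and g: "g absolutely_integrable_on {0..L}"
    and F: "\<And>x. x \<in> {0..L} \<Longrightarrow> F x = F 0 + integral {0..x} g"
  shows "integral {0..L} (\<lambda>x. p x * g x) = p L * F L - p 0 * F 0 - integral {0..L} (\<lambda>x. p' x * F x)"
proof -
  have cp: "continuous_on {0..L} p" by (rule DERIV_continuous_on[OF p])
  have gi: "g integrable_on {0..L}" and ga: "(\<lambda>x. \<bar>g x\<bar>) integrable_on {0..L}"
    using g by (auto simp: absolutely_integrable_on_def)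
  have cF: "continuous_on {0..L} F"
    by (rule continuous_on_eq[OF _ F[symmetric]])
      (intro continuous_intros indefinite_integral_continuous_1 gi)
  have pg: "(\<lambda>x. p x * g x) absolutely_integrable_on {0..L}"
    by (rule absolutely_integrable_bounded_measurable_product_real[OF _ _ _ g])
      (use cp in \<open>auto intro!: continuous_imp_measurable_on_sets_lebesgue compact_imp_bounded compact_continuous_image\<close>)
  have pgi: "(\<lambda>x. p x * g x) integrable_on {0..L}"
    using pg by (auto simp: absolutely_integrable_on_def)
  have pFi: "(\<lambda>x. p' x * F x) integrable_on {0..L}"
    by (intro integrable_continuous_real continuous_intros p' cF)
  have "bounded (p' ` {0..L})" by (intro compact_imp_bounded compact_continuous_image p') simp
  then obtain M where "\<forall>y\<in>p' ` {0..L}. norm y \<le> M" unfolding bounded_iff by blast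
  then have M: "\<And>x. x \<in> {0..L} \<Longrightarrow> \<bar>p' x\<bar> \<le> M" by auto
  have M0: "M \<ge> 0" using M[of 0] L by auto
  define N where "N x = integral {0..x} (\<lambda>x. \<bar>g x\<bar>)" for x
  have cN: "continuous_on {0..L} N" unfolding N_def by (rule indefinite_integral_continuous_1[OF ga])
  define D where "D x = integral {0..x} (\<lambda>x. p x * g x) + integral {0..x} (\<lambda>x. p' x * F x) - p x * F x" for x
  have lip: "\<bar>p r - p x\<bar> \<le> M * \<bar>r - x\<bar>" if "r \<in> {0..L}" "x \<in> {0..L}" for r x
    using field_differentiable_bound[of "{0..L}" p p' M r x] p M that by (auto intro: convex_real_interval)
  have est: "\<bar>D x - D s\<bar> \<le> 2 * M * (x - s) * (N x - N s)" if sx: "0 \<le> s" "s \<le> x" "x \<le> L" for s x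
  proof -
    have sub: "{s..x} \<subseteq> {0..L}" using sx by auto
    have int: "f integrable_on {s..x}" if "f integrable_on {0..L}" for f :: "real \<Rightarrow> real"
      by (rule integrable_subinterval_real[OF that sub])
    have FF: "F r - F s = integral {s..r} g" if "r \<in> {s..x}" for r
      using F[of r] F[of s] integral_diff_interval[OF gi, of s r] sx that by simp
    have NN: "N x - N s = integral {s..x} (\<lambda>x. \<bar>g x\<bar>)"
      unfolding N_def using integral_diff_interval[OF ga sx] .
    have pp: "p x - p s = integral {s..x} p'"
    proof -
      have "(p' has_integral (p x - p s)) {s..x}"
        by (rule fundamental_theorem_of_calculus[OF sx(2)])
          (use sub in \<open>auto intro!: has_vector_derivative_within_subset[OF p[unfolded
             has_real_derivative_iff_has_vector_derivative]]\<close>)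
      then show ?thesis by (simp add: integral_unique)
    qed
    have i1: "(\<lambda>r. (p r - p x) * g r) integrable_on {s..x}"
      using integrable_diff[OF int[OF pgi] integrable_on_cmult_left[OF int[OF gi], of "p x"]]
      by (simp add: left_diff_distrib)
    have i2: "(\<lambda>r. p' r * (F r - F s)) integrable_on {s..x}"
      by (intro integrable_continuous_real continuous_intros)
        (use sub in \<open>auto intro: continuous_on_subset[OF p'] continuous_on_subset[OF cF]\<close>)
    have p'i: "p' integrable_on {s..x}" by (intro int integrable_continuous_real p')
    have "D x - D s = integral {s..x} (\<lambda>x. p x * g x) + integral {s..x} (\<lambda>x. p' x * F x) - (p x * F x - p s * F s)"
      unfolding D_def using integral_diff_interval[OF pgi sx] integral_diff_interval[OF pFi sx] by simp
    \<comment> \<open>Splitting the increment of the product with \<open>p\<close> at the right end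
      and \<open>F\<close> at the left end leaves remainders containing only the oscillations
      \<open>p r - p x\<close> and \<open>F r - F s\<close>.\<close>
    also have "p x * F x - p s * F s = p x * integral {s..x} g + integral {s..x} p' * F s"
      using FF[of x] pp sx by (simp add: algebra_simps)
    also have "integral {s..x} (\<lambda>x. p x * g x) + integral {s..x} (\<lambda>x. p' x * F x)
          - (p x * integral {s..x} g + integral {s..x} p' * F s)
        = integral {s..x} (\<lambda>r. (p r - p x) * g r) + integral {s..x} (\<lambda>r. p' r * (F r - F s))"
    proof -
      have "integral {s..x} (\<lambda>r. (p r - p x) * g r) = integral {s..x} (\<lambda>r. p r * g r) - p x * integral {s..x} g"
        unfolding left_diff_distrib
        by (subst Henstock_Kurzweil_Integration.integral_diff)
          (use int[OF pgi] integrable_on_cmult_left[OF int[OF gi], of "p x"] in auto)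
      moreover have "integral {s..x} (\<lambda>r. p' r * (F r - F s)) = integral {s..x} (\<lambda>r. p' r * F r) - integral {s..x} p' * F s"
        unfolding right_diff_distrib
        by (subst Henstock_Kurzweil_Integration.integral_diff)
          (use int[OF pFi] integrable_on_cmult_right[OF p'i, of "F s"] in auto)
      ultimately show ?thesis by simp
    qed
    finally have D: "D x - D s = integral {s..x} (\<lambda>r. (p r - p x) * g r) + integral {s..x} (\<lambda>r. p' r * (F r - F s))" .
    have "\<bar>integral {s..x} (\<lambda>r. (p r - p x) * g r)\<bar> \<le> integral {s..x} (\<lambda>r. M * (x - s) * \<bar>g r\<bar>)"
    proof (rule integral_norm_bound_integral[OF i1, unfolded real_norm_def])
      show "(\<lambda>r. M * (x - s) * \<bar>g r\<bar>) integrable_on {s..x}"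
        using integrable_on_cmult_left[OF int[OF ga], of "M * (x - s)"] by simp
      fix r assume r: "r \<in> {s..x}"
      have "\<bar>p r - p x\<bar> \<le> M * \<bar>r - x\<bar>" using lip[of r x] r sub sx by auto
      also have "\<dots> \<le> M * (x - s)" using r M0 by (intro mult_left_mono) auto
      finally show "\<bar>(p r - p x) * g r\<bar> \<le> M * (x - s) * \<bar>g r\<bar>" by (simp add: abs_mult mult_right_mono)
    qed
    also have "\<dots> = M * (x - s) * (N x - N s)" by (simp add: NN)
    finally have 1: "\<bar>integral {s..x} (\<lambda>r. (p r - p x) * g r)\<bar> \<le> M * (x - s) * (N x - N s)" .
    have "\<bar>integral {s..x} (\<lambda>r. p' r * (F r - F s))\<bar> \<le> integral {s..x} (\<lambda>r. M * (N x - N s))"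
    proof (rule integral_norm_bound_integral[OF i2, unfolded real_norm_def])
      fix r assume r: "r \<in> {s..x}"
      have "norm (integral {s..r} g) \<le> integral {s..r} (\<lambda>x. \<bar>g x\<bar>)"
        by (rule integral_norm_bound_integral)
          (use r sub in \<open>auto intro!: integrable_subinterval_real[OF gi] integrable_subinterval_real[OF ga]\<close>)
      then have "\<bar>F r - F s\<bar> \<le> integral {s..r} (\<lambda>x. \<bar>g x\<bar>)" unfolding FF[OF r] by simp
      also have "\<dots> \<le> integral {s..x} (\<lambda>x. \<bar>g x\<bar>)"
        by (rule integral_subset_le)
          (use r sub in \<open>auto intro!: integrable_subinterval_real[OF ga]\<close>)
      finally have "\<bar>F r - F s\<bar> \<le> N x - N s" by (simp add: NN)
      then show "\<bar>p' r * (F r - F s)\<bar> \<le> M * (N x - N s)"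
        unfolding abs_mult using M[of r] r sub M0 by (intro mult_mono) auto
    qed (rule integrable_const_ivl)
    also have "\<dots> = M * (x - s) * (N x - N s)" using sx by simp
    finally have 2: "\<bar>integral {s..x} (\<lambda>r. p' r * (F r - F s))\<bar> \<le> M * (x - s) * (N x - N s)" .
    show ?thesis using D 1 2 by linarith
  qed
  have est': "\<bar>D y - D x\<bar> \<le> 2 * M * \<bar>N y - N x\<bar> * \<bar>y - x\<bar>" if "x \<in> {0..L}" "y \<in> {0..L}" for x y
  proof (cases "x \<le> y")
    case True
    have "\<bar>D y - D x\<bar> \<le> 2 * M * (y - x) * (N y - N x)" using est[of x y] that True by simp
    also have "\<dots> \<le> 2 * M * (y - x) * \<bar>N y - N x\<bar>"
      using True M0 by (intro mult_left_mono) auto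
    also have "\<dots> = 2 * M * \<bar>N y - N x\<bar> * \<bar>y - x\<bar>" using True by simp
    finally show ?thesis .
  next
    case False
    have "\<bar>D y - D x\<bar> \<le> 2 * M * (x - y) * (N x - N y)"
      using est[of y x] that False by (simp add: abs_minus_commute)
    also have "\<dots> \<le> 2 * M * (x - y) * \<bar>N y - N x\<bar>"
      using False M0 by (intro mult_left_mono) auto
    also have "\<dots> = 2 * M * \<bar>N y - N x\<bar> * \<bar>y - x\<bar>" using False by simp
    finally show ?thesis .
  qed
  have "(D has_real_derivative 0) (at x within {0..L})" if x: "x \<in> {0..L}" for x
    unfolding has_field_derivative_def has_derivative_within_alt
  proof (intro conjI allI impI)
    fix e :: real assume e: "e > 0"
    have "e / (2 * M + 1) > 0" using e M0 by simp
    then obtain d where d: "d > 0" "\<And>y. y \<in> {0..L} \<Longrightarrow> \<bar>y - x\<bar> < d \<Longrightarrow> \<bar>N y - N x\<bar> < e / (2 * M + 1)"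
      using cN x unfolding continuous_on_iff dist_real_def by metis
    show "\<exists>d>0. \<forall>y\<in>{0..L}. norm (y - x) < d \<longrightarrow> norm (D y - D x - 0 * (y - x)) \<le> e * norm (y - x)"
    proof (intro exI[of _ d] conjI ballI impI d(1))
      fix y assume y: "y \<in> {0..L}" "norm (y - x) < d"
      have "2 * M * \<bar>N y - N x\<bar> \<le> (2 * M + 1) * \<bar>N y - N x\<bar>" by (simp add: mult_right_mono)
      also have "\<dots> \<le> e" using d(2)[of y] y M0 by (simp add: field_simps)
      finally have "2 * M * \<bar>N y - N x\<bar> * \<bar>y - x\<bar> \<le> e * \<bar>y - x\<bar>" by (rule mult_right_mono) simp
      then show "norm (D y - D x - 0 * (y - x)) \<le> e * norm (y - x)" using est'[OF x y(1)] by simp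
    qed
  qed (simp add: bounded_linear_mult_right)
  then have "\<exists>c. \<forall>x\<in>{0..L}. D x = c"
    by (intro has_field_derivative_zero_constant) auto
  then have "D L = D 0" using L by auto
  then show ?thesis by (simp add: D_def)
qed

section \<open>Smooth functions of compact support\<close>

text \<open>The functions P(1/x) exp(-1/x), continued by zero. The polynomial factor makes the
  family closed under differentiation, so smoothness follows without a formula for higher
  derivatives.\<close>

definition flat :: "real poly \<Rightarrow> real \<Rightarrow> real" where
  "flat P x = (if x > 0 then poly P (1 / x) * exp (- 1 / x) else 0)"

lemma poly_exp_neg_tendsto_0: "((\<lambda>y. poly P y * exp (- y)) \<longlongrightarrow> 0) at_top" for P :: "real poly"
proof -
  have *: "((\<lambda>y::real. y ^ n * exp (- y)) \<longlongrightarrow> 0) at_top" for n :: nat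
    using tendsto_power_div_exp_0[of n] by (simp add: exp_minus divide_inverse)
  have "((\<lambda>y. \<Sum>i\<le>degree P. coeff P i * (y ^ i * exp (- y))) \<longlongrightarrow> (\<Sum>i\<le>degree P. coeff P i * 0)) at_top"
    by (intro tendsto_sum tendsto_mult tendsto_const *)
  then show ?thesis by (simp add: poly_altdef sum_distrib_right mult.assoc)
qed

text \<open>With u = 1/x one has d/dx = - u^2 d/du, which turns P exp(-u) into u^2 (P - P') exp(-u).
  At zero the difference quotient from the right is u P(u) exp(-u), which tends to zero as u
  grows.\<close>

lemma flat_derivative:
  "(flat P has_real_derivative flat (monom 1 2 * (P - pderiv P)) x) (at x)"
proof (cases x "0::real" rule: linorder_cases)
  case less
  have "((\<lambda>x. 0) has_real_derivative 0) (at x)" by simp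
  then show ?thesis
    using less by (subst DERIV_cong_ev[OF refl _ refl, of _ "\<lambda>x. 0"])
      (auto simp: flat_def eventually_nhds intro!: exI[of _ "{..<0}"])
next
  case greater
  have "((\<lambda>x. poly P (1 / x) * exp (- 1 / x)) has_real_derivative
      poly (monom 1 2 * (P - pderiv P)) (1 / x) * exp (- 1 / x)) (at x)"
    using greater
    by (auto intro!: derivative_eq_intros DERIV_chain2[OF poly_DERIV]
        simp: poly_monom field_simps power2_eq_square)
  then show ?thesis
    using greater by (subst DERIV_cong_ev[OF refl _ refl, of _ "\<lambda>x. poly P (1 / x) * exp (- 1 / x)"])
      (auto simp: flat_def eventually_nhds intro!: exI[of _ "{0<..}"])
next
  case equal
  have "((\<lambda>h. (flat P (0 + h) - flat P 0) / h) \<longlongrightarrow> 0) (at 0)"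
    unfolding filterlim_at_split
  proof
    have "((\<lambda>h. 0::real) \<longlongrightarrow> 0) (at_left 0)" by simp
    then show "((\<lambda>h. (flat P (0 + h) - flat P 0) / h) \<longlongrightarrow> 0) (at_left 0)"
      by (rule Lim_transform_eventually) (auto simp: eventually_at_filter flat_def)
    have "((\<lambda>h. poly (monom 1 1 * P) (inverse h) * exp (- inverse h)) \<longlongrightarrow> 0) (at_right 0)"
      by (rule filterlim_compose[OF poly_exp_neg_tendsto_0 filterlim_inverse_at_top_right])
    then show "((\<lambda>h. (flat P (0 + h) - flat P 0) / h) \<longlongrightarrow> 0) (at_right 0)"
      by (rule Lim_transform_eventually)
        (auto simp: eventually_at_filter flat_def poly_monom field_simps)
  qed
  then show ?thesis using equal by (simp add: DERIV_def flat_def)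
qed

text \<open>A family closed under linear combinations and derivatives. Scalars need no constructor
  of their own, since they can be absorbed into the polynomials.\<close>

inductive_set bump_span :: "(real \<Rightarrow> real) set" where
  prod: "(\<lambda>x. flat P (m * (x - p)) * flat Q (m * (q - x))) \<in> bump_span"
| add: "f \<in> bump_span \<Longrightarrow> g \<in> bump_span \<Longrightarrow> (\<lambda>x. f x + g x) \<in> bump_span"

lemma flat_smult: "flat (smult c P) x = c * flat P x"
  by (simp add: flat_def)

lemma bump_span_scale: "f \<in> bump_span \<Longrightarrow> (\<lambda>x. c * f x) \<in> bump_span"
proof (induction rule: bump_span.induct)
  case (prod P m p Q q)
  show ?case using bump_span.prod[of "smult c P" m p Q q] by (simp add: flat_smult mult.assoc)
next
  case (add f g)
  then show ?case using bump_span.add by (auto simp: distrib_left)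
qed

lemma bump_span_derivative: "f \<in> bump_span \<Longrightarrow> \<exists>g\<in>bump_span. \<forall>x. (f has_real_derivative g x) (at x)"
proof (induction rule: bump_span.induct)
  case (prod P m p Q q)
  let ?d = "\<lambda>P. monom 1 2 * (P - pderiv P) :: real poly"
  show ?case
  proof (intro bexI allI)
    fix x
    have 1: "((\<lambda>x. flat P (m * (x - p))) has_real_derivative flat (?d P) (m * (x - p)) * m) (at x)"
      by (rule DERIV_chain2[OF flat_derivative]) (auto intro!: derivative_eq_intros)
    have 2: "((\<lambda>x. flat Q (m * (q - x))) has_real_derivative flat (?d Q) (m * (q - x)) * (- m)) (at x)"
      by (rule DERIV_chain2[OF flat_derivative]) (auto intro!: derivative_eq_intros)
    show "((\<lambda>x. flat P (m * (x - p)) * flat Q (m * (q - x))) has_real_derivative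
        flat (smult m (?d P)) (m * (x - p)) * flat Q (m * (q - x))
        + flat P (m * (x - p)) * flat (smult (- m) (?d Q)) (m * (q - x))) (at x)"
      unfolding flat_smult by (rule DERIV_cong[OF DERIV_mult[OF 1 2]]) (simp only: algebra_simps)
  qed (intro bump_span.intros)
next
  case (add f g)
  then obtain f' g' where "f' \<in> bump_span" "\<And>x. (f has_real_derivative f' x) (at x)"
    "g' \<in> bump_span" "\<And>x. (g has_real_derivative g' x) (at x)" by blast
  then show ?case by (intro bexI[of _ "\<lambda>x. f' x + g' x"] allI DERIV_add bump_span.add) auto
qed

lemma smooth_of_derivative_closed:
  fixes f :: "real \<Rightarrow> real"
  assumes closed: "\<And>f. f \<in> S \<Longrightarrow> \<exists>g\<in>S. \<forall>x. (f has_real_derivative g x) (at x)" and f: "f \<in> S"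
  shows "((deriv ^^ n) f) differentiable (at x)"
proof -
  have "(deriv ^^ n) f \<in> S" for n
  proof (induction n)
    case (Suc n)
    obtain g where g: "g \<in> S" "\<And>x. ((deriv ^^ n) f has_real_derivative g x) (at x)"
      using closed[OF Suc] by blast
    have "deriv ((deriv ^^ n) f) = g" using g(2) DERIV_imp_deriv by blast
    then show ?case using g(1) by simp
  qed (simp add: f)
  then show ?thesis using closed real_differentiable_def by blast
qed

text \<open>Positive exactly on the interval from \<open>p\<close> to \<open>q\<close> when
  \<open>m > 0\<close>; as \<open>m\<close> grows it increases to the indicator of that open
  interval.\<close>

definition bump :: "real \<Rightarrow> real \<Rightarrow> nat \<Rightarrow> real \<Rightarrow> real" where
  "bump p q m x = flat 1 (real m * (x - p)) * flat 1 (real m * (q - x))"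

lemma bump_in_span: "bump p q m \<in> bump_span"
  unfolding bump_def[abs_def] by (rule bump_span.prod)

lemma flat_bounds: "0 \<le> flat 1 x" "flat 1 x \<le> 1"
  by (auto simp: flat_def)

lemma bump_bounds: "0 \<le> bump p q m x" "bump p q m x \<le> 1"
  using flat_bounds by (auto simp: bump_def intro: mult_le_one)

lemma bump_outside: "x \<notin> {p..q} \<Longrightarrow> bump p q m x = 0"
  by (auto simp: bump_def flat_def mult_less_0_iff zero_less_mult_iff not_le)

lemma bump_tendsto: "(\<lambda>m. bump p q (Suc m) x) \<longlonglongrightarrow> indicator {p<..<q} x"
proof -
  have pos: "(\<lambda>m. flat 1 (real (Suc m) * y)) \<longlonglongrightarrow> (if y > 0 then 1 else 0)" for y
  proof (cases "y > 0")
    case True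
    have "(\<lambda>m. exp (- (inverse (real (Suc m)) * (1 / y)))) \<longlonglongrightarrow> exp (- (0 * (1 / y)))"
      by (intro tendsto_exp tendsto_minus tendsto_mult LIMSEQ_inverse_real_of_nat tendsto_const)
    moreover have "flat 1 (real (Suc m) * y) = exp (- (inverse (real (Suc m)) * (1 / y)))" for m
      using True by (simp add: flat_def field_simps del: of_nat_Suc)
    ultimately show ?thesis using True by simp
  next
    case False
    then have "flat 1 (real (Suc m) * y) = 0" for m by (auto simp: flat_def zero_less_mult_iff)
    then show ?thesis using False by simp
  qed
  have "(\<lambda>m. bump p q (Suc m) x) \<longlonglongrightarrow> (if x - p > 0 then 1 else 0) * (if q - x > 0 then 1 else 0)"
    unfolding bump_def by (intro tendsto_mult pos)
  also have "(if x - p > 0 then 1 else 0) * (if q - x > 0 then 1 else 0::real) = indicator {p<..<q} x"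
    by (auto simp: indicator_def)
  finally show ?thesis .
qed

lemma bump_span_continuous: "f \<in> bump_span \<Longrightarrow> continuous_on S f"
  using bump_span_derivative DERIV_isCont continuous_at_imp_continuous_on by metis

text \<open>The antiderivative vanishing at \<open>p\<close> is constant on either side of the
  support of \<open>g\<close>; zero mean makes the constant on the right equal to the zero on the
  left.\<close>

lemma test_fun_antiderivative:
  assumes g: "g \<in> bump_span" and pq: "0 < p" "p \<le> q" "q < L" and out: "\<And>x. x \<notin> {p..q} \<Longrightarrow> g x = 0"
    and int: "integral {0..L} g = 0"
  shows "\<exists>\<phi>. test_fun L \<phi> \<and> (\<forall>x. deriv \<phi> x = g x)"
proof -
  have "\<exists>F. \<forall>x::real. -\<infinity> < ereal x \<longrightarrow> ereal x < \<infinity> \<longrightarrow> (F has_vector_derivative g x) (at x)"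
    by (rule einterval_antiderivative) (use bump_span_continuous[OF g, of UNIV] in \<open>auto simp: continuous_on_eq_continuous_at\<close>)
  then obtain F where F: "\<And>x. (F has_real_derivative g x) (at x)"
    by (auto simp: has_real_derivative_iff_has_vector_derivative)
  define \<phi> where "\<phi> x = F x - F p" for x
  have d\<phi>: "(\<phi> has_real_derivative g x) (at x)" for x
    unfolding \<phi>_def using DERIV_diff[OF F[of x] DERIV_const] by simp
  \<comment> \<open>Adjoining the antiderivative to \<open>bump_span\<close> keeps the family closed
    under differentiation.\<close>
  have smooth: "((deriv ^^ n) \<phi>) differentiable (at x)" for n x
    by (rule smooth_of_derivative_closed[of "insert \<phi> bump_span"])
      (use g d\<phi> bump_span_derivative in blast)+
  have ftc: "(g has_integral (\<phi> y - \<phi> x)) {x..y}" if "x \<le> y" for x y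
    by (rule fundamental_theorem_of_calculus[OF that])
      (use d\<phi> in \<open>auto simp: has_real_derivative_iff_has_vector_derivative intro: has_vector_derivative_at_within\<close>)
  have zero: "\<phi> y = \<phi> x" if "x \<le> y" "y \<le> p \<or> q \<le> x" for x y
  proof -
    have "(g has_integral 0) {x..y}"
      by (rule has_integral_spike_finite[of "{p, q}" _ g "\<lambda>x. 0"]) (use out that in auto)
    from has_integral_unique[OF ftc[OF that(1)] this] show ?thesis by simp
  qed
  have "\<phi> p = 0" by (simp add: \<phi>_def)
  moreover have "\<phi> q = \<phi> p"
    using integral_unique[OF ftc[of 0 L]] int zero[of 0 p] zero[of q L] pq by simp
  ultimately have out\<phi>: "\<phi> x = 0" if "x \<notin> {p..q}" for x
    using that zero[of x p] zero[of q x] by (cases "x < p") auto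
  have "test_fun L \<phi>"
    unfolding test_fun_def using smooth pq out\<phi> by (intro conjI allI exI[of _ p] exI[of _ q]) auto
  then show ?thesis using DERIV_imp_deriv[OF d\<phi>] by (intro exI[of _ \<phi>]) simp
qed

section \<open>Weak derivatives as primitives\<close>

lemma ae_eq_integral:
  assumes "ae_eq L f g" "S \<subseteq> {0..L}"
  shows "integral S f = integral S g"
proof -
  have "AE x in lebesgue. x \<in> {0..L} \<longrightarrow> f x = g x"
    using assms(1) unfolding ae_eq_def by (subst (asm) AE_restrict_space_iff) auto
  then obtain N where N: "negligible N" "{x. \<not> (x \<in> {0..L} \<longrightarrow> f x = g x)} \<subseteq> N"
    unfolding eventually_ae_filter_negligible by auto
  show ?thesis
  proof (rule integral_spike[OF N(1)])
    fix x assume x: "x \<in> S - N"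
    then have "x \<in> {0..L}" "x \<notin> {x. \<not> (x \<in> {0..L} \<longrightarrow> f x = g x)}" using assms(2) N(2) by blast+
    then show "g x = f x" by simp
  qed
qed

lemma integral_lebesgue_on: "integrable (lebesgue_on {0..L}) f \<Longrightarrow> integral\<^sup>L (lebesgue_on {0..L}) f = integral {0..L} f" for L :: real and f :: "real \<Rightarrow> real"
  by (rule lebesgue_integral_eq_integral) auto

lemma L2_inner_integral: "L2 L f \<Longrightarrow> L2 L g \<Longrightarrow> L2_inner L f g = integral {0..L} (\<lambda>x. f x * g x)"
  unfolding L2_inner_def by (intro integral_lebesgue_on L2_mult_integrable)

lemma L2_inner_diff: "L2 L f \<Longrightarrow> L2 L g \<Longrightarrow> L2 L h \<Longrightarrow> L2_inner L h (\<lambda>x. f x - g x) = L2_inner L h f - L2_inner L h g"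
  using inner_diff_right[of "emb L h" "emb L f" "emb L g"]
  by (simp add: inner_emb L2_diff flip: emb_diff)

lemma L2_inner_scale: "L2 L f \<Longrightarrow> L2 L h \<Longrightarrow> L2_inner L h (\<lambda>x. r * f x) = r * L2_inner L h f"
  using inner_scaleR_right[of "emb L h" r "emb L f"]
  by (simp add: inner_emb L2_scale flip: emb_scale)

lemma L2_inner_commute: "L2_inner L f g = L2_inner L g f"
  by (simp add: L2_inner_def mult.commute)

lemma L2_primitive:
  assumes "L2 L g"
  shows "continuous_on {0..L} (\<lambda>x. C + integral {0..x} g)"
  using L2_absolutely_integrable[OF assms]
  by (intro continuous_intros indefinite_integral_continuous_1) (simp add: absolutely_integrable_on_def)

text \<open>A fixed bump \<open>\<theta>\<close> of nonzero mean corrects any other bump to mean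
  zero, hence to the derivative of a test function. So \<open>k - c\<close> is orthogonal to all
  bumps compactly supported inside (0,L), in the limit to indicators of intervals, and therefore
  zero.\<close>

lemma du_bois_reymond:
  assumes L: "L > 0" and k: "L2 L k"
    and zero: "\<And>\<phi>. test_fun L \<phi> \<Longrightarrow> L2_inner L k (deriv \<phi>) = 0"
  shows "\<exists>c. ae_eq L k (\<lambda>x. c)"
proof -
  define \<theta> where "\<theta> = bump (L/4) (3*L/4) 1"
  have bL2: "L2 L f" if "f \<in> bump_span" for f by (intro L2_continuous bump_span_continuous that)
  have bi: "f integrable_on {0..L}" if "f \<in> bump_span" for f
    by (intro integrable_continuous_real bump_span_continuous that)
  have \<theta>: "\<theta> \<in> bump_span" unfolding \<theta>_def by (rule bump_in_span)
  define I where "I = integral {0..L} \<theta>"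
  have "\<theta> (L/2) > 0" using L by (simp add: \<theta>_def bump_def flat_def)
  then have "I \<noteq> 0"
    unfolding I_def using integral_eq_0_iff[of 0 L \<theta>] bump_span_continuous[OF \<theta>] L bump_bounds
    by (auto simp: \<theta>_def intro!: bexI[of _ "L/2"])
  \<comment> \<open>The only constant for which \<open>k - c\<close> is orthogonal to
    \<open>\<theta>\<close>.\<close>
  define c where "c = L2_inner L k \<theta> / I"
  have ind: "(LINT s:{p<..<q}|lebesgue. restr L (\<lambda>x. k x - c) s) = 0" if pq: "0 < p" "q < L" for p q
  proof (cases "p < q")
    case True
    have kc: "L2 L (\<lambda>x. k x - c)" by (intro L2_diff k L2_continuous) simp
    have z: "L2_inner L (\<lambda>x. k x - c) (bump p q (Suc m)) = 0" for m
    proof -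
      define \<psi> where "\<psi> = bump p q (Suc m)"
      have \<psi>: "\<psi> \<in> bump_span" unfolding \<psi>_def by (rule bump_in_span)
      define r where "r = integral {0..L} \<psi> / I"
      have g: "(\<lambda>x. \<psi> x + (- r) * \<theta> x) \<in> bump_span" by (intro bump_span.add \<psi> bump_span_scale \<theta>)
      have "integral {0..L} (\<lambda>x. \<psi> x - r * \<theta> x) = 0"
        by (subst Henstock_Kurzweil_Integration.integral_diff)
          (use bi[OF \<psi>] bi[OF bump_span_scale[OF \<theta>, of r]] \<open>I \<noteq> 0\<close> in \<open>auto simp: r_def I_def\<close>)
      then have "\<exists>\<phi>. test_fun L \<phi> \<and> (\<forall>x. deriv \<phi> x = \<psi> x + (- r) * \<theta> x)"
      proof (intro test_fun_antiderivative[OF g, of "min p (L/4)" "max q (3*L/4)"])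
        fix x assume "x \<notin> {min p (L/4)..max q (3*L/4)}"
        then have "x \<notin> {p..q}" "x \<notin> {L/4..3*L/4}" by auto
        then show "\<psi> x + (- r) * \<theta> x = 0" by (simp add: \<psi>_def \<theta>_def bump_outside)
      qed (use L pq True in auto)
      then obtain \<phi> where \<phi>: "test_fun L \<phi>" "deriv \<phi> = (\<lambda>x. \<psi> x - r * \<theta> x)"
        by (auto simp: fun_eq_iff)
      have "L2_inner L k (\<lambda>x. \<psi> x - r * \<theta> x) = 0" using zero[OF \<phi>(1)] by (simp add: \<phi>(2))
      then have "L2_inner L k \<psi> = r * L2_inner L k \<theta>"
        by (simp add: L2_inner_diff L2_inner_scale L2_scale k bL2 \<psi> \<theta>)
      also have "\<dots> = c * integral {0..L} \<psi>" by (simp add: r_def c_def)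
      also have "\<dots> = L2_inner L (\<lambda>x. c) \<psi>"
        by (subst L2_inner_integral) (auto intro: L2_continuous bL2 \<psi>)
      finally show ?thesis
        unfolding \<psi>_def[symmetric] L2_inner_commute[of L _ \<psi>]
        by (subst L2_inner_diff) (auto intro: L2_continuous bL2 \<psi> k)
    qed
    have "(\<lambda>m. L2_inner L (\<lambda>x. k x - c) (bump p q (Suc m))) \<longlonglongrightarrow>
        integral\<^sup>L (lebesgue_on {0..L}) (\<lambda>x. (k x - c) * indicator {p<..<q} x)"
      unfolding L2_inner_def
    proof (rule integral_dominated_convergence[where w = "\<lambda>x. \<bar>k x - c\<bar>"])
      have m: "(\<lambda>x. k x - c) \<in> borel_measurable (lebesgue_on {0..L})" using kc by (simp add: L2_def)
      show "(\<lambda>x. (k x - c) * indicator {p<..<q} x) \<in> borel_measurable (lebesgue_on {0..L})"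
        by (intro borel_measurable_times m borel_measurable_indicator)
          (use pq in \<open>auto simp: sets_restrict_space_iff\<close>)
      show "(\<lambda>x. (k x - c) * bump p q (Suc n) x) \<in> borel_measurable (lebesgue_on {0..L})" for n
        using bL2[OF bump_in_span] by (intro borel_measurable_times m) (simp add: L2_def)
      show "integrable (lebesgue_on {0..L}) (\<lambda>x. \<bar>k x - c\<bar>)"
        by (intro integrable_abs L2_integrable kc)
      show "AE x in lebesgue_on {0..L}. norm ((k x - c) * bump p q (Suc n) x) \<le> \<bar>k x - c\<bar>" for n
        using bump_bounds[of p q "Suc n"] by (auto simp: abs_mult intro!: mult_right_le_one_le)
      show "AE x in lebesgue_on {0..L}. (\<lambda>n. (k x - c) * bump p q (Suc n) x)
          \<longlonglongrightarrow> (k x - c) * indicator {p<..<q} x"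
        by (intro always_eventually allI tendsto_mult tendsto_const bump_tendsto)
    qed
    then have "integral\<^sup>L (lebesgue_on {0..L}) (\<lambda>x. (k x - c) * indicator {p<..<q} x) = 0"
      unfolding z using LIMSEQ_unique tendsto_const by blast
    also have "integral\<^sup>L (lebesgue_on {0..L}) (\<lambda>x. (k x - c) * indicator {p<..<q} x)
        = (LINT s:{p<..<q}|lebesgue. restr L (\<lambda>x. k x - c) s)"
      unfolding integral_restr set_lebesgue_integral_def
      by (rule Bochner_Integration.integral_cong) (auto simp: restr_def indicator_def)
    finally show ?thesis .
  qed (simp add: set_lebesgue_integral_def)
  have fi: "integrable lebesgue (restr L (\<lambda>x. k x - c))"
    unfolding integrable_restr[symmetric] by (intro L2_integrable L2_diff k L2_continuous) simp
  have "(LINT s:{x<..}|lebesgue. restr L (\<lambda>x. k x - c) s) = 0" for x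
  proof -
    let ?f = "restr L (\<lambda>x. k x - c)"
    \<comment> \<open>Orthogonality is known only for intervals with closure inside (0,L). They
      exhaust the part of the half line inside [0,L] except for endpoints, which form a null
      set.\<close>
    let ?A = "\<lambda>n. {max x 0 + inverse (real (Suc n)) <..< L - inverse (real (Suc n))}"
    have conv: "(\<lambda>n. LINT s:?A n|lebesgue. ?f s) \<longlonglongrightarrow> (LINT s:{x<..}|lebesgue. ?f s)"
      unfolding set_lebesgue_integral_def
    proof (rule integral_dominated_convergence[where w = "\<lambda>s. \<bar>?f s\<bar>"])
      show "integrable lebesgue (\<lambda>s. \<bar>?f s\<bar>)" using fi by (rule integrable_abs)
      show "AE s in lebesgue. norm (indicator (?A n) s *\<^sub>R ?f s) \<le> \<bar>?f s\<bar>" for n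
        by (auto simp: indicator_def)
      have "AE s in lebesgue. s \<noteq> 0 \<and> s \<noteq> L"
        unfolding eventually_ae_filter_negligible by (rule exI[of _ "{0, L}"]) auto
      then show "AE s in lebesgue. (\<lambda>n. indicator (?A n) s *\<^sub>R ?f s) \<longlonglongrightarrow> indicator {x<..} s *\<^sub>R ?f s"
      proof eventually_elim
        fix s :: real assume s: "s \<noteq> 0 \<and> s \<noteq> L"
        consider "s \<notin> {0..L}" | "s \<le> x" | "max x 0 < s" "s < L" using s by fastforce
        then show "(\<lambda>n. indicator (?A n) s *\<^sub>R ?f s) \<longlonglongrightarrow> indicator {x<..} s *\<^sub>R ?f s"
        proof cases
          case 1
          then have "?f s = 0" by (auto simp: restr_def)
          then show ?thesis by simp
        next
          case 2
          have "s \<notin> ?A n" for n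
          proof -
            have "s \<le> max x 0 + inverse (real (Suc n))" using 2 by (intro add_increasing2) auto
            then show ?thesis by simp
          qed
          then have "(\<lambda>n. indicator (?A n) s *\<^sub>R ?f s) = (\<lambda>n. 0)" by simp
          then show ?thesis using 2 by (simp only:) simp
        next
          case 3
          have "\<forall>\<^sub>F n in sequentially. inverse (real (Suc n)) < min (s - max x 0) (L - s)"
            by (rule order_tendstoD[OF LIMSEQ_inverse_real_of_nat]) (use 3 in auto)
          then have "\<forall>\<^sub>F n in sequentially. indicator {x<..} s *\<^sub>R ?f s = indicator (?A n) s *\<^sub>R ?f s"
            by eventually_elim (use 3 in \<open>auto simp: indicator_def\<close>)
          then show ?thesis by (rule Lim_transform_eventually[OF tendsto_const])
        qed
      qed
    qed (auto intro!: borel_measurable_times borel_measurable_indicator borel_measurable_integrable[OF fi])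
    have "(LINT s:?A n|lebesgue. ?f s) = 0" for n
    proof (rule ind)
      show "0 < max x 0 + inverse (real (Suc n))" by (intro add_nonneg_pos) auto
    qed simp
    from LIMSEQ_unique[OF conv[unfolded this] tendsto_const] show ?thesis .
  qed
  from integral_zero_imp_AE_zero[OF fi this]
  have "ae_eq L k (\<lambda>x. c)"
    unfolding ae_eq_restr by (rule eventually_mono) (auto simp: restr_def)
  then show ?thesis by blast
qed

lemma test_fun_props:
  assumes "test_fun L \<phi>"
  shows "(\<phi> has_real_derivative deriv \<phi> x) (at x)" "continuous_on S (deriv \<phi>)" "continuous_on S \<phi>" "\<phi> 0 = 0" "\<phi> L = 0"
proof -
  have d: "((deriv ^^ n) \<phi>) differentiable (at x)" for n x using assms by (auto simp: test_fun_def)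
  have "\<phi> differentiable (at x)" for x using d[of 0 x] by simp
  then show der: "(\<phi> has_real_derivative deriv \<phi> x) (at x)" for x
    using DERIV_deriv_iff_real_differentiable by blast
  have "deriv \<phi> differentiable (at x)" for x using d[of 1 x] by simp
  then show "continuous_on S (deriv \<phi>)"
    by (intro continuous_at_imp_continuous_on ballI differentiable_imp_continuous_within)
  show "continuous_on S \<phi>"
    by (intro continuous_at_imp_continuous_on ballI DERIV_isCont[OF der])
  show "\<phi> 0 = 0" "\<phi> L = 0" using assms by (auto simp: test_fun_def)
qed

lemma primitive_weak_pairing:
  assumes "L > 0" "L2 L g" "test_fun L \<phi>"
  shows "L2_inner L (\<lambda>x. C + integral {0..x} g) (deriv \<phi>) = - L2_inner L g \<phi>"
proof -
  note t = test_fun_props[OF assms(3)]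
  have "integral {0..L} (\<lambda>x. \<phi> x * g x) = \<phi> L * (C + integral {0..L} g) - \<phi> 0 * (C + integral {0..0} g)
      - integral {0..L} (\<lambda>x. deriv \<phi> x * (C + integral {0..x} g))"
    by (rule integration_by_parts_primitive)
      (use assms(1) t in \<open>auto intro: has_field_derivative_at_within L2_absolutely_integrable assms(2)\<close>)
  then show ?thesis
    using t L2_primitive[OF assms(2)]
    by (simp add: L2_inner_integral L2_continuous assms(2) mult.commute)
qed

text \<open>If \<open>g\<close> is the weak derivative, \<open>f\<close> minus the primitive of
  \<open>g\<close> has weak derivative zero and is constant by du Bois-Reymond. The converse is
  integration by parts against test functions, whose boundary terms vanish.\<close>

lemma weak_deriv_iff_primitive:
  assumes L: "L > 0"
  shows "weak_deriv L f g \<longleftrightarrow> L2 L g \<and> (\<exists>C. ae_eq L f (\<lambda>x. C + integral {0..x} g))"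
proof
  assume w: "weak_deriv L f g"
  then have f: "L2 L f" and g: "L2 L g"
    and eq: "\<And>\<phi>. test_fun L \<phi> \<Longrightarrow> L2_inner L f (deriv \<phi>) = - L2_inner L g \<phi>"
    by (auto simp: weak_deriv_def L2_inner_def)
  let ?P = "\<lambda>x. 0 + integral {0..x} g"
  have P: "L2 L ?P" by (rule L2_continuous[OF L2_primitive[OF g]])
  have "\<exists>c. ae_eq L (\<lambda>x. f x - ?P x) (\<lambda>x. c)"
  proof (rule du_bois_reymond[OF L L2_diff[OF f P]])
    fix \<phi> assume \<phi>: "test_fun L \<phi>"
    have "L2 L (deriv \<phi>)" by (intro L2_continuous test_fun_props(2)[OF \<phi>])
    then show "L2_inner L (\<lambda>x. f x - ?P x) (deriv \<phi>) = 0"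
      using eq[OF \<phi>] primitive_weak_pairing[OF L g \<phi>, of 0]
        L2_inner_diff[OF f P, of "deriv \<phi>"]
      unfolding L2_inner_commute[of L _ "deriv \<phi>"] by simp
  qed
  then obtain c where "ae_eq L (\<lambda>x. f x - ?P x) (\<lambda>x. c)" by blast
  then have "ae_eq L f (\<lambda>x. c + integral {0..x} g)"
    unfolding ae_eq_def by (rule eventually_mono) simp
  with g show "L2 L g \<and> (\<exists>C. ae_eq L f (\<lambda>x. C + integral {0..x} g))" by blast
next
  assume "L2 L g \<and> (\<exists>C. ae_eq L f (\<lambda>x. C + integral {0..x} g))"
  then obtain C where g: "L2 L g" and f: "ae_eq L f (\<lambda>x. C + integral {0..x} g)" by blast
  let ?P = "\<lambda>x. C + integral {0..x} g"
  have P: "L2 L ?P" by (rule L2_continuous[OF L2_primitive[OF g]])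
  have f': "ae_eq L ?P f" using f unfolding ae_eq_def by (rule eventually_mono) simp
  have fL: "L2 L f" by (rule L2_cong_ae[OF P f'])
  have "L2_inner L f (deriv \<phi>) = - L2_inner L g \<phi>" if \<phi>: "test_fun L \<phi>" for \<phi>
  proof -
    have "L2 L (deriv \<phi>)" by (intro L2_continuous test_fun_props(2)[OF \<phi>])
    then have "L2_inner L f (deriv \<phi>) = L2_inner L ?P (deriv \<phi>)"
      using emb_cong[OF P f'] by (metis P fL inner_emb)
    then show ?thesis using primitive_weak_pairing[OF L g \<phi>] by simp
  qed
  with fL g show "weak_deriv L f g" by (simp add: weak_deriv_def L2_inner_def)
qed

section \<open>A linear differential equation of order three\<close>

text \<open>Variation of constants. The coefficient is complex because two characteristic roots of
  the third-order equation are.\<close>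

lemma linear_ode_order_one:
  fixes l :: complex and \<Psi> :: "real \<Rightarrow> real"
  assumes "continuous_on {0..L} \<Psi>"
  shows "\<exists>v. v 0 = 0 \<and> (\<forall>x\<in>{0..L}. (v has_vector_derivative l * v x + of_real (\<Psi> x)) (at x within {0..L}))"
proof -
  let ?f = "\<lambda>s. exp (- l * of_real s) * complex_of_real (\<Psi> s)"
  let ?I = "\<lambda>x. integral {0..x} ?f"
  let ?v = "\<lambda>x. exp (l * of_real x) * ?I x"
  have "(?v has_vector_derivative l * ?v x + of_real (\<Psi> x)) (at x within {0..L})" if x: "x \<in> {0..L}" for x
  proof -
  have I: "(?I has_vector_derivative ?f x) (at x within {0..L})"
    by (rule integral_has_vector_derivative[OF _ x]) (intro continuous_intros assms)
  have E: "((\<lambda>x. exp (l * of_real x)) has_vector_derivative l * exp (l * of_real x)) (at x within {0..L})"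
  proof -
    have "((\<lambda>z. exp (l * z)) has_field_derivative exp (l * of_real x) * l) (at (of_real x))"
      by (auto intro!: derivative_eq_intros)
    from has_vector_derivative_real_field[OF this] show ?thesis
      by (simp add: o_def mult.commute)
  qed
  have "exp (l * of_real x) * ?f x = of_real (\<Psi> x)"
    by (simp add: mult.assoc[symmetric] exp_minus)
  then show ?thesis
    using has_vector_derivative_mult[OF E I] by (simp only: add.commute mult.assoc)
  qed
  then show ?thesis by (intro exI[of _ ?v]) simp
qed

text \<open>This is the characteristic polynomial of Y''' + Y' + \<mu> Y. Dividing out a real root s
  leaves z^2 + s z + s^2 + 1 with discriminant - 3 s^2 - 4 < 0, so the other roots are a nonreal
  conjugate pair.\<close>

lemma cubic_has_distinct_roots:
  fixes \<mu> :: real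
  assumes "\<mu> > 0"
  shows "\<exists>p q r :: complex. p \<noteq> q \<and> q \<noteq> r \<and> p \<noteq> r \<and>
     p ^ 3 + p + of_real \<mu> = 0 \<and> q ^ 3 + q + of_real \<mu> = 0 \<and> r ^ 3 + r + of_real \<mu> = 0"
proof -
  have "\<exists>s. - \<mu> \<le> s \<and> s \<le> 0 \<and> s ^ 3 + s + \<mu> = 0"
    by (rule IVT') (use assms in \<open>auto intro!: continuous_intros\<close>)
  then obtain s :: real where s: "s ^ 3 + s + \<mu> = 0" by blast
  then have \<mu>: "\<mu> = - (s ^ 3) - s" by simp
  define t where "t = sqrt (3 * s\<^sup>2 / 4 + 1)"
  have t2: "t\<^sup>2 = 3 * s\<^sup>2 / 4 + 1" and t0: "t \<noteq> 0"
    by (auto simp: t_def add_nonneg_eq_0_iff)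
  have sq: "z ^ 3 + z + of_real \<mu> = (z - of_real s) * (z\<^sup>2 + of_real s * z + of_real (s\<^sup>2 + 1))" for z :: complex
    by (simp add: \<mu> algebra_simps power2_eq_square power3_eq_cube)
  have root: "z\<^sup>2 + of_real s * z + of_real (s\<^sup>2 + 1) = 0" if "z = Complex (- s / 2) t'" "t'\<^sup>2 = t\<^sup>2" for z t'
    using that t2 by (auto simp: complex_eq_iff power2_eq_square algebra_simps)
  have "of_real s \<noteq> Complex (- s / 2) t" "of_real s \<noteq> Complex (- s / 2) (- t)"
    "Complex (- s / 2) t \<noteq> Complex (- s / 2) (- t)"
    using t0 by (auto simp: complex_eq_iff)
  then show ?thesis
    using root[OF refl, of t] root[OF refl, of "- t"]
    by (intro exI[of _ "of_real s"] exI[of _ "Complex (- s / 2) t"] exI[of _ "Complex (- s / 2) (- t)"])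
      (auto simp: sq)
qed

text \<open>The weights of the second divided difference at \<open>p\<close>, \<open>q\<close>,
  \<open>r\<close>: it annihilates 1 and z and takes the value 1 on z^2.\<close>

lemma divided_difference_weights:
  fixes p q r :: complex
  assumes "p \<noteq> q" "q \<noteq> r" "p \<noteq> r"
  shows "\<exists>a b c. a + b + c = 0 \<and> a * p + b * q + c * r = 0 \<and> a * p\<^sup>2 + b * q\<^sup>2 + c * r\<^sup>2 = 1"
proof (intro exI conjI)
  let ?a = "1 / ((p - q) * (p - r))" and ?b = "1 / ((q - p) * (q - r))" and ?c = "1 / ((r - p) * (r - q))"
  have nz: "p - q \<noteq> 0" "q - r \<noteq> 0" "p - r \<noteq> 0" "q - p \<noteq> 0" "r - q \<noteq> 0" "r - p \<noteq> 0" using assms by auto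
  show "?a + ?b + ?c = 0" using nz by (simp add: divide_simps) (simp add: algebra_simps)
  show "?a * p + ?b * q + ?c * r = 0" using nz by (simp add: divide_simps) (simp add: algebra_simps)
  show "?a * p\<^sup>2 + ?b * q\<^sup>2 + ?c * r\<^sup>2 = 1"
    using nz by (simp add: divide_simps) (simp add: algebra_simps power2_eq_square)
qed

text \<open>Combine the three first-order solutions with these weights. The forcing then cancels in
  the first two derivatives and appears with coefficient 1 in the third; the cubic equation for the
  roots supplies the remaining terms.\<close>

lemma linear_ode_order_three_zero_data:
  fixes \<Psi> :: "real \<Rightarrow> real"
  assumes \<mu>: "\<mu> > 0" and \<Psi>: "continuous_on {0..L} \<Psi>"
  shows "\<exists>Y Y1 Y2. Y 0 = 0 \<and> Y1 0 = 0 \<and> Y2 0 = 0 \<and> (\<forall>x\<in>{0..L}.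
     (Y has_real_derivative Y1 x) (at x within {0..L}) \<and>
     (Y1 has_real_derivative Y2 x) (at x within {0..L}) \<and>
     (Y2 has_real_derivative \<Psi> x - Y1 x - \<mu> * Y x) (at x within {0..L}))"
proof -
  obtain p q r :: complex where dist: "p \<noteq> q" "q \<noteq> r" "p \<noteq> r"
    and roots: "p ^ 3 + p + of_real \<mu> = 0" "q ^ 3 + q + of_real \<mu> = 0" "r ^ 3 + r + of_real \<mu> = 0"
    using cubic_has_distinct_roots[OF \<mu>] by blast
  have cubes: "p ^ 3 = - p - of_real \<mu>" "q ^ 3 = - q - of_real \<mu>" "r ^ 3 = - r - of_real \<mu>"
    using roots by (simp_all add: add_eq_0_iff algebra_simps)
  obtain a b c where abc: "a + b + c = 0" "a * p + b * q + c * r = 0" "a * p\<^sup>2 + b * q\<^sup>2 + c * r\<^sup>2 = 1"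
    using divided_difference_weights[OF dist] by blast
  obtain u v w where u: "u 0 = 0" "\<And>x. x \<in> {0..L} \<Longrightarrow> (u has_vector_derivative p * u x + of_real (\<Psi> x)) (at x within {0..L})"
    and v: "v 0 = 0" "\<And>x. x \<in> {0..L} \<Longrightarrow> (v has_vector_derivative q * v x + of_real (\<Psi> x)) (at x within {0..L})"
    and w: "w 0 = 0" "\<And>x. x \<in> {0..L} \<Longrightarrow> (w has_vector_derivative r * w x + of_real (\<Psi> x)) (at x within {0..L})"
    using linear_ode_order_one[OF \<Psi>] by metis
  have der: "((\<lambda>x. Re (A * u x + B * v x + C * w x)) has_real_derivative
      Re (A * p * u x + B * q * v x + C * r * w x) + Re (A + B + C) * \<Psi> x) (at x within {0..L})"
    if x: "x \<in> {0..L}" for A B C x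
  proof -
    have "((\<lambda>x. A * u x + B * v x + C * w x) has_vector_derivative
        A * (p * u x + of_real (\<Psi> x)) + B * (q * v x + of_real (\<Psi> x)) + C * (r * w x + of_real (\<Psi> x))) (at x within {0..L})"
      by (intro has_vector_derivative_add has_vector_derivative_mult_right u v w x)
    from bounded_linear.has_vector_derivative[OF bounded_linear_Re this]
    show ?thesis
      unfolding has_real_derivative_iff_has_vector_derivative
      by (rule has_vector_derivative_eq_rhs) (simp add: algebra_simps)
  qed
  define Y Y1 Y2 where "Y x = Re (a * u x + b * v x + c * w x)"
    and "Y1 x = Re (a * p * u x + b * q * v x + c * r * w x)"
    and "Y2 x = Re (a * p\<^sup>2 * u x + b * q\<^sup>2 * v x + c * r\<^sup>2 * w x)" for x
  have "(Y has_real_derivative Y1 x) (at x within {0..L})" if "x \<in> {0..L}" for x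
    using der[OF that, of a b c] abc(1) by (simp add: Y_def[abs_def] Y1_def)
  moreover have "(Y1 has_real_derivative Y2 x) (at x within {0..L})" if "x \<in> {0..L}" for x
    using der[OF that, of "a * p" "b * q" "c * r"] abc(2)
    by (simp add: Y1_def[abs_def] Y2_def power2_eq_square mult.assoc)
  moreover have "(Y2 has_real_derivative \<Psi> x - Y1 x - \<mu> * Y x) (at x within {0..L})" if "x \<in> {0..L}" for x
  proof -
    have "a * p\<^sup>2 * p * u x + b * q\<^sup>2 * q * v x + c * r\<^sup>2 * r * w x
        = a * p ^ 3 * u x + b * q ^ 3 * v x + c * r ^ 3 * w x"
      by (simp add: power2_eq_square power3_eq_cube mult.assoc)
    also have "\<dots> = - (a * p * u x + b * q * v x + c * r * w x) - of_real \<mu> * (a * u x + b * v x + c * w x)"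
      unfolding cubes by (simp add: algebra_simps)
    finally have *: "Re (a * p\<^sup>2 * p * u x + b * q\<^sup>2 * q * v x + c * r\<^sup>2 * r * w x) = - Y1 x - \<mu> * Y x"
      unfolding Y1_def Y_def by (simp only: minus_complex.sel uminus_complex.sel Re_complex_of_real
          times_complex.sel Im_complex_of_real mult_zero_left diff_0_right)
    have "Y2 = (\<lambda>x. Re (a * p\<^sup>2 * u x + b * q\<^sup>2 * v x + c * r\<^sup>2 * w x))"
      by (simp only: Y2_def fun_eq_iff simp_thms)
    then show ?thesis
      using der[OF that, of "a * p\<^sup>2" "b * q\<^sup>2" "c * r\<^sup>2"] abc(3)
      unfolding * by (simp only: one_complex.sel) (simp add: algebra_simps)
  qed
  ultimately show ?thesis
    by (intro exI[of _ Y] exI[of _ Y1] exI[of _ Y2]) (simp add: Y_def Y1_def Y2_def u(1) v(1) w(1))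
qed

lemma linear_ode_order_three:
  fixes \<Psi> :: "real \<Rightarrow> real"
  assumes \<mu>: "\<mu> > 0" and \<Psi>: "continuous_on {0..L} \<Psi>"
  shows "\<exists>Y Y1 Y2. Y 0 = 0 \<and> Y1 0 = 0 \<and> Y2 0 = \<alpha> \<and> (\<forall>x\<in>{0..L}.
     (Y has_real_derivative Y1 x) (at x within {0..L}) \<and>
     (Y1 has_real_derivative Y2 x) (at x within {0..L}) \<and>
     (Y2 has_real_derivative \<Psi> x - Y1 x - \<mu> * Y x) (at x within {0..L}))"
proof -
  \<comment> \<open>The forcing for \<open>Z = Y - \<alpha> * x\<^sup>2 / 2\<close>, which has zero
    initial data.\<close>
  have "continuous_on {0..L} (\<lambda>x. \<Psi> x - \<alpha> * x - \<mu> * (\<alpha> * x\<^sup>2 / 2))" by (intro continuous_intros \<Psi>) auto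
  from linear_ode_order_three_zero_data[OF \<mu> this] obtain Z Z1 Z2 where
    Z: "Z 0 = 0" "Z1 0 = 0" "Z2 0 = 0" and
    der: "\<And>x. x \<in> {0..L} \<Longrightarrow> (Z has_real_derivative Z1 x) (at x within {0..L})"
      "\<And>x. x \<in> {0..L} \<Longrightarrow> (Z1 has_real_derivative Z2 x) (at x within {0..L})"
      "\<And>x. x \<in> {0..L} \<Longrightarrow> (Z2 has_real_derivative \<Psi> x - \<alpha> * x - \<mu> * (\<alpha> * x\<^sup>2 / 2) - Z1 x - \<mu> * Z x) (at x within {0..L})"
    by blast
  show ?thesis
    by (rule exI[of _ "\<lambda>x. Z x + \<alpha> * x\<^sup>2 / 2"], rule exI[of _ "\<lambda>x. Z1 x + \<alpha> * x"], rule exI[of _ "\<lambda>x. Z2 x + \<alpha>"])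
      (auto simp: Z algebra_simps intro!: derivative_eq_intros der)
qed

section \<open>The generator\<close>

text \<open>The pointwise form of H^3: classical derivatives up to order two and an absolutely
  continuous second derivative with density \<open>y3\<close> in L^2.\<close>

definition H3_class :: "real \<Rightarrow> (real \<Rightarrow> real) \<Rightarrow> (real \<Rightarrow> real) \<Rightarrow> (real \<Rightarrow> real) \<Rightarrow> (real \<Rightarrow> real) \<Rightarrow> bool" where
  "H3_class L y y1 y2 y3 \<longleftrightarrow> L2 L y3 \<and> (\<forall>x\<in>{0..L}.
     (y has_real_derivative y1 x) (at x within {0..L}) \<and>
     (y1 has_real_derivative y2 x) (at x within {0..L}) \<and>
     y2 x = y2 0 + integral {0..x} y3)"

lemma H3_classD:
  assumes "H3_class L y y1 y2 y3"
  shows "L2 L y3"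
    "\<And>x. x \<in> {0..L} \<Longrightarrow> (y has_real_derivative y1 x) (at x within {0..L})"
    "\<And>x. x \<in> {0..L} \<Longrightarrow> (y1 has_real_derivative y2 x) (at x within {0..L})"
    "\<And>x. x \<in> {0..L} \<Longrightarrow> y2 x = y2 0 + integral {0..x} y3"
    "continuous_on {0..L} y" "continuous_on {0..L} y1" "continuous_on {0..L} y2"
proof -
  show y3: "L2 L y3"
    and d: "\<And>x. x \<in> {0..L} \<Longrightarrow> (y has_real_derivative y1 x) (at x within {0..L})"
    and d1: "\<And>x. x \<in> {0..L} \<Longrightarrow> (y1 has_real_derivative y2 x) (at x within {0..L})"
    and i: "\<And>x. x \<in> {0..L} \<Longrightarrow> y2 x = y2 0 + integral {0..x} y3"
    using assms unfolding H3_class_def by blast+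
  show "continuous_on {0..L} y" by (rule DERIV_continuous_on[OF d])
  show "continuous_on {0..L} y1" by (rule DERIV_continuous_on[OF d1])
  show "continuous_on {0..L} y2"
    by (rule continuous_on_eq[OF L2_primitive[OF y3] i[symmetric]])
qed

lemma H3_class_L2:
  assumes "H3_class L y y1 y2 y3"
  shows "L2 L y" "L2 L y1" "L2 L y2" "L2 L y3"
  using H3_classD(1,5,6,7)[OF assms] by (auto intro: L2_continuous)

lemma L2_integrable_on: "L2 L f \<Longrightarrow> {x..x'} \<subseteq> {0..L} \<Longrightarrow> f integrable_on {x..x'}"
  using L2_absolutely_integrable[of L f] integrable_subinterval_real[of f 0 L x x']
  by (auto simp: absolutely_integrable_on_def)

lemma H3_class_add:
  assumes "H3_class L y y1 y2 y3" "H3_class L w w1 w2 w3"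
  shows "H3_class L (\<lambda>x. y x + w x) (\<lambda>x. y1 x + w1 x) (\<lambda>x. y2 x + w2 x) (\<lambda>x. y3 x + w3 x)"
  unfolding H3_class_def
proof (intro conjI ballI)
  note y = H3_classD[OF assms(1)] and w = H3_classD[OF assms(2)]
  show "L2 L (\<lambda>x. y3 x + w3 x)" by (intro L2_add y w)
  fix x assume x: "x \<in> {0..L}"
  show "((\<lambda>x. y x + w x) has_real_derivative y1 x + w1 x) (at x within {0..L})"
    by (intro DERIV_add y(2) w(2) x)
  show "((\<lambda>x. y1 x + w1 x) has_real_derivative y2 x + w2 x) (at x within {0..L})"
    by (intro DERIV_add y(3) w(3) x)
  have "integral {0..x} (\<lambda>x. y3 x + w3 x) = integral {0..x} y3 + integral {0..x} w3"
    using x y(1) w(1) by (intro Henstock_Kurzweil_Integration.integral_add L2_integrable_on[of L]) auto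
  then show "y2 x + w2 x = y2 0 + w2 0 + integral {0..x} (\<lambda>x. y3 x + w3 x)"
    using y(4)[OF x] w(4)[OF x] by linarith
qed

lemma H3_class_scale:
  assumes "H3_class L y y1 y2 y3"
  shows "H3_class L (\<lambda>x. r * y x) (\<lambda>x. r * y1 x) (\<lambda>x. r * y2 x) (\<lambda>x. r * y3 x)"
  unfolding H3_class_def
proof (intro conjI ballI)
  note y = H3_classD[OF assms(1)]
  show "L2 L (\<lambda>x. r * y3 x)" by (intro L2_scale y)
  fix x assume x: "x \<in> {0..L}"
  show "((\<lambda>x. r * y x) has_real_derivative r * y1 x) (at x within {0..L})" by (intro DERIV_cmult y(2) x)
  show "((\<lambda>x. r * y1 x) has_real_derivative r * y2 x) (at x within {0..L})" by (intro DERIV_cmult y(3) x)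
  show "r * y2 x = r * y2 0 + integral {0..x} (\<lambda>x. r * y3 x)"
    using y(4)[OF x] by (simp add: distrib_left)
qed

lemma H3_class_diff:
  assumes "H3_class L y y1 y2 y3" "H3_class L w w1 w2 w3"
  shows "H3_class L (\<lambda>x. y x - w x) (\<lambda>x. y1 x - w1 x) (\<lambda>x. y2 x - w2 x) (\<lambda>x. y3 x - w3 x)"
  using H3_class_add[OF assms(1) H3_class_scale[OF assms(2), of "-1"]] by simp

lemma integral_real_derivative:
  fixes y y1 :: "real \<Rightarrow> real"
  assumes "\<And>x. x \<in> {0..L} \<Longrightarrow> (y has_real_derivative y1 x) (at x within {0..L})" "0 \<le> s" "s \<le> x" "x \<le> L"
  shows "integral {s..x} y1 = y x - y s"
proof (rule integral_unique, rule fundamental_theorem_of_calculus)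
  fix t assume "t \<in> {s..x}"
  then have "(y has_vector_derivative y1 t) (at t within {0..L})"
    using assms by (auto simp: has_real_derivative_iff_has_vector_derivative)
  then show "(y has_vector_derivative y1 t) (at t within {s..x})"
    by (rule has_vector_derivative_within_subset) (use assms in auto)
qed (use assms in auto)

lemma ae_eq_sym: "ae_eq L f g \<Longrightarrow> ae_eq L g f"
  unfolding ae_eq_def by (erule eventually_mono, erule sym)

lemma ae_eq_trans: "ae_eq L f g \<Longrightarrow> ae_eq L g h \<Longrightarrow> ae_eq L f h"
  unfolding ae_eq_def by (erule (1) eventually_elim2, erule (1) trans)

lemma ae_eq_on: "(\<And>x. x \<in> {0..L} \<Longrightarrow> f x = g x) \<Longrightarrow> ae_eq L f g"
  unfolding ae_eq_def by (rule AE_I2) simp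

lemma H3_derivs_of_class:
  assumes L: "L > 0" and y: "H3_class L y y1 y2 y3" and f: "ae_eq L f y"
  shows "H3_derivs L f y1 y2 y3"
proof -
  note d = H3_classD[OF y] and L2 = H3_class_L2[OF y]
  have "ae_eq L y (\<lambda>x. y 0 + integral {0..x} y1)"
    by (rule ae_eq_on) (use integral_real_derivative[OF d(2), of 0] in simp)
  moreover have "ae_eq L y1 (\<lambda>x. y1 0 + integral {0..x} y2)"
    by (rule ae_eq_on) (use integral_real_derivative[OF d(3), of 0] in simp)
  moreover have "ae_eq L y2 (\<lambda>x. y2 0 + integral {0..x} y3)"
    by (rule ae_eq_on) (rule d(4))
  ultimately show ?thesis
    unfolding H3_derivs_def weak_deriv_iff_primitive[OF L] using L2 ae_eq_trans[OF f] by blast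
qed

text \<open>The representatives are built from the highest derivative down, each as the primitive of
  the continuous representative one order above, so that the lower two are differentiable at every
  point.\<close>

lemma class_of_H3_derivs:
  assumes L: "L > 0" and "H3_derivs L f g1 g2 g3"
  shows "\<exists>y y1 y2. H3_class L y y1 y2 g3 \<and> ae_eq L f y \<and> ae_eq L g1 y1 \<and> ae_eq L g2 y2"
proof -
  obtain C C1 C2 where g: "L2 L g1" "L2 L g2" "L2 L g3"
    and C: "ae_eq L f (\<lambda>x. C + integral {0..x} g1)" "ae_eq L g1 (\<lambda>x. C1 + integral {0..x} g2)"
      "ae_eq L g2 (\<lambda>x. C2 + integral {0..x} g3)"
    using assms(2) unfolding H3_derivs_def weak_deriv_iff_primitive[OF L] by blast
  define y2 where "y2 x = C2 + integral {0..x} g3" for x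
  define y1 where "y1 x = C1 + integral {0..x} y2" for x
  define y where "y x = C + integral {0..x} y1" for x
  have c2: "continuous_on {0..L} y2" unfolding y2_def by (rule L2_primitive[OF g(3)])
  have c1: "continuous_on {0..L} y1" unfolding y1_def by (rule L2_primitive[OF L2_continuous[OF c2]])
  have g2: "ae_eq L g2 y2" using C(3) by (simp add: y2_def[abs_def])
  have "ae_eq L (\<lambda>x. C1 + integral {0..x} g2) y1"
    by (rule ae_eq_on) (use ae_eq_integral[OF g2] in \<open>simp add: y1_def\<close>)
  then have g1: "ae_eq L g1 y1" using C(2) ae_eq_trans by blast
  have "ae_eq L (\<lambda>x. C + integral {0..x} g1) y"
    by (rule ae_eq_on) (use ae_eq_integral[OF g1] in \<open>simp add: y_def\<close>)
  then have f: "ae_eq L f y" using C(1) ae_eq_trans by blast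
  have "H3_class L y y1 y2 g3"
    unfolding H3_class_def
  proof (intro conjI ballI g)
    fix x assume x: "x \<in> {0..L}"
    show "(y has_real_derivative y1 x) (at x within {0..L})"
      using DERIV_add[OF DERIV_const integral_has_real_derivative[OF c1 x]] by (simp add: y_def[abs_def])
    show "(y1 has_real_derivative y2 x) (at x within {0..L})"
      using DERIV_add[OF DERIV_const integral_has_real_derivative[OF c2 x]] by (simp add: y1_def[abs_def])
    show "y2 x = y2 0 + integral {0..x} g3" by (simp add: y2_def)
  qed
  with f g1 g2 show ?thesis by blast
qed

lemma continuous_ae_eq:
  assumes L: "L > 0" and f: "continuous_on {0..L} f" and g: "continuous_on {0..L} g" and ae: "ae_eq L f g"
    and x: "x \<in> {0..L}"
  shows "f x = g x"
proof -
  have "integral {0..L} (\<lambda>x. (f x - g x)\<^sup>2) = integral {0..L} (\<lambda>x. 0)"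
  proof (rule ae_eq_integral[of L])
    show "ae_eq L (\<lambda>x. (f x - g x)\<^sup>2) (\<lambda>x. 0)"
      using ae unfolding ae_eq_def by (rule eventually_mono) simp
  qed simp
  then have "integral {0..L} (\<lambda>x. (f x - g x)\<^sup>2) = 0" by simp
  moreover have "continuous_on {0..L} (\<lambda>x. (f x - g x)\<^sup>2)" by (intro continuous_intros f g)
  ultimately have "\<forall>x\<in>{0..L}. (f x - g x)\<^sup>2 = 0"
    using integral_eq_0_iff[of 0 L "\<lambda>x. (f x - g x)\<^sup>2"] L by simp
  then show ?thesis using x by auto
qed

lemma derivative_unique_on:
  fixes f g f' g' :: "real \<Rightarrow> real"
  assumes L: "L > 0" and "\<And>x. x \<in> {0..L} \<Longrightarrow> (f has_real_derivative f' x) (at x within {0..L})"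
    "\<And>x. x \<in> {0..L} \<Longrightarrow> (g has_real_derivative g' x) (at x within {0..L})"
    "\<And>x. x \<in> {0..L} \<Longrightarrow> f x = g x" and x: "x \<in> {0..L}"
  shows "f' x = g' x"
proof -
  have "(f has_vector_derivative g' x) (at x within {0..L})"
    by (rule has_vector_derivative_transform[OF x assms(4)
          assms(3)[OF x, unfolded has_real_derivative_iff_has_vector_derivative]])
  then show ?thesis
    using vector_derivative_unique_within_closed_interval[of 0 L x f "f' x" "g' x"] L x assms(2)[OF x]
    by (simp add: has_real_derivative_iff_has_vector_derivative)
qed

text \<open>Continuous representatives are unique, so boundary values read from any witness of
  \<open>C1_rep\<close> are those of the function in \<open>H3_class\<close>.\<close>

lemma C1_rep_class:
  assumes L: "L > 0" and y: "H3_class L y y1 y2 y3" and f: "ae_eq L f y" and h: "C1_rep L f h h'"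
    and x: "x \<in> {0..L}"
  shows "h x = y x" "h' x = y1 x"
proof -
  have dh: "\<And>x. x \<in> {0..L} \<Longrightarrow> (h has_real_derivative h' x) (at x within {0..L})" and fh: "ae_eq L f h"
    using h by (auto simp: C1_rep_def)
  have eq: "h x = y x" if "x \<in> {0..L}" for x
    by (rule continuous_ae_eq[OF L DERIV_continuous_on[OF dh] H3_classD(5)[OF y] ae_eq_trans[OF ae_eq_sym[OF fh] f] that])
  show "h x = y x" using eq x .
  show "h' x = y1 x" by (rule derivative_unique_on[OF L dh H3_classD(2)[OF y] eq x])
qed

lemma C1_rep_of_class: "H3_class L y y1 y2 y3 \<Longrightarrow> ae_eq L f y \<Longrightarrow> C1_rep L f y y1"
  unfolding C1_rep_def using H3_classD(2,6) by blast

text \<open>Integrating by parts against the derivative of a test function gives zero, since the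
  primitive of \<open>g\<close> vanishes. Du Bois-Reymond makes \<open>g\<close> constant, and its
  integral over [0,L] fixes the constant as zero.\<close>

lemma primitive_zero_imp_ae_zero:
  assumes L: "L > 0" and g: "L2 L g" and zero: "\<And>x. x \<in> {0..L} \<Longrightarrow> integral {0..x} g = 0"
  shows "ae_eq L g (\<lambda>x. 0)"
proof -
  have "\<exists>c. ae_eq L g (\<lambda>x. c)"
  proof (rule du_bois_reymond[OF L g])
    fix \<phi> assume \<phi>: "test_fun L \<phi>"
    have "((deriv ^^ n) \<phi>) differentiable (at x)" for n x using \<phi> by (auto simp: test_fun_def)
    from this[of 1] this[of 2] have d: "\<And>x. deriv \<phi> differentiable (at x)" "\<And>x. deriv (deriv \<phi>) differentiable (at x)"
      by (simp_all add: numeral_2_eq_2)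
    have "integral {0..L} (\<lambda>x. deriv \<phi> x * g x) = deriv \<phi> L * 0 - deriv \<phi> 0 * 0 - integral {0..L} (\<lambda>x. deriv (deriv \<phi>) x * 0)"
    proof (rule integration_by_parts_primitive)
      show "(deriv \<phi> has_real_derivative deriv (deriv \<phi>) x) (at x within {0..L})" for x
        using d(1) DERIV_deriv_iff_real_differentiable has_field_derivative_at_within by blast
      show "continuous_on {0..L} (deriv (deriv \<phi>))"
        by (intro continuous_at_imp_continuous_on ballI differentiable_imp_continuous_within d)
      show "g absolutely_integrable_on {0..L}" by (rule L2_absolutely_integrable[OF g])
    qed (use L zero in auto)
    moreover have "L2 L (deriv \<phi>)" by (intro L2_continuous test_fun_props(2)[OF \<phi>])
    ultimately show "L2_inner L g (deriv \<phi>) = 0" by (simp add: L2_inner_integral g mult.commute)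
  qed
  then obtain c where c: "ae_eq L g (\<lambda>x. c)" by blast
  have "integral {0..L} g = integral {0..L} (\<lambda>x. c)" by (rule ae_eq_integral[OF c]) simp
  then have "c = 0" using zero[of L] L by simp
  with c show ?thesis by simp
qed

text \<open>The energy identity: y y' is the derivative of y^2 / 2, and after one integration by
  parts the third-order term becomes y' y'', the derivative of (y')^2 / 2. Only the fluxes at the
  two ends remain.\<close>

lemma integral_by_parts_H3:
  assumes L: "L > 0" and y: "H3_class L y y1 y2 y3" and bc: "y 0 = 0" "y L = 0"
  shows "L2_inner L y (\<lambda>x. - y1 x - y3 x) = (y1 L)\<^sup>2 / 2 - (y1 0)\<^sup>2 / 2"
proof -
  note d = H3_classD[OF y] and L2 = H3_class_L2[OF y]
  have 0: "integral {0..L} (\<lambda>x. y x * y1 x) = 0"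
  proof -
    have "integral {0..L} (\<lambda>x. y x * y1 x) = (y L)\<^sup>2 / 2 - (y 0)\<^sup>2 / 2"
      by (rule integral_real_derivative[where y = "\<lambda>x. (y x)\<^sup>2 / 2"])
        (use L in \<open>auto intro!: derivative_eq_intros d(2)\<close>)
    then show ?thesis using bc by simp
  qed
  have 1: "integral {0..L} (\<lambda>x. y1 x * y2 x) = (y1 L)\<^sup>2 / 2 - (y1 0)\<^sup>2 / 2"
    by (rule integral_real_derivative[where y = "\<lambda>x. (y1 x)\<^sup>2 / 2"])
      (use L in \<open>auto intro!: derivative_eq_intros d(3)\<close>)
  have 3: "integral {0..L} (\<lambda>x. y x * y3 x) = - integral {0..L} (\<lambda>x. y1 x * y2 x)"
    using integration_by_parts_primitive[OF _ d(2) d(6) L2_absolutely_integrable[OF d(1)] d(4)] L bc by simp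
  have m: "L2 L (\<lambda>x. - y1 x)" by (rule L2_uminus[OF L2(2)])
  have "L2_inner L y (\<lambda>x. - y1 x) = 0"
    using L2_inner_scale[OF L2(2) L2(1), of "-1"] 0 by (simp add: L2_inner_integral L2)
  then show ?thesis
    using 1 3 by (simp add: L2_inner_diff L2_inner_integral[OF L2(1) L2(4)] L2 m)
qed

section \<open>The generator: dissipativity and range\<close>

text \<open>Only the restriction of \<open>Y\<close> to [0,L] is constrained; outside,
  \<open>Y\<close> is arbitrary and \<open>F\<close> is zero. Thus
  \<open>U - h *\<^sub>R V = f\<close> is solvable for every \<open>f\<close> in the ambient
  space.\<close>

definition kdv_graph :: "real \<Rightarrow> real \<Rightarrow> real \<Rightarrow> real \<Rightarrow> ((lsq \<times> real) \<times> (lsq \<times> real)) set" where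
  "kdv_graph L a b c = {((Y, z), (F, g)) | Y z F g. \<exists>y y1 y2 y3. H3_class L y y1 y2 y3 \<and>
     cutoff L Y = emb L y \<and> F = emb L (\<lambda>x. - y1 x - y3 x) \<and>
     y 0 = 0 \<and> y L = 0 \<and> y1 L = a * z \<and> g = b * z + c * y1 0}"

lemma kdv_graph_iff: "((Y, z), (F, g)) \<in> kdv_graph L a b c \<longleftrightarrow> (\<exists>y y1 y2 y3. H3_class L y y1 y2 y3 \<and>
     cutoff L Y = emb L y \<and> F = emb L (\<lambda>x. - y1 x - y3 x) \<and>
     y 0 = 0 \<and> y L = 0 \<and> y1 L = a * z \<and> g = b * z + c * y1 0)"
  unfolding kdv_graph_def by blast

lemma subspace_kdv_graph: "subspace (kdv_graph L a b c)"
proof (rule subspaceI)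
  have z: "H3_class L (\<lambda>x. 0) (\<lambda>x. 0) (\<lambda>x. 0) (\<lambda>x. 0)"
    unfolding H3_class_def by (auto intro: L2_continuous)
  have e0: "emb L (\<lambda>x. 0) = 0" using emb_scale[of L "\<lambda>x. 0" 0] L2_continuous[of L "\<lambda>x. 0"] by simp
  have c0: "cutoff L 0 = 0" using cutoff_simps(3)[of L 0 0] by simp
  show "0 \<in> kdv_graph L a b c"
    unfolding zero_prod_def kdv_graph_iff using z e0 c0 by (intro exI[of _ "\<lambda>x. 0"]) simp
next
  fix p q assume "p \<in> kdv_graph L a b c" "q \<in> kdv_graph L a b c"
  then obtain Y z F g Y' z' F' g' where pq: "p = ((Y, z), (F, g))" "q = ((Y', z'), (F', g'))"
    and p: "((Y, z), (F, g)) \<in> kdv_graph L a b c" and q: "((Y', z'), (F', g')) \<in> kdv_graph L a b c"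
    by (metis surj_pair)
  from p obtain y y1 y2 y3 where y: "H3_class L y y1 y2 y3" "cutoff L Y = emb L y"
     "F = emb L (\<lambda>x. - y1 x - y3 x)" "y 0 = 0" "y L = 0" "y1 L = a * z" "g = b * z + c * y1 0"
    unfolding kdv_graph_iff by blast
  from q obtain w w1 w2 w3 where w: "H3_class L w w1 w2 w3" "cutoff L Y' = emb L w"
     "F' = emb L (\<lambda>x. - w1 x - w3 x)" "w 0 = 0" "w L = 0" "w1 L = a * z'" "g' = b * z' + c * w1 0"
    unfolding kdv_graph_iff by blast
  note Ly = H3_class_L2[OF y(1)] and Lw = H3_class_L2[OF w(1)]
  have "F + F' = emb L (\<lambda>x. (- y1 x - y3 x) + (- w1 x - w3 x))"
    unfolding y(3) w(3) by (intro emb_add[symmetric] L2_diff L2_uminus Ly Lw)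
  also have "(\<lambda>x. (- y1 x - y3 x) + (- w1 x - w3 x)) = (\<lambda>x. - (y1 x + w1 x) - (y3 x + w3 x))" by auto
  finally have "F + F' = emb L (\<lambda>x. - (y1 x + w1 x) - (y3 x + w3 x))" .
  then show "p + q \<in> kdv_graph L a b c"
    unfolding pq plus_prod_def fst_conv snd_conv kdv_graph_iff
    by (intro exI[of _ "\<lambda>x. y x + w x"] exI[of _ "\<lambda>x. y1 x + w1 x"] exI[of _ "\<lambda>x. y2 x + w2 x"]
        exI[of _ "\<lambda>x. y3 x + w3 x"] conjI H3_class_add y(1) w(1))
      (simp_all add: cutoff_simps y w emb_add Ly Lw algebra_simps)
next
  fix r p assume "p \<in> kdv_graph L a b c"
  then obtain Y z F g where pq: "p = ((Y, z), (F, g))"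
    and p: "((Y, z), (F, g)) \<in> kdv_graph L a b c" by (metis surj_pair)
  from p obtain y y1 y2 y3 where y: "H3_class L y y1 y2 y3" "cutoff L Y = emb L y"
     "F = emb L (\<lambda>x. - y1 x - y3 x)" "y 0 = 0" "y L = 0" "y1 L = a * z" "g = b * z + c * y1 0"
    unfolding kdv_graph_iff by blast
  note Ly = H3_class_L2[OF y(1)]
  have "r *\<^sub>R F = emb L (\<lambda>x. r * (- y1 x - y3 x))"
    unfolding y(3) by (intro emb_scale[symmetric] L2_diff L2_uminus Ly)
  also have "(\<lambda>x. r * (- y1 x - y3 x)) = (\<lambda>x. - (r * y1 x) - r * y3 x)" by (auto simp: algebra_simps)
  finally have "r *\<^sub>R F = emb L (\<lambda>x. - (r * y1 x) - r * y3 x)" .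
  then show "r *\<^sub>R p \<in> kdv_graph L a b c"
    unfolding pq scaleR_prod_def fst_conv snd_conv kdv_graph_iff
    by (intro exI[of _ "\<lambda>x. r * y x"] exI[of _ "\<lambda>x. r * y1 x"] exI[of _ "\<lambda>x. r * y2 x"]
        exI[of _ "\<lambda>x. r * y3 x"] conjI H3_class_scale y(1))
      (simp_all add: cutoff_simps y emb_scale Ly algebra_simps)
qed

lemma kdv_quasi_dissipative:
  assumes L: "L > 0" and "(U, V) \<in> kdv_graph L a b c"
  shows "inner U V \<le> (a\<^sup>2 / 2 + \<bar>b\<bar> + c\<^sup>2 / 2) * inner U U"
proof -
  obtain Y z F g where UV: "U = (Y, z)" "V = (F, g)" by (metis surj_pair)
  obtain y y1 y2 y3 where y: "H3_class L y y1 y2 y3" "cutoff L Y = emb L y"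
     "F = emb L (\<lambda>x. - y1 x - y3 x)" "y 0 = 0" "y L = 0" "y1 L = a * z" "g = b * z + c * y1 0"
    using assms(2) unfolding UV kdv_graph_iff by blast
  note Ly = H3_class_L2[OF y(1)]
  have f: "L2 L (\<lambda>x. - y1 x - y3 x)" by (intro L2_diff L2_uminus Ly)
  \<comment> \<open>The image \<open>F\<close> lives on [0,L], so \<open>Y\<close> may be replaced
    by its cutoff in the inner product.\<close>
  have "inner Y F = L2_inner L y (\<lambda>x. - y1 x - y3 x)"
    using inner_cutoff[OF f, of Y] by (simp add: y(2,3) inner_emb Ly f)
  then have "inner U V = (a * z)\<^sup>2 / 2 - (y1 0)\<^sup>2 / 2 + z * (b * z + c * y1 0)"
    using integral_by_parts_H3[OF L y(1,4,5)] by (simp add: UV y(6,7))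
  \<comment> \<open>Completing the square in \<open>y1 0\<close>: the outgoing flux
    \<open>(y1 0)\<^sup>2 / 2\<close> absorbs the feedback term at the cost of
    \<open>c\<^sup>2 / 2 * z\<^sup>2\<close>. The absolute value of \<open>b\<close> then makes the
    growth constant nonnegative.\<close>
  also have "\<dots> = (a\<^sup>2 / 2 + b + c\<^sup>2 / 2) * z\<^sup>2 - (y1 0 - c * z)\<^sup>2 / 2"
    by (simp add: field_simps power2_eq_square)
  also have "\<dots> \<le> (a\<^sup>2 / 2 + \<bar>b\<bar> + c\<^sup>2 / 2) * z\<^sup>2"
  proof -
    have "(a\<^sup>2 / 2 + b + c\<^sup>2 / 2) * z\<^sup>2 \<le> (a\<^sup>2 / 2 + \<bar>b\<bar> + c\<^sup>2 / 2) * z\<^sup>2"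
      by (intro mult_right_mono) auto
    then show ?thesis using zero_le_power2[of "y1 0 - c * z"] by linarith
  qed
  also have "\<dots> \<le> (a\<^sup>2 / 2 + \<bar>b\<bar> + c\<^sup>2 / 2) * inner U U"
    by (intro mult_left_mono) (auto simp: UV power2_eq_square)
  finally show ?thesis .
qed

text \<open>Continuity and uniqueness of derivatives carry the vanishing from L^2 to point values up
  to order two. Besides single-valuedness, this lets the initial data of a kernel element be read
  off at zero.\<close>

lemma H3_class_zero:
  assumes L: "L > 0" and y: "H3_class L y y1 y2 y3" and e: "emb L y = 0"
  shows "\<And>x. x \<in> {0..L} \<Longrightarrow> y x = 0" "\<And>x. x \<in> {0..L} \<Longrightarrow> y1 x = 0"
    "\<And>x. x \<in> {0..L} \<Longrightarrow> y2 x = 0" "ae_eq L y3 (\<lambda>x. 0)"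
proof -
  note d = H3_classD[OF y]
  have e0: "emb L (\<lambda>x. 0) = 0" using emb_scale[of L "\<lambda>x. 0" 0] L2_continuous[of L "\<lambda>x. 0"] by simp
  have "ae_eq L y (\<lambda>x. 0)"
    using e e0 emb_eq_iff[OF H3_class_L2(1)[OF y], of "\<lambda>x. 0"] L2_continuous[of L "\<lambda>x. 0"] by simp
  then show y0: "y x = 0" if "x \<in> {0..L}" for x
    using continuous_ae_eq[OF L d(5) continuous_on_const _ that] by blast
  show y1: "y1 x = 0" if "x \<in> {0..L}" for x
    by (rule derivative_unique_on[OF L d(2) _ y0 that]) (auto intro: DERIV_const)
  show y2: "y2 x = 0" if "x \<in> {0..L}" for x
    by (rule derivative_unique_on[OF L d(3) _ y1 that]) (auto intro: DERIV_const)
  show "ae_eq L y3 (\<lambda>x. 0)"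
  proof (rule primitive_zero_imp_ae_zero[OF L d(1)])
    fix x assume x: "x \<in> {0..L}"
    then have "0 \<in> {0..L}" by simp
    then show "integral {0..x} y3 = 0" using d(4)[OF x] y2[OF x] y2[of 0] by simp
  qed
qed

lemma kdv_single:
  assumes L: "L > 0" and "(0, V) \<in> kdv_graph L a b c"
  shows "V = 0"
proof -
  obtain F g where V: "V = (F, g)" by (metis surj_pair)
  obtain y y1 y2 y3 where y: "H3_class L y y1 y2 y3" "cutoff L 0 = emb L y"
     "F = emb L (\<lambda>x. - y1 x - y3 x)" "g = b * 0 + c * y1 0"
    using assms(2) unfolding V zero_prod_def kdv_graph_iff by blast
  have c0: "cutoff L 0 = 0" using cutoff_simps(3)[of L 0 0] by simp
  note z = H3_class_zero[OF L y(1) y(2)[symmetric, unfolded c0]]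
  have "ae_eq L (\<lambda>x. - y1 x - y3 x) (\<lambda>x. 0)"
  proof -
    have "ae_eq L (\<lambda>x. - y1 x - y3 x) (\<lambda>x. - y3 x)" by (rule ae_eq_on) (simp add: z(2))
    moreover have "ae_eq L (\<lambda>x. - y3 x) (\<lambda>x. 0)"
      using z(4) unfolding ae_eq_def by (rule eventually_mono) simp
    ultimately show ?thesis by (rule ae_eq_trans)
  qed
  moreover have "L2 L (\<lambda>x. - y1 x - y3 x)" by (intro L2_diff L2_uminus H3_class_L2[OF y(1)])
  ultimately have "F = emb L (\<lambda>x. 0)" unfolding y(3) using emb_cong by blast
  also have "\<dots> = 0" using emb_scale[of L "\<lambda>x. 0" 0] L2_continuous[of L "\<lambda>x. 0"] by simp
  finally show ?thesis using z(2)[of 0] L by (simp add: V y(4) zero_prod_def)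
qed

text \<open>The right-hand side is only square integrable, so the equation is integrated once: the
  primitive of \<open>y\<close> solves an equation with continuous right-hand side.\<close>
lemma H3_class_initial_value:
  assumes L: "L > 0" and \<mu>: "\<mu> > 0" and F: "L2 L F"
  shows "\<exists>y y1 y2. H3_class L y y1 y2 (\<lambda>x. F x - y1 x - \<mu> * y x) \<and> y 0 = 0 \<and> y1 0 = \<alpha> \<and> y2 0 = \<beta>"
proof -
  \<comment> \<open>The integration constant \<open>\<beta>\<close> becomes \<open>y2 0\<close>,
    since the unknown and its primitive both vanish at zero.\<close>
  let ?P = "\<lambda>x. \<beta> + integral {0..x} F"
  from linear_ode_order_three[OF \<mu> L2_primitive[OF F], of \<alpha> \<beta>]
  obtain Y y y1 where *: "Y 0 = 0 \<and> y 0 = 0 \<and> y1 0 = \<alpha> \<and> (\<forall>x\<in>{0..L}.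
      (Y has_real_derivative y x) (at x within {0..L}) \<and>
      (y has_real_derivative y1 x) (at x within {0..L}) \<and>
      (y1 has_real_derivative ?P x - y x - \<mu> * Y x) (at x within {0..L}))"
    by blast
  then have ini: "Y 0 = 0" "y 0 = 0" "y1 0 = \<alpha>" by simp_all
  have der: "(Y has_real_derivative y x) (at x within {0..L})"
      "(y has_real_derivative y1 x) (at x within {0..L})"
      "(y1 has_real_derivative ?P x - y x - \<mu> * Y x) (at x within {0..L})" if "x \<in> {0..L}" for x
    using * that by blast+
  let ?y2 = "\<lambda>x. ?P x - y x - \<mu> * Y x"
  have L2: "L2 L y" "L2 L y1"
    using DERIV_continuous_on[OF der(2)] DERIV_continuous_on[OF der(3)] by (auto intro: L2_continuous)
  have "H3_class L y y1 ?y2 (\<lambda>x. F x - y1 x - \<mu> * y x)"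
    unfolding H3_class_def
  proof (intro conjI ballI der)
    show "L2 L (\<lambda>x. F x - y1 x - \<mu> * y x)" by (intro L2_diff L2_scale F L2)
    fix x assume x: "x \<in> {0..L}"
    then have sub: "{0..x} \<subseteq> {0..L}" by auto
    note i = L2_integrable_on[OF F sub] L2_integrable_on[OF L2(2) sub] L2_integrable_on[OF L2_scale[OF L2(1)] sub, of \<mu>]
    have "integral {0..x} (\<lambda>x. F x - y1 x - \<mu> * y x) = integral {0..x} F - integral {0..x} y1 - \<mu> * integral {0..x} y"
      by (simp add: Henstock_Kurzweil_Integration.integral_diff integrable_diff i)
    also have "\<dots> = integral {0..x} F - y x - \<mu> * Y x"
      using integral_real_derivative[OF der(1), of 0 x] integral_real_derivative[OF der(2), of 0 x] x ini by simp
    finally show "?y2 x = ?y2 0 + integral {0..x} (\<lambda>x. F x - y1 x - \<mu> * y x)" using ini by simp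
  qed
  then show ?thesis using ini by (intro exI[of _ y] exI[of _ y1] exI[of _ ?y2]) simp
qed

lemma kdv_range:
  fixes h a b c L :: real and f :: "lsq \<times> real"
  assumes L: "L > 0" and h: "0 < h" "h * (a\<^sup>2 / 2 + \<bar>b\<bar> + c\<^sup>2 / 2) < 1"
  shows "\<exists>U V. (U, V) \<in> kdv_graph L a b c \<and> U - h *\<^sub>R V = f"
proof -
  obtain Yf zf where f: "f = (Yf, zf)" by (metis surj_pair)
  define \<mu> where "\<mu> = 1 / h"
  have \<mu>: "\<mu> > 0" "h * \<mu> = 1" using h by (auto simp: \<mu>_def)
  have L20: "L2 L (\<lambda>x. 0)" by (intro L2_continuous) simp
  \<comment> \<open>\<open>p\<close> and \<open>q\<close> span the homogeneous solutions vanishing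
    at zero, and \<open>r\<close> is a particular solution; the equation has been multiplied by
    \<open>\<mu> = 1 / h\<close>.\<close>
  obtain p p1 p2 where p: "H3_class L p p1 p2 (\<lambda>x. 0 - p1 x - \<mu> * p x)" "p 0 = 0" "p1 0 = 1" "p2 0 = 0"
    using H3_class_initial_value[OF L \<mu>(1) L20, of 1 0] by blast
  obtain q q1 q2 where q: "H3_class L q q1 q2 (\<lambda>x. 0 - q1 x - \<mu> * q x)" "q 0 = 0" "q1 0 = 0" "q2 0 = 1"
    using H3_class_initial_value[OF L \<mu>(1) L20, of 0 1] by blast
  have F: "L2 L (\<lambda>x. \<mu> * rep_lsq Yf x)" by (intro L2_scale L2_rep)
  obtain r r1 r2 where r: "H3_class L r r1 r2 (\<lambda>x. \<mu> * rep_lsq Yf x - r1 x - \<mu> * r x)" "r 0 = 0" "r1 0 = 0" "r2 0 = 0"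
    using H3_class_initial_value[OF L \<mu>(1) F, of 0 0] by blast
  \<comment> \<open>The components express \<open>y L = 0\<close>, \<open>y1 L = a * z\<close> and
    the resolvent equation for \<open>z\<close>; the condition at the left end is built into
    \<open>p\<close>, \<open>q\<close> and \<open>r\<close>.\<close>
  define T :: "real \<times> real \<times> real \<Rightarrow> real \<times> real \<times> real" where
    "T = (\<lambda>(\<alpha>, \<beta>, z). (\<alpha> * p L + \<beta> * q L, \<alpha> * p1 L + \<beta> * q1 L - a * z, z - h * (b * z + c * \<alpha>)))"
  have lin: "linear T"
    unfolding T_def by (rule linearI) (auto simp: algebra_simps)
  have "inj T"
  proof (subst linear_injective_0[OF lin], intro allI impI)
    fix v assume Tv: "T v = 0"
    obtain \<alpha> \<beta> z where v: "v = (\<alpha>, \<beta>, z)" by (metis surj_pair)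
    have T: "\<alpha> * p L + \<beta> * q L = 0" "\<alpha> * p1 L + \<beta> * q1 L = a * z" "z = h * (b * z + c * \<alpha>)"
      using Tv by (simp_all add: T_def v zero_prod_def)
    define y y1 y2 y3 where "y x = \<alpha> * p x + \<beta> * q x" and "y1 x = \<alpha> * p1 x + \<beta> * q1 x"
      and "y2 x = \<alpha> * p2 x + \<beta> * q2 x"
      and "y3 x = \<alpha> * (0 - p1 x - \<mu> * p x) + \<beta> * (0 - q1 x - \<mu> * q x)" for x
    have y: "H3_class L y y1 y2 y3"
      using H3_class_add[OF H3_class_scale[OF p(1), of \<alpha>] H3_class_scale[OF q(1), of \<beta>]]
      by (simp add: y_def[abs_def] y1_def[abs_def] y2_def[abs_def] y3_def[abs_def])
    note Ly = H3_class_L2[OF y]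
    define V where "V = (emb L (\<lambda>x. - y1 x - y3 x), b * z + c * \<alpha>)"
    have G: "((emb L y, z), V) \<in> kdv_graph L a b c"
      unfolding V_def kdv_graph_iff
      by (intro exI[of _ y] exI[of _ y1] exI[of _ y2] exI[of _ y3])
        (use y T p q in \<open>simp add: cutoff_emb Ly y_def y1_def\<close>)
    have "(\<lambda>x. - y1 x - y3 x) = (\<lambda>x. \<mu> * y x)" by (auto simp: y_def y1_def y3_def algebra_simps)
    then have hV: "h *\<^sub>R V = (emb L y, z)" using T(3) \<mu>(2) by (simp add: V_def emb_scale Ly)
    \<comment> \<open>A kernel vector gives U with \<open>h\<close> A U = U, so the squared norm of
      U is at most \<open>h\<close> times the growth constant times itself; the smallness of
      \<open>h\<close> forces U = 0.\<close>
    have "inner (emb L y, z) (emb L y, z) = h * inner (emb L y, z) V"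
      by (subst (2) hV[symmetric]) (rule inner_scaleR_right)
    also have "\<dots> \<le> h * ((a\<^sup>2 / 2 + \<bar>b\<bar> + c\<^sup>2 / 2) * inner (emb L y, z) (emb L y, z))"
      by (intro mult_left_mono kdv_quasi_dissipative[OF L G]) (use h in simp)
    finally have "(1 - h * (a\<^sup>2 / 2 + \<bar>b\<bar> + c\<^sup>2 / 2)) * inner (emb L y, z) (emb L y, z) \<le> 0"
      by (simp only: left_diff_distrib mult.assoc mult_1_left diff_le_0_iff_le)
    then have "inner (emb L y, z) (emb L y, z) \<le> 0" using h(2) by (simp only: mult_le_0_iff) simp
    then have "(emb L y, z) = 0" by (meson inner_eq_zero_iff inner_ge_zero order_antisym)
    then have e: "emb L y = 0" "z = 0" by (simp_all add: zero_prod_def)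
    have "y1 0 = 0" "y2 0 = 0" using H3_class_zero[OF L y e(1)] L by auto
    then show "v = 0" using e p q by (simp add: v y1_def y2_def zero_prod_def)
  qed
  then have "surj T" using lin linear_injective_imp_surjective by blast
  then obtain \<alpha> \<beta> z where T: "T (\<alpha>, \<beta>, z) = (- r L, - r1 L, zf)" by (metis surj_def surj_pair)
  define y y1 y2 y3 where "y x = r x + (\<alpha> * p x + \<beta> * q x)" and "y1 x = r1 x + (\<alpha> * p1 x + \<beta> * q1 x)"
    and "y2 x = r2 x + (\<alpha> * p2 x + \<beta> * q2 x)"
    and "y3 x = (\<mu> * rep_lsq Yf x - r1 x - \<mu> * r x) + (\<alpha> * (0 - p1 x - \<mu> * p x) + \<beta> * (0 - q1 x - \<mu> * q x))" for x
  have y: "H3_class L y y1 y2 y3"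
    using H3_class_add[OF r(1) H3_class_add[OF H3_class_scale[OF p(1), of \<alpha>] H3_class_scale[OF q(1), of \<beta>]]]
    by (simp add: y_def[abs_def] y1_def[abs_def] y2_def[abs_def] y3_def[abs_def])
  note Ly = H3_class_L2[OF y]
  have bc: "y 0 = 0" "y L = 0" "y1 L = a * z" "y1 0 = \<alpha>" "z - h * (b * z + c * \<alpha>) = zf"
    using T p q r by (auto simp: T_def y_def y1_def)
  \<comment> \<open>Outside [0,L] the generator vanishes, so there the solution must coincide with
    the data \<open>Yf\<close>.\<close>
  define Y where "Y = Yf - cutoff L Yf + emb L y"
  have cY: "cutoff L Y = emb L y"
  proof -
    have "cutoff L (cutoff L Yf) = cutoff L Yf" unfolding cutoff_def[of L Yf] by (rule cutoff_emb[OF L2_rep])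
    then show ?thesis by (simp add: Y_def cutoff_simps cutoff_emb Ly)
  qed
  have G: "((Y, z), (emb L (\<lambda>x. - y1 x - y3 x), b * z + c * y1 0)) \<in> kdv_graph L a b c"
    unfolding kdv_graph_iff using y cY bc by blast
  have "(\<lambda>x. - y1 x - y3 x) = (\<lambda>x. \<mu> * (y x - rep_lsq Yf x))"
    by (auto simp: y_def y1_def y3_def algebra_simps)
  then have "emb L (\<lambda>x. - y1 x - y3 x) = \<mu> *\<^sub>R (emb L y - cutoff L Yf)"
    by (simp add: emb_scale emb_diff L2_diff Ly L2_rep cutoff_def)
  then have "Y - h *\<^sub>R emb L (\<lambda>x. - y1 x - y3 x) = Yf" using \<mu>(2) by (simp add: Y_def)
  then have "(Y, z) - h *\<^sub>R (emb L (\<lambda>x. - y1 x - y3 x), b * z + c * y1 0) = f"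
    using bc by (simp add: f)
  with G show ?thesis by blast
qed

lemma kdv_quasi_m_dissipative:
  assumes "L > 0"
  shows "quasi_m_dissipative (kdv_graph L a b c) (a\<^sup>2 / 2 + \<bar>b\<bar> + c\<^sup>2 / 2)"
proof
  fix y assume "(0, y) \<in> kdv_graph L a b c"
  then show "y = 0" by (rule kdv_single[OF assms])
qed (use subspace_kdv_graph kdv_quasi_dissipative[OF assms] kdv_range[OF assms] in auto)

section \<open>Strong and mild solutions\<close>

lemma L2_abs: "L2 L f \<Longrightarrow> L2 L (\<lambda>x. \<bar>f x\<bar>)"
  by (simp add: L2_def borel_measurable_abs)

lemma L2_norm_const: "L > 0 \<Longrightarrow> L2_norm L (\<lambda>x. M) = sqrt L * \<bar>M\<bar>"
proof -
  assume L: "L > 0"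
  have "integral\<^sup>L (lebesgue_on {0..L}) (\<lambda>x. M\<^sup>2) = L * M\<^sup>2"
    using integral_lebesgue_on[of L "\<lambda>x. M\<^sup>2"] L continuous_imp_integrable_real[of 0 L "\<lambda>x. M\<^sup>2"] by simp
  then show ?thesis by (simp add: L2_norm_def real_sqrt_mult)
qed

lemma abs_integral_le_L2_norm:
  assumes L: "L > 0" and f: "L2 L f" and sx: "0 \<le> s" "s \<le> x" "x \<le> L"
  shows "\<bar>integral {s..x} f\<bar> \<le> sqrt L * L2_norm L f"
proof -
  have sub: "{s..x} \<subseteq> {0..L}" using sx by auto
  have one: "L2 L (\<lambda>x. 1)" by (intro L2_continuous) simp
  have "norm (integral {s..x} f) \<le> integral {s..x} (\<lambda>x. \<bar>f x\<bar>)"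
    by (rule integral_norm_bound_integral) (use f sub in \<open>auto intro: L2_integrable_on L2_abs\<close>)
  also have "\<dots> \<le> integral {0..L} (\<lambda>x. \<bar>f x\<bar>)"
    by (rule integral_subset_le) (use f sub in \<open>auto intro: L2_integrable_on L2_abs\<close>)
  also have "\<dots> = inner (emb L (\<lambda>x. 1)) (emb L (\<lambda>x. \<bar>f x\<bar>))"
    by (simp add: inner_emb one L2_abs f L2_inner_integral)
  also have "\<dots> \<le> norm (emb L (\<lambda>x. 1)) * norm (emb L (\<lambda>x. \<bar>f x\<bar>))" by (rule norm_cauchy_schwarz)
  also have "\<dots> = sqrt L * L2_norm L f"
    by (simp add: norm_emb one L2_abs f L2_norm_const[OF L]) (simp add: L2_norm_def)
  finally show ?thesis by simp
qed

lemma L2_norm_le_sup: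
  assumes L: "L > 0" and f: "L2 L f" and M: "\<And>x. x \<in> {0..L} \<Longrightarrow> \<bar>f x\<bar> \<le> M"
  shows "L2_norm L f \<le> sqrt L * M"
proof -
  have M0: "M \<ge> 0" using M[of 0] L by auto
  have "integral\<^sup>L (lebesgue_on {0..L}) (\<lambda>x. (f x)\<^sup>2) \<le> integral\<^sup>L (lebesgue_on {0..L}) (\<lambda>x. M\<^sup>2)"
  proof (rule integral_mono)
    show "integrable (lebesgue_on {0..L}) (\<lambda>x. (f x)\<^sup>2)" using f by (simp add: L2_def)
    show "integrable (lebesgue_on {0..L}) (\<lambda>x. M\<^sup>2)" by (intro continuous_imp_integrable_real) simp
    fix x assume "x \<in> space (lebesgue_on {0..L})"
    then have "\<bar>f x\<bar> \<le> M" using M by simp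
    then show "(f x)\<^sup>2 \<le> M\<^sup>2" by (simp add: abs_le_square_iff[symmetric] M0)
  qed
  then have "L2_norm L f \<le> L2_norm L (\<lambda>x. M)" by (simp add: L2_norm_def)
  then show ?thesis using L2_norm_const[OF L] M0 by simp
qed

text \<open>With \<open>\<kappa> = y''(L)\<close> one has \<open>y'' = \<kappa> - y - \<integral>\<^sub>x\<^sup>L (y' + y''')\<close>, and \<open>\<integral>\<^sub>0\<^sup>L y' = 0\<close> determines \<open>\<kappa>\<close>.\<close>
lemma H3_class_sup_estimate:
  assumes L: "L > 0"
  shows "\<exists>C\<ge>0. \<forall>y y1 y2 y3. H3_class L y y1 y2 y3 \<longrightarrow> y 0 = 0 \<longrightarrow> y L = 0 \<longrightarrow> (\<forall>x\<in>{0..L}.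
     \<bar>y1 x\<bar> \<le> C * (\<bar>y1 L\<bar> + L2_norm L y + L2_norm L (\<lambda>x. y1 x + y3 x)) \<and>
     \<bar>y2 x\<bar> \<le> C * (\<bar>y1 L\<bar> + L2_norm L y + L2_norm L (\<lambda>x. y1 x + y3 x)))"
proof -
  \<comment> \<open>\<open>K * N\<close> bounds the slope at \<open>L\<close> plus the error
    \<open>B\<close> in \<open>D\<close> below. The summands of \<open>C\<close> collect the
    resulting bounds for y', for \<kappa>, for y and for the integral remainder
    \<open>E\<close>.\<close>
  define K where "K = 1 + sqrt L * (L + 1)"
  define C where "C = 3 * K + 2 / L * K + 3 * L * K + sqrt L"
  have K: "K \<ge> 0" using L by (simp add: K_def)
  have C: "C \<ge> 0" "3 * K \<le> C" "2 / L * K + 3 * L * K + sqrt L \<le> C"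
    using L K by (auto simp: C_def)
  have "\<bar>y1 x\<bar> \<le> C * N \<and> \<bar>y2 x\<bar> \<le> C * N"
    if y: "H3_class L y y1 y2 y3" and bc: "y 0 = 0" "y L = 0" and x: "x \<in> {0..L}"
      and N_def: "N = \<bar>y1 L\<bar> + L2_norm L y + L2_norm L (\<lambda>x. y1 x + y3 x)" for y y1 y2 y3 x N
  proof -
    note d = H3_classD[OF y] and L2 = H3_class_L2[OF y]
    have n0: "L2_norm L g \<ge> 0" for g by (simp add: L2_norm_def)
    define \<kappa> where "\<kappa> = y2 L"
    define b where "b = sqrt L * L2_norm L (\<lambda>x. y1 x + y3 x)"
    define B where "B = L * b + sqrt L * L2_norm L y"
    have b0: "b \<ge> 0" using L n0 by (simp add: b_def)
    have bN: "b \<le> sqrt L * N" unfolding b_def N_def using L n0 by (intro mult_left_mono) auto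
    have BN: "\<bar>y1 L\<bar> + B \<le> K * N"
    proof -
      have "L * b \<le> L * (sqrt L * N)" using bN L by (intro mult_left_mono) auto
      moreover have "sqrt L * L2_norm L y \<le> sqrt L * N" unfolding N_def using L n0 by (intro mult_left_mono) auto
      moreover have "\<bar>y1 L\<bar> \<le> N" using n0 by (simp add: N_def)
      ultimately show ?thesis by (simp add: B_def K_def algebra_simps)
    qed
    define E where "E x = y2 x + y x - \<kappa>" for x
    have Eb: "\<bar>E x\<bar> \<le> b" if x: "x \<in> {0..L}" for x
    proof -
      have xs: "0 \<le> x" "x \<le> L" "L \<le> L" using x by auto
      have y3i: "y3 integrable_on {0..L}" using L2_integrable_on[OF L2(4)] by simp
      have "L \<in> {0..L}" using L by simp
      then have "y2 L - y2 x = integral {x..L} y3"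
        using integral_diff_interval[OF y3i xs] d(4)[of L] d(4)[OF x] by linarith
      moreover have "integral {x..L} y1 = y L - y x" by (rule integral_real_derivative[OF d(2) xs])
      moreover have "integral {x..L} (\<lambda>x. y1 x + y3 x) = integral {x..L} y1 + integral {x..L} y3"
        using xs by (intro Henstock_Kurzweil_Integration.integral_add L2_integrable_on[of L] L2) auto
      ultimately have "E x = - integral {x..L} (\<lambda>x. y1 x + y3 x)" using bc by (simp add: E_def \<kappa>_def)
      then show ?thesis
        using abs_integral_le_L2_norm[OF L L2_add[OF L2(2) L2(4)] xs] by (simp add: b_def)
    qed
    have cE: "continuous_on {0..L} E" unfolding E_def by (intro continuous_intros d)
    \<comment> \<open>The deviation of y' from the affine function with the same value and slope at
      the right end.\<close>
    define D where "D x = y1 x - y1 L + \<kappa> * (L - x)" for x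
    have DB: "\<bar>D x\<bar> \<le> B" if x: "x \<in> {0..L}" for x
    proof -
      have xs: "0 \<le> x" "x \<le> L" "L \<le> L" using x by auto
      have Ei: "E integrable_on {x..L}" using xs by (intro L2_integrable_on[of L] L2_continuous cE) auto
      have yi: "y integrable_on {x..L}" using xs by (intro L2_integrable_on[of L] L2) auto
      have "integral {x..L} y2 = y1 L - y1 x" by (rule integral_real_derivative[OF d(3) xs])
      also have "integral {x..L} y2 = integral {x..L} (\<lambda>x. (E x - y x) + \<kappa>)"
        by (rule arg_cong[where f = "integral _"]) (auto simp: E_def)
      also have "\<dots> = integral {x..L} (\<lambda>x. E x - y x) + integral {x..L} (\<lambda>x. \<kappa>)"
        by (rule Henstock_Kurzweil_Integration.integral_add[OF integrable_diff[OF Ei yi] integrable_const_ivl])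
      also have "\<dots> = integral {x..L} E - integral {x..L} y + \<kappa> * (L - x)"
        using xs by (simp add: Henstock_Kurzweil_Integration.integral_diff[OF Ei yi])
      finally have "D x = integral {x..L} y - integral {x..L} E" by (simp add: D_def)
      moreover have "\<bar>integral {x..L} y\<bar> \<le> sqrt L * L2_norm L y"
        by (rule abs_integral_le_L2_norm[OF L L2(1) xs])
      moreover have "\<bar>integral {x..L} E\<bar> \<le> L * b"
      proof -
        have "norm (integral {x..L} E) \<le> integral {x..L} (\<lambda>x. b)"
          by (rule integral_norm_bound_integral[OF Ei integrable_const_ivl]) (use Eb xs in auto)
        also have "\<dots> = (L - x) * b" using xs by simp
        also have "\<dots> \<le> L * b" using xs b0 by (intro mult_right_mono) auto
        finally show ?thesis by simp
      qed
      ultimately show ?thesis by (simp add: B_def)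
    qed
    have B0: "B \<ge> 0" using DB[of 0] L by auto
    \<comment> \<open>The mean value bound for an antiderivative of \<open>D\<close>: since
      \<open>y\<close> vanishes at both ends, only
      \<open>\<kappa> * L\<^sup>2 / 2 - y1 L * L\<close> survives, which isolates \<kappa>.\<close>
    have "\<bar>(y L + \<kappa> * (L * L - L\<^sup>2 / 2) - y1 L * L) - (y 0 + \<kappa> * (L * 0 - 0\<^sup>2 / 2) - y1 L * 0)\<bar> \<le> B * \<bar>L - 0\<bar>"
    proof (rule field_differentiable_bound[of "{0..L}" "\<lambda>x. y x + \<kappa> * (L * x - x\<^sup>2 / 2) - y1 L * x" D B L 0, unfolded real_norm_def])
      fix x assume x: "x \<in> {0..L}"
      show "((\<lambda>x. y x + \<kappa> * (L * x - x\<^sup>2 / 2) - y1 L * x) has_field_derivative D x) (at x within {0..L})"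
        by (auto intro!: derivative_eq_intros d(2) x simp: D_def)
      show "\<bar>D x\<bar> \<le> B" by (rule DB[OF x])
    qed (use L in auto)
    then have "\<bar>\<kappa> * L\<^sup>2 / 2 - y1 L * L\<bar> \<le> B * L" using bc L by (simp add: power2_eq_square field_simps)
    then have "\<bar>\<kappa> * L\<^sup>2 / 2\<bar> \<le> B * L + \<bar>y1 L * L\<bar>" by linarith
    then have "\<bar>\<kappa>\<bar> * L\<^sup>2 / 2 \<le> (\<bar>y1 L\<bar> + B) * L" using L by (simp add: abs_mult algebra_simps)
    also have "\<dots> \<le> K * N * L" using BN L by (intro mult_right_mono) auto
    finally have "\<bar>\<kappa>\<bar> * L * L \<le> 2 * (K * N) * L" by (simp add: power2_eq_square)
    then have kL: "\<bar>\<kappa>\<bar> * L \<le> 2 * (K * N)" using L by (simp only: mult_le_cancel_right_pos)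
    then have k: "\<bar>\<kappa>\<bar> \<le> 2 / L * (K * N)" using L by (simp add: field_simps)
    have y1: "\<bar>y1 x\<bar> \<le> 3 * (K * N)" if x: "x \<in> {0..L}" for x
    proof -
      have "\<bar>\<kappa> * (L - x)\<bar> \<le> \<bar>\<kappa>\<bar> * L" using x by (auto simp: abs_mult intro!: mult_left_mono)
      moreover have "y1 x = D x + y1 L - \<kappa> * (L - x)" by (simp add: D_def)
      ultimately show ?thesis using DB[OF x] kL BN by linarith
    qed
    have y0: "\<bar>y x\<bar> \<le> 3 * (K * N) * L" if x: "x \<in> {0..L}" for x
    proof -
      have "\<bar>y x - y 0\<bar> \<le> 3 * (K * N) * \<bar>x - 0\<bar>"
        by (rule field_differentiable_bound[of "{0..L}" y y1, unfolded real_norm_def])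
          (use d(2) y1 x L in auto)
      also have "\<dots> \<le> 3 * (K * N) * L"
        using x y1[of 0] L by (intro mult_left_mono) auto
      finally show ?thesis using bc by simp
    qed
    have N0: "N \<ge> 0" using n0 by (simp add: N_def)
    have "\<bar>y2 x\<bar> \<le> 2 / L * (K * N) + 3 * (K * N) * L + sqrt L * N"
    proof -
      have "y2 x = E x - y x + \<kappa>" by (simp add: E_def)
      then show ?thesis using Eb[OF x] y0[OF x] k bN by linarith
    qed
    also have "\<dots> = (2 / L * K + 3 * L * K + sqrt L) * N" by (simp add: algebra_simps)
    also have "\<dots> \<le> C * N" by (rule mult_right_mono[OF C(3) N0])
    finally have "\<bar>y2 x\<bar> \<le> C * N" .
    moreover have "\<bar>y1 x\<bar> \<le> C * N"
      using y1[OF x] mult_right_mono[OF C(2) N0] by (simp add: mult.assoc)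
    ultimately show ?thesis by blast
  qed
  then show ?thesis using C(1) by blast
qed

text \<open>Square integrability is assumed for nonnegative times only, and the filter
  \<open>at t within {0..}\<close> sees no others.\<close>

lemma L2_cont_iff:
  assumes "\<And>t. t \<ge> 0 \<Longrightarrow> L2 L (u t)"
  shows "L2_cont L u \<longleftrightarrow> continuous_on {0..} (\<lambda>t. emb L (u t))"
proof -
  have "((\<lambda>s. L2_norm L (\<lambda>x. u s x - u t x)) \<longlongrightarrow> 0) (at t within {0..}) \<longleftrightarrow>
      ((\<lambda>s. emb L (u s)) \<longlongrightarrow> emb L (u t)) (at t within {0..})" if t: "t \<ge> 0" for t
  proof -
    have "((\<lambda>s. emb L (u s)) \<longlongrightarrow> emb L (u t)) (at t within {0..}) \<longleftrightarrow>
        ((\<lambda>s. norm (emb L (u s) - emb L (u t))) \<longlongrightarrow> 0) (at t within {0..})"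
      by (simp only: tendsto_norm_zero_iff LIM_zero_iff)
    also have "\<dots> \<longleftrightarrow> ((\<lambda>s. L2_norm L (\<lambda>x. u s x - u t x)) \<longlongrightarrow> 0) (at t within {0..})"
    proof (rule tendsto_cong)
      show "\<forall>\<^sub>F s in at t within {0..}. norm (emb L (u s) - emb L (u t)) = L2_norm L (\<lambda>x. u s x - u t x)"
        unfolding eventually_at_filter
        by (intro always_eventually allI impI)
          (use assms t in \<open>simp add: norm_emb L2_diff flip: emb_diff\<close>)
    qed
    finally show ?thesis ..
  qed
  then show ?thesis unfolding L2_cont_def continuous_on_def using assms by auto
qed

lemma has_vector_derivative_iff_quotient:
  fixes U :: "real \<Rightarrow> 'a::real_normed_vector"
  shows "(U has_vector_derivative V) (at t within S) \<longleftrightarrow>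
    ((\<lambda>s. norm ((1 / (s - t)) *\<^sub>R (U s - U t) - V)) \<longlongrightarrow> 0) (at t within S)"
proof -
  have "(U has_vector_derivative V) (at t within S) \<longleftrightarrow>
    ((\<lambda>s. norm ((1 / norm (s - t)) *\<^sub>R (U s - (U t + (s - t) *\<^sub>R V)))) \<longlongrightarrow> 0) (at t within S)"
    unfolding has_vector_derivative_def has_derivative_within tendsto_norm_zero_iff
    by (simp add: bounded_linear_scaleR_left)
  also have "\<dots> \<longleftrightarrow> ((\<lambda>s. norm ((1 / (s - t)) *\<^sub>R (U s - U t) - V)) \<longlongrightarrow> 0) (at t within S)"
  proof (rule tendsto_cong)
    show "\<forall>\<^sub>F s in at t within S. norm ((1 / norm (s - t)) *\<^sub>R (U s - (U t + (s - t) *\<^sub>R V)))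
        = norm ((1 / (s - t)) *\<^sub>R (U s - U t) - V)"
      unfolding eventually_at_filter
    proof (intro always_eventually allI impI)
      fix s assume "s \<noteq> t"
      then have "(1 / (s - t)) *\<^sub>R (U s - U t) - V = (1 / (s - t)) *\<^sub>R (U s - (U t + (s - t) *\<^sub>R V))"
        by (simp add: scaleR_diff_right scaleR_add_right)
      then show "norm ((1 / norm (s - t)) *\<^sub>R (U s - (U t + (s - t) *\<^sub>R V)))
        = norm ((1 / (s - t)) *\<^sub>R (U s - U t) - V)" by simp
    qed
  qed
  finally show ?thesis .
qed

lemma L2_deriv_iff:
  assumes u: "\<And>t. t \<ge> 0 \<Longrightarrow> L2 L (u t)" and v: "\<And>t. t \<ge> 0 \<Longrightarrow> L2 L (v t)"
  shows "L2_deriv L u v \<longleftrightarrow>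
    (\<forall>t\<ge>0. ((\<lambda>t. emb L (u t)) has_vector_derivative emb L (v t)) (at t within {0..}))"
proof -
  have "((\<lambda>s. L2_norm L (\<lambda>x. (u s x - u t x) / (s - t) - v t x)) \<longlongrightarrow> 0) (at t within {0..}) \<longleftrightarrow>
    ((\<lambda>t. emb L (u t)) has_vector_derivative emb L (v t)) (at t within {0..})" if t: "t \<ge> 0" for t
    unfolding has_vector_derivative_iff_quotient
  proof (rule tendsto_cong)
    show "\<forall>\<^sub>F s in at t within {0..}. L2_norm L (\<lambda>x. (u s x - u t x) / (s - t) - v t x)
        = norm ((1 / (s - t)) *\<^sub>R (emb L (u s) - emb L (u t)) - emb L (v t))"
      unfolding eventually_at_filter
    proof (intro always_eventually allI impI)
      fix s :: real assume "s \<in> {0..}"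
      then have us: "L2 L (u s)" using u by simp
      have "(1 / (s - t)) *\<^sub>R (emb L (u s) - emb L (u t)) - emb L (v t)
          = emb L (\<lambda>x. (1 / (s - t)) * (u s x - u t x) - v t x)"
        by (simp only: emb_diff[OF L2_scale[OF L2_diff[OF us u[OF t]]] v[OF t]]
            emb_scale[OF L2_diff[OF us u[OF t]]] emb_diff[OF us u[OF t]])
      moreover have "L2 L (\<lambda>x. (1 / (s - t)) * (u s x - u t x) - v t x)"
        using t by (intro L2_diff L2_scale us u v)
      ultimately show "L2_norm L (\<lambda>x. (u s x - u t x) / (s - t) - v t x)
        = norm ((1 / (s - t)) *\<^sub>R (emb L (u s) - emb L (u t)) - emb L (v t))"
        by (simp add: norm_emb)
    qed
  qed
  then show ?thesis unfolding L2_deriv_def by simp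
qed

section \<open>Passage between concrete solutions and the abstract equation\<close>

lemma graph_of_H3:
  assumes L: "L > 0" and d: "H3_derivs L f w1 w2 w3" and h: "C1_rep L f h h'" "h 0 = 0" "h L = 0" "h' L = a * z"
    and F: "L2 L F" "ae_eq L F (\<lambda>x. - w1 x - w3 x)"
  shows "((emb L f, z), (emb L F, b * z + c * h' 0)) \<in> kdv_graph L a b c"
proof -
  obtain y y1 y2 where y: "H3_class L y y1 y2 w3" "ae_eq L f y" "ae_eq L w1 y1"
    using class_of_H3_derivs[OF L d] by blast
  have f: "L2 L f" using d by (simp add: H3_derivs_def weak_deriv_def)
  have hy: "h 0 = y 0" "h L = y L" "h' L = y1 L" "h' 0 = y1 0"
    using C1_rep_class[OF L y(1,2) h(1)] L by auto
  have "ae_eq L (\<lambda>x. - w1 x - w3 x) (\<lambda>x. - y1 x - w3 x)"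
    using y(3) unfolding ae_eq_def by (rule eventually_mono) simp
  then have "emb L F = emb L (\<lambda>x. - y1 x - w3 x)"
    using ae_eq_trans[OF F(2)] emb_cong[OF F(1)] by blast
  moreover have "cutoff L (emb L f) = emb L y" using cutoff_emb[OF f] emb_cong[OF f y(2)] by simp
  ultimately show ?thesis
    unfolding kdv_graph_iff using y(1) h(2-4) hy by metis
qed

lemma strong_sol_graph:
  assumes L: "L > 0" and s: "strong_sol L a b c y0 z0 y z" and y0: "L2 L y0"
  shows "\<exists>V. (\<forall>t\<ge>0. ((emb L (y t), z t), V t) \<in> kdv_graph L a b c \<and>
      ((\<lambda>t. (emb L (y t), z t)) has_vector_derivative V t) (at t within {0..})) \<and>
      (emb L (y 0), z 0) = (emb L y0, z0) \<and> (\<forall>t\<ge>0. L2 L (y t))"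
proof -
  obtain v g1 g2 g3 zd where s: "L2_cont L y" "L2_cont L v"
    "\<And>t. t \<ge> 0 \<Longrightarrow> H3_derivs L (y t) (g1 t) (g2 t) (g3 t)" "L2_deriv L y v"
    "\<And>t. t \<ge> 0 \<Longrightarrow> ae_eq L (\<lambda>x. v t x + g1 t x + g3 t x) (\<lambda>x. 0)"
    "\<And>t. t \<ge> 0 \<Longrightarrow> (z has_real_derivative zd t) (at t within {0..})"
    "\<And>t. t \<ge> 0 \<Longrightarrow> \<exists>h h'. C1_rep L (y t) h h' \<and> h 0 = 0 \<and> h L = 0 \<and> h' L = a * z t \<and>
             zd t = b * z t + c * h' 0"
    "ae_eq L (y 0) y0" "z 0 = z0"
    using s unfolding strong_sol_def by blast
  have y: "L2 L (y t)" and v: "L2 L (v t)" if "t \<ge> 0" for t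
    using s(1,2) that by (auto simp: L2_cont_def)
  have "((emb L (y t), z t), (emb L (v t), zd t)) \<in> kdv_graph L a b c" if t: "t \<ge> 0" for t
  proof -
    obtain h h' where h: "C1_rep L (y t) h h'" "h 0 = 0" "h L = 0" "h' L = a * z t" "zd t = b * z t + c * h' 0"
      using s(7)[OF t] by blast
    have "ae_eq L (v t) (\<lambda>x. - g1 t x - g3 t x)"
      using s(5)[OF t] unfolding ae_eq_def by (rule eventually_mono) simp
    from graph_of_H3[OF L s(3)[OF t] h(1-4) v[OF t] this] show ?thesis by (simp add: h(5))
  qed
  moreover have "((\<lambda>t. (emb L (y t), z t)) has_vector_derivative (emb L (v t), zd t)) (at t within {0..})"
    if t: "t \<ge> 0" for t
    using s(4) L2_deriv_iff[of L y v, OF y v] s(6)[OF t] t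
    by (intro has_vector_derivative_Pair) (auto simp: has_real_derivative_iff_has_vector_derivative)
  moreover have "(emb L (y 0), z 0) = (emb L y0, z0)"
    using s(8,9) emb_cong[OF y[of 0]] by simp
  ultimately show ?thesis using y by (intro exI[of _ "\<lambda>t. (emb L (v t), zd t)"]) blast
qed

lemma in_dom_A_graph:
  assumes L: "L > 0" and "in_dom_A L a y0 z0"
  shows "L2 L y0 \<and> (\<exists>V. ((emb L y0, z0), V) \<in> kdv_graph L a b c)"
proof -
  obtain g1 g2 g3 h h' where d: "H3_derivs L y0 g1 g2 g3"
    and h: "C1_rep L y0 h h'" "h 0 = 0" "h L = 0" "h' L = a * z0"
    using assms(2) unfolding in_dom_A_def H3_def by blast
  have g: "L2 L y0" "L2 L g1" "L2 L g3" using d by (auto simp: H3_derivs_def weak_deriv_def)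
  have "L2 L (\<lambda>x. - g1 x - g3 x)" by (intro L2_diff L2_uminus g)
  moreover have "ae_eq L (\<lambda>x. - g1 x - g3 x) (\<lambda>x. - g1 x - g3 x)" by (rule ae_eq_on) simp
  ultimately show ?thesis using graph_of_H3[OF L d h] g(1) by blast
qed

lemma strong_sol_unique:
  assumes L: "L > 0" and y0: "L2 L y0"
    and s: "strong_sol L a b c y0 z0 y z" and s': "strong_sol L a b c y0 z0 y' z'" and t: "t \<ge> 0"
  shows "ae_eq L (y t) (y' t) \<and> z t = z' t"
proof -
  interpret quasi_m_dissipative "kdv_graph L a b c" "a\<^sup>2 / 2 + \<bar>b\<bar> + c\<^sup>2 / 2"
    by (rule kdv_quasi_m_dissipative[OF L])
  obtain V where V: "\<And>t. t \<ge> 0 \<Longrightarrow> ((emb L (y t), z t), V t) \<in> kdv_graph L a b c"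
      "\<And>t. t \<ge> 0 \<Longrightarrow> ((\<lambda>t. (emb L (y t), z t)) has_vector_derivative V t) (at t within {0..})"
      "(emb L (y 0), z 0) = (emb L y0, z0)" "\<And>t. t \<ge> 0 \<Longrightarrow> L2 L (y t)"
    using strong_sol_graph[OF L s y0] by blast
  obtain V' where V': "\<And>t. t \<ge> 0 \<Longrightarrow> ((emb L (y' t), z' t), V' t) \<in> kdv_graph L a b c"
      "\<And>t. t \<ge> 0 \<Longrightarrow> ((\<lambda>t. (emb L (y' t), z' t)) has_vector_derivative V' t) (at t within {0..})"
      "(emb L (y' 0), z' 0) = (emb L y0, z0)" "\<And>t. t \<ge> 0 \<Longrightarrow> L2 L (y' t)"
    using strong_sol_graph[OF L s' y0] by blast
  have "(emb L (y t), z t) - (emb L (y' t), z' t) = 0"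
    by (rule strong_solution_zero[where u = "\<lambda>t. (emb L (y t), z t) - (emb L (y' t), z' t)" and v = "\<lambda>t. V t - V' t"])
      (use V(3) V'(3) t in \<open>auto intro!: G_diff V(1) V'(1) has_vector_derivative_diff V(2) V'(2) simp del: diff_Pair\<close>)
  then have "emb L (y t) = emb L (y' t)" "z t = z' t" by (auto simp: zero_prod_def)
  then show ?thesis using emb_eq_iff[OF V(4)[OF t] V'(4)[OF t]] by simp
qed

lemma H3_of_graph:
  assumes L: "L > 0" and "((Y, z), (F, g)) \<in> kdv_graph L a b c"
  shows "\<exists>w w1 w2 w3. H3_class L w w1 w2 w3 \<and> ae_eq L (rep_lsq Y) w \<and> cutoff L Y = emb L w \<and>
     F = emb L (\<lambda>x. - w1 x - w3 x) \<and>
     w 0 = 0 \<and> w L = 0 \<and> w1 L = a * z \<and> g = b * z + c * w1 0"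
proof -
  obtain w w1 w2 w3 where w: "H3_class L w w1 w2 w3" "cutoff L Y = emb L w" "F = emb L (\<lambda>x. - w1 x - w3 x)"
     "w 0 = 0" "w L = 0" "w1 L = a * z" "g = b * z + c * w1 0"
    using assms(2) unfolding kdv_graph_iff by blast
  then have "ae_eq L (rep_lsq Y) w"
    using emb_eq_iff[OF L2_rep H3_class_L2(1)[OF w(1)]] by (simp add: cutoff_def)
  with w show ?thesis by blast
qed

lemma continuous_on_norm_bound:
  fixes A :: "real \<Rightarrow> 'a::real_normed_vector" and p :: "real \<Rightarrow> real" and q :: "real \<Rightarrow> 'b::real_normed_vector"
    and r :: "real \<Rightarrow> 'c::real_normed_vector"
  assumes c: "continuous_on S p" "continuous_on S q" "continuous_on S r"
    and bound: "\<And>s t. s \<in> S \<Longrightarrow> t \<in> S \<Longrightarrow> norm (A s - A t) \<le> C * (\<bar>p s - p t\<bar> + norm (q s - q t) + norm (r s - r t))"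
  shows "continuous_on S A"
  unfolding continuous_on_def
proof
  fix t assume t: "t \<in> S"
  have lim: "(p \<longlongrightarrow> p t) (at t within S)" "(q \<longlongrightarrow> q t) (at t within S)" "(r \<longlongrightarrow> r t) (at t within S)"
    using c t by (auto simp: continuous_on_def)
  have "((\<lambda>s. C * (\<bar>p s - p t\<bar> + norm (q s - q t) + norm (r s - r t))) \<longlongrightarrow>
      C * (\<bar>p t - p t\<bar> + norm (q t - q t) + norm (r t - r t))) (at t within S)"
    by (intro tendsto_intros lim)
  then have "((\<lambda>s. C * (\<bar>p s - p t\<bar> + norm (q s - q t) + norm (r s - r t))) \<longlongrightarrow> 0) (at t within S)" by simp
  then have "((\<lambda>s. A s - A t) \<longlongrightarrow> 0) (at t within S)"
    by (rule Lim_null_comparison[rotated])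
      (auto simp: eventually_at_filter intro!: always_eventually bound t)
  then show "(A \<longlongrightarrow> A t) (at t within S)" by (simp add: LIM_zero_iff)
qed

text \<open>The abstract solution and its derivative are continuous in the Hilbert space. The sup
  estimate for differences of two times upgrades this to L^2 continuity of the spatial
  derivatives.\<close>

lemma strong_sol_exists:
  assumes L: "L > 0" and dom: "in_dom_A L a y0 z0"
  shows "\<exists>y z. strong_sol L a b c y0 z0 y z"
proof -
  interpret quasi_m_dissipative "kdv_graph L a b c" "a\<^sup>2 / 2 + \<bar>b\<bar> + c\<^sup>2 / 2"
    by (rule kdv_quasi_m_dissipative[OF L])
  obtain V0 where y0: "L2 L y0" and V0: "((emb L y0, z0), V0) \<in> kdv_graph L a b c"
    using in_dom_A_graph[OF L dom] by blast
  obtain u v where u0: "u 0 = (emb L y0, z0)"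
    and uv: "\<And>t. t \<ge> 0 \<Longrightarrow> (u t, v t) \<in> kdv_graph L a b c"
      "\<And>t. t \<ge> 0 \<Longrightarrow> (u has_vector_derivative v t) (at t within {0..})"
    and cv: "continuous_on {0..} v"
    using strong_solution[OF V0] by blast
  have cu: "continuous_on {0..} u"
    unfolding continuous_on_eq_continuous_within
    using uv(2) has_vector_derivative_continuous by blast
  define Q where "Q t w w1 w2 w3 \<longleftrightarrow> H3_class L w w1 w2 w3 \<and> ae_eq L (rep_lsq (fst (u t))) w \<and>
     cutoff L (fst (u t)) = emb L w \<and> fst (v t) = emb L (\<lambda>x. - w1 x - w3 x) \<and>
     w 0 = 0 \<and> w L = 0 \<and> w1 L = a * snd (u t) \<and> snd (v t) = b * snd (u t) + c * w1 0" for t w w1 w2 w3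
  have "\<exists>w w1 w2 w3. Q t w w1 w2 w3" if "t \<ge> 0" for t
    unfolding Q_def
    by (rule H3_of_graph[OF L, of "fst (u t)" "snd (u t)" "fst (v t)" "snd (v t)" a b c, unfolded prod.collapse, OF uv(1)[OF that]])
  then obtain w w1 w2 w3 where Q: "\<And>t. t \<ge> 0 \<Longrightarrow> Q t (w t) (w1 t) (w2 t) (w3 t)" by metis
  have w: "H3_class L (w t) (w1 t) (w2 t) (w3 t)" "ae_eq L (rep_lsq (fst (u t))) (w t)"
      "cutoff L (fst (u t)) = emb L (w t)" "fst (v t) = emb L (\<lambda>x. - w1 t x - w3 t x)"
      "w t 0 = 0" "w t L = 0" "w1 t L = a * snd (u t)" "snd (v t) = b * snd (u t) + c * w1 t 0"
    if "t \<ge> 0" for t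
    using Q[OF that] unfolding Q_def by blast+
  note Lw = H3_class_L2[OF w(1)]
  define y where "y t = rep_lsq (fst (u t))" for t
  define vv where "vv t x = - w1 t x - w3 t x" for t x
  have Ly: "L2 L (y t)" for t by (simp add: y_def L2_rep)
  have Lv: "L2 L (vv t)" if "t \<ge> 0" for t
    unfolding vv_def by (intro L2_diff L2_uminus Lw that)
  have embv: "emb L (vv t) = fst (v t)" if "t \<ge> 0" for t using w(4)[OF that] by (simp add: vv_def[abs_def])
  have emby: "emb L (y t) = cutoff L (fst (u t))" for t by (simp add: y_def cutoff_def)
  have cy: "continuous_on {0..} (\<lambda>t. emb L (y t))"
    unfolding emby by (intro bounded_linear.continuous_on[OF bounded_linear_cutoff] continuous_on_fst cu)
  have cvv: "continuous_on {0..} (\<lambda>t. emb L (vv t))"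
    by (rule continuous_on_eq[OF continuous_on_fst[OF cv]]) (simp add: embv)
  have cz: "continuous_on {0..} (\<lambda>t. a * snd (u t))" by (intro continuous_intros cu)
  obtain C where C: "C \<ge> 0" and est: "\<And>y y1 y2 y3 x. H3_class L y y1 y2 y3 \<Longrightarrow> y 0 = 0 \<Longrightarrow> y L = 0 \<Longrightarrow> x \<in> {0..L} \<Longrightarrow>
     \<bar>y1 x\<bar> \<le> C * (\<bar>y1 L\<bar> + L2_norm L y + L2_norm L (\<lambda>x. y1 x + y3 x)) \<and>
     \<bar>y2 x\<bar> \<le> C * (\<bar>y1 L\<bar> + L2_norm L y + L2_norm L (\<lambda>x. y1 x + y3 x))"
    using H3_class_sup_estimate[OF L] by blast
  \<comment> \<open>The distance of the solution at two times as measured by the right-hand side of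
    the sup estimate: slope at \<open>L\<close>, the function, and y' + y'''.\<close>
  let ?N = "\<lambda>s t. \<bar>a * snd (u s) - a * snd (u t)\<bar> + norm (emb L (y s) - emb L (y t)) + norm (emb L (vv s) - emb L (vv t))"
  have diff_est: "norm (emb L (w1 s) - emb L (w1 t)) \<le> sqrt L * C * ?N s t"
      "norm (emb L (w2 s) - emb L (w2 t)) \<le> sqrt L * C * ?N s t"
    if st: "s \<in> {0..}" "t \<in> {0..}" for s t
  proof -
    have s: "s \<ge> 0" and t: "t \<ge> 0" using st by auto
    note d = H3_class_diff[OF w(1)[OF s] w(1)[OF t]]
    have n1: "L2_norm L (\<lambda>x. w s x - w t x) = norm (emb L (y s) - emb L (y t))"
      using s t by (simp add: emby w(3) norm_emb Lw L2_diff flip: emb_diff)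
    have "norm (emb L (vv s) - emb L (vv t)) = L2_norm L (\<lambda>x. vv s x - vv t x)"
      using s t by (simp add: norm_emb Lv L2_diff flip: emb_diff)
    also have "\<dots> = L2_norm L (\<lambda>x. (w1 s x - w1 t x) + (w3 s x - w3 t x))"
      unfolding L2_norm_def by (simp add: vv_def power2_eq_square algebra_simps)
    finally have n2: "L2_norm L (\<lambda>x. (w1 s x - w1 t x) + (w3 s x - w3 t x)) = norm (emb L (vv s) - emb L (vv t))" ..
    note e = est[OF d, unfolded n1 n2]
    have 1: "norm (emb L (w1 s) - emb L (w1 t)) = L2_norm L (\<lambda>x. w1 s x - w1 t x)"
      and 2: "norm (emb L (w2 s) - emb L (w2 t)) = L2_norm L (\<lambda>x. w2 s x - w2 t x)"
      using s t by (simp_all add: norm_emb Lw L2_diff flip: emb_diff)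
    show "norm (emb L (w1 s) - emb L (w1 t)) \<le> sqrt L * C * ?N s t"
      unfolding 1 mult.assoc
      by (rule L2_norm_le_sup[OF L]) (use e s t w(5,6,7) in \<open>auto intro: L2_diff Lw\<close>)
    show "norm (emb L (w2 s) - emb L (w2 t)) \<le> sqrt L * C * ?N s t"
      unfolding 2 mult.assoc
      by (rule L2_norm_le_sup[OF L]) (use e s t w(5,6,7) in \<open>auto intro: L2_diff Lw\<close>)
  qed
  have c1: "continuous_on {0..} (\<lambda>t. emb L (w1 t))"
    by (rule continuous_on_norm_bound[OF cz cy cvv diff_est(1)])
  have c2: "continuous_on {0..} (\<lambda>t. emb L (w2 t))"
    by (rule continuous_on_norm_bound[OF cz cy cvv diff_est(2)])
  \<comment> \<open>The third derivative equals minus the time derivative minus the first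
    derivative, both already continuous.\<close>
  have c3: "continuous_on {0..} (\<lambda>t. emb L (w3 t))"
  proof (rule continuous_on_eq)
    show "continuous_on {0..} (\<lambda>t. (-1) *\<^sub>R emb L (vv t) - emb L (w1 t))" by (intro continuous_intros cvv c1)
    fix t :: real assume "t \<in> {0..}"
    then have t: "t \<ge> 0" by simp
    have "(-1) *\<^sub>R emb L (vv t) - emb L (w1 t) = emb L (\<lambda>x. (-1) * vv t x - w1 t x)"
      by (simp only: emb_diff[OF L2_scale[OF Lv[OF t]] Lw(2)[OF t]] emb_scale[OF Lv[OF t]])
    also have "(\<lambda>x. (-1) * vv t x - w1 t x) = w3 t" by (auto simp: vv_def)
    finally show "(-1) *\<^sub>R emb L (vv t) - emb L (w1 t) = emb L (w3 t)" .
  qed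
  have "strong_sol L a b c y0 z0 y (\<lambda>t. snd (u t))"
    unfolding strong_sol_def
  proof (rule exI[of _ vv], rule exI[of _ w1], rule exI[of _ w2], rule exI[of _ w3],
      rule exI[of _ "\<lambda>t. snd (v t)"], intro conjI allI impI)
    show "L2_cont L y" using L2_cont_iff[of L y] Ly cy by blast
    show "L2_cont L w1" using L2_cont_iff[of L w1] Lw(2) c1 by blast
    show "L2_cont L w2" using L2_cont_iff[of L w2] Lw(3) c2 by blast
    show "L2_cont L w3" using L2_cont_iff[of L w3] Lw(4) c3 by blast
    show "L2_cont L vv" using L2_cont_iff[of L vv] Lv cvv by blast
    show "continuous_on {0..} (\<lambda>t. snd (v t))" by (intro continuous_intros cv)
    have der: "((\<lambda>t. emb L (y t)) has_vector_derivative emb L (vv t)) (at t within {0..})" if t: "t \<ge> 0" for t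
    proof -
      have "((\<lambda>t. cutoff L (fst (u t))) has_vector_derivative cutoff L (fst (v t))) (at t within {0..})"
        by (intro bounded_linear.has_vector_derivative[OF bounded_linear_cutoff]
            bounded_linear.has_vector_derivative[OF bounded_linear_fst] uv(2) t)
      moreover have "cutoff L (fst (v t)) = emb L (vv t)" using embv[OF t] cutoff_emb[OF Lv[OF t]] by simp
      ultimately show ?thesis by (simp add: emby)
    qed
    then show "L2_deriv L y vv" using L2_deriv_iff[of L y vv] Ly Lv by blast
    have "cutoff L (emb L y0) = emb L y0" by (rule cutoff_emb[OF y0])
    then have "emb L (y 0) = emb L y0" by (simp add: emby u0)
    then show "ae_eq L (y 0) y0" using emb_eq_iff[OF Ly y0] by simp
    show "snd (u 0) = z0" by (simp add: u0)
    fix t :: real assume t: "t \<ge> 0"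
    have yw: "ae_eq L (y t) (w t)" using w(2)[OF t] by (simp add: y_def)
    show "H3_derivs L (y t) (w1 t) (w2 t) (w3 t)" by (rule H3_derivs_of_class[OF L w(1)[OF t] yw])
    show "ae_eq L (\<lambda>x. vv t x + w1 t x + w3 t x) (\<lambda>x. 0)" by (rule ae_eq_on) (simp add: vv_def)
    show "((\<lambda>t. snd (u t)) has_real_derivative snd (v t)) (at t within {0..})"
      unfolding has_real_derivative_iff_has_vector_derivative
      by (rule bounded_linear.has_vector_derivative[OF bounded_linear_snd uv(2)[OF t]])
    show "\<exists>h h'. C1_rep L (y t) h h' \<and> h 0 = 0 \<and> h L = 0 \<and> h' L = a * snd (u t) \<and>
        snd (v t) = b * snd (u t) + c * h' 0"
      using C1_rep_of_class[OF w(1)[OF t] yw] w(5-8)[OF t] by blast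
  qed
  then show ?thesis by blast
qed

lemma mild_sol_exists:
  assumes L: "L > 0" and y0: "L2 L y0"
  shows "\<exists>y z. mild_sol L a b c y0 z0 y z"
proof -
  interpret quasi_m_dissipative "kdv_graph L a b c" "a\<^sup>2 / 2 + \<bar>b\<bar> + c\<^sup>2 / 2"
    by (rule kdv_quasi_m_dissipative[OF L])
  from mild_solution[of "(emb L y0, z0)"]
  obtain u :: "real \<Rightarrow> lsq \<times> real" where u: "continuous_on {0..} u \<and> u 0 = (emb L y0, z0) \<and>
      (\<forall>t\<ge>0. (integral {0..t} u, u t - (emb L y0, z0)) \<in> kdv_graph L a b c)" by (rule exE)
  then have cu: "continuous_on {0..} u" by blast
  have uG: "(integral {0..t} u, u t - (emb L y0, z0)) \<in> kdv_graph L a b c" if "t \<ge> 0" for t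
    using u that by blast
  define y where "y t = rep_lsq (fst (u t))" for t
  have Ly: "L2 L (y t)" for t by (simp add: y_def L2_rep)
  have emby: "emb L (y t) = cutoff L (fst (u t))" for t by (simp add: y_def cutoff_def)
  have cy: "continuous_on {0..} (\<lambda>t. emb L (y t))"
    unfolding emby by (intro bounded_linear.continuous_on[OF bounded_linear_cutoff] continuous_on_fst cu)
  have "mild_sol L a b c y0 z0 y (\<lambda>t. snd (u t))"
    unfolding mild_sol_def
  proof (intro conjI allI impI)
    show "L2_cont L y" using L2_cont_iff[of L y] Ly cy by blast
    show "continuous_on {0..} (\<lambda>t. snd (u t))" by (intro continuous_intros cu)
    fix t :: real assume t: "t \<ge> 0"
    have ui: "u integrable_on {0..t}"
      by (rule integrable_continuous_real) (auto intro: continuous_on_subset[OF cu])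
    have lin: "f (integral {0..t} u) = integral {0..t} (\<lambda>s. f (u s))" if "bounded_linear f" for f :: "lsq \<times> real \<Rightarrow> real"
      using integral_linear[OF ui that] by (simp add: o_def)
    define I where "I = integral {0..t} u"
    have zI: "snd I = integral {0..t} (\<lambda>s. snd (u s))" unfolding I_def by (rule lin[OF bounded_linear_snd])
    obtain w w1 w2 w3 where w: "H3_class L w w1 w2 w3" "ae_eq L (rep_lsq (fst I)) w"
      "fst (u t) - emb L y0 = emb L (\<lambda>x. - w1 x - w3 x)" "w 0 = 0" "w L = 0" "w1 L = a * snd I"
      "snd (u t) - z0 = b * snd I + c * w1 0"
      using H3_of_graph[OF L, of "fst I" "snd I" "fst (u t) - emb L y0" "snd (u t) - z0" a b c] uG[OF t]
      by (cases "u t") (auto simp: I_def)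
    note Lw = H3_class_L2[OF w(1)]
    have F: "L2 L (\<lambda>x. - w1 x - w3 x)" by (intro L2_diff L2_uminus Lw)
    have "emb L (\<lambda>x. y t x - y0 x) = cutoff L (fst (u t) - emb L y0)"
      by (simp add: emb_diff Ly y0 emby cutoff_simps cutoff_emb)
    also have "\<dots> = emb L (\<lambda>x. - w1 x - w3 x)" unfolding w(3) by (rule cutoff_emb[OF F])
    finally have ae: "ae_eq L (\<lambda>x. y t x - y0 x) (\<lambda>x. - w1 x - w3 x)"
      using emb_eq_iff[OF L2_diff[OF Ly y0] F] by simp
    \<comment> \<open>Pairing with a fixed function is a bounded functional, so it passes through
      the vector-valued integral.\<close>
    have pair: "L2_inner L (rep_lsq (fst I)) \<phi> = integral {0..t} (\<lambda>s. L2_inner L (y s) \<phi>)" if \<phi>: "L2 L \<phi>" for \<phi>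
    proof -
      have "bounded_linear (\<lambda>p :: lsq \<times> real. inner (fst p) (emb L \<phi>))"
        by (rule bounded_linear_compose[OF bounded_linear_inner_left bounded_linear_fst])
      from lin[OF this] show ?thesis by (simp add: I_def y_def inner_emb_right[OF \<phi>])
    qed
    show "\<exists>W w1 w2 w3 h h'. L2 L W \<and>
        (\<forall>\<phi>. L2 L \<phi> \<longrightarrow> L2_inner L W \<phi> = integral {0..t} (\<lambda>s. L2_inner L (y s) \<phi>)) \<and>
        H3_derivs L W w1 w2 w3 \<and> C1_rep L W h h' \<and> h 0 = 0 \<and> h L = 0 \<and>
        h' L = a * integral {0..t} (\<lambda>t. snd (u t)) \<and>
        ae_eq L (\<lambda>x. y t x - y0 x) (\<lambda>x. - w1 x - w3 x) \<and>
        snd (u t) - z0 = b * integral {0..t} (\<lambda>t. snd (u t)) + c * h' 0"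
      by (rule exI[of _ "rep_lsq (fst I)"], rule exI[of _ w1], rule exI[of _ w2], rule exI[of _ w3],
          rule exI[of _ w], rule exI[of _ w1], intro
          conjI allI impI L2_rep pair H3_derivs_of_class[OF L w(1,2)] C1_rep_of_class[OF w(1,2)] w(4,5) ae)
        (use w(6,7) zI in simp_all)
  qed
  then show ?thesis by blast
qed

text \<open>The function \<open>W\<close> is known only through its pairings; these determine it as
  the first component of the vector-valued integral, so uniqueness can be argued in the Hilbert
  space.\<close>

lemma mild_sol_graph:
  assumes L: "L > 0" and m: "mild_sol L a b c y0 z0 y z" and y0: "L2 L y0"
  shows "(\<forall>t\<ge>0. L2 L (y t)) \<and> continuous_on {0..} (\<lambda>t. (emb L (y t), z t)) \<and>
    (\<forall>t\<ge>0. (integral {0..t} (\<lambda>t. (emb L (y t), z t)), (emb L (y t), z t) - (emb L y0, z0)) \<in> kdv_graph L a b c)"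
proof (intro conjI allI impI)
  have y: "L2 L (y t)" if "t \<ge> 0" for t using m that by (auto simp: mild_sol_def L2_cont_def)
  then show "L2 L (y t)" if "t \<ge> 0" for t using that .
  have cy: "continuous_on {0..} (\<lambda>t. emb L (y t))"
    using m L2_cont_iff[of L y] y by (auto simp: mild_sol_def)
  have cz: "continuous_on {0..} z" using m by (simp add: mild_sol_def)
  show cu: "continuous_on {0..} (\<lambda>t. (emb L (y t), z t))" by (intro continuous_intros cy cz)
  fix t :: real assume t: "t \<ge> 0"
  obtain W w1 w2 w3 h h' where W: "L2 L W"
      "\<And>\<phi>. L2 L \<phi> \<Longrightarrow> L2_inner L W \<phi> = integral {0..t} (\<lambda>s. L2_inner L (y s) \<phi>)"
    and d: "H3_derivs L W w1 w2 w3" and h: "C1_rep L W h h'" "h 0 = 0" "h L = 0" "h' L = a * integral {0..t} z"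
    and ae: "ae_eq L (\<lambda>x. y t x - y0 x) (\<lambda>x. - w1 x - w3 x)"
    and z: "z t - z0 = b * integral {0..t} z + c * h' 0"
    using m t unfolding mild_sol_def by blast
  let ?u = "\<lambda>t. (emb L (y t), z t)"
  have ui: "?u integrable_on {0..t}"
    by (rule integrable_continuous_real) (auto intro: continuous_on_subset[OF cu])
  have lin: "f (integral {0..t} ?u) = integral {0..t} (\<lambda>s. f (?u s))" if "bounded_linear f" for f :: "lsq \<times> real \<Rightarrow> real"
    using integral_linear[OF ui that] by (simp add: o_def)
  have 2: "snd (integral {0..t} ?u) = integral {0..t} z" using lin[OF bounded_linear_snd] by simp
  \<comment> \<open>Every \<open>X\<close> of the ambient space is allowed: against functions
    supported in [0,L], only its restriction enters.\<close>
  have "inner (fst (integral {0..t} ?u)) X = inner (emb L W) X" for X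
  proof -
    have "bounded_linear (\<lambda>p :: lsq \<times> real. inner (fst p) X)"
      by (rule bounded_linear_compose[OF bounded_linear_inner_left bounded_linear_fst])
    from lin[OF this] have "inner (fst (integral {0..t} ?u)) X = integral {0..t} (\<lambda>s. inner (emb L (y s)) X)" by simp
    also have "\<dots> = integral {0..t} (\<lambda>s. L2_inner L (y s) (rep_lsq X))"
    proof (rule integral_cong)
      fix s assume "s \<in> {0..t}"
      then have ys: "L2 L (y s)" using y by simp
      show "inner (emb L (y s)) X = L2_inner L (y s) (rep_lsq X)"
        using inner_emb_right[OF ys, of X] by (simp add: inner_commute L2_inner_commute)
    qed
    also have "\<dots> = L2_inner L W (rep_lsq X)" using W(2)[OF L2_rep] by simp
    also have "\<dots> = inner (emb L W) X"
      using inner_emb_right[OF W(1), of X] by (simp add: inner_commute L2_inner_commute)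
    finally show ?thesis .
  qed
  then have 1: "fst (integral {0..t} ?u) = emb L W" using vector_eq_rdot by blast
  have "integral {0..t} ?u = (emb L W, integral {0..t} z)" using 1 2 by (simp add: prod_eq_iff)
  moreover have "?u t - (emb L y0, z0) = (emb L (\<lambda>x. y t x - y0 x), b * integral {0..t} z + c * h' 0)"
    using z by (simp add: emb_diff y t y0)
  ultimately show "(integral {0..t} ?u, ?u t - (emb L y0, z0)) \<in> kdv_graph L a b c"
    using graph_of_H3[OF L d h L2_diff[OF y[OF t] y0] ae] by simp
qed

lemma mild_sol_unique:
  assumes L: "L > 0" and y0: "L2 L y0"
    and m: "mild_sol L a b c y0 z0 y z" and m': "mild_sol L a b c y0 z0 y' z'" and t: "t \<ge> 0"
  shows "ae_eq L (y t) (y' t) \<and> z t = z' t"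
proof -
  interpret quasi_m_dissipative "kdv_graph L a b c" "a\<^sup>2 / 2 + \<bar>b\<bar> + c\<^sup>2 / 2"
    by (rule kdv_quasi_m_dissipative[OF L])
  define u u' where "u t = (emb L (y t), z t)" and "u' t = (emb L (y' t), z' t)" for t
  have U: "\<And>t. t \<ge> 0 \<Longrightarrow> L2 L (y t)" "continuous_on {0..} u"
      "\<And>t. t \<ge> 0 \<Longrightarrow> (integral {0..t} u, u t - (emb L y0, z0)) \<in> kdv_graph L a b c"
    using mild_sol_graph[OF L m y0] by (auto simp: u_def[abs_def])
  have U': "\<And>t. t \<ge> 0 \<Longrightarrow> L2 L (y' t)" "continuous_on {0..} u'"
      "\<And>t. t \<ge> 0 \<Longrightarrow> (integral {0..t} u', u' t - (emb L y0, z0)) \<in> kdv_graph L a b c"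
    using mild_sol_graph[OF L m' y0] by (auto simp: u'_def[abs_def])
  have "u t - u' t = 0"
  proof (rule mild_solution_zero[where u = "\<lambda>t. u t - u' t", OF _ _ t])
    show "continuous_on {0..} (\<lambda>t. u t - u' t)" by (intro continuous_intros U(2) U'(2))
    fix t :: real assume t: "t \<ge> 0"
    have "integral {0..t} (\<lambda>t. u t - u' t) = integral {0..t} u - integral {0..t} u'"
      by (intro Henstock_Kurzweil_Integration.integral_diff integrable_continuous_real)
        (auto intro: continuous_on_subset[OF U(2)] continuous_on_subset[OF U'(2)])
    then show "(integral {0..t} (\<lambda>t. u t - u' t), u t - u' t) \<in> kdv_graph L a b c"
      using G_diff[OF U(3)[OF t] U'(3)[OF t]] by simp
  qed
  then have "emb L (y t) = emb L (y' t)" "z t = z' t" by (auto simp: u_def u'_def zero_prod_def)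
  then show ?thesis using emb_eq_iff[OF U(1)[OF t] U'(1)[OF t]] by simp
qed

theorem theorem2p1:
  fixes L a b c :: real
  assumes "L > 0"
  shows "(\<forall>(y0 :: real \<Rightarrow> real) (z0 :: real). in_dom_A L a y0 z0 \<longrightarrow>
            (\<exists>y z. strong_sol L a b c y0 z0 y z) \<and>
            (\<forall>y z y' z'. strong_sol L a b c y0 z0 y z \<and> strong_sol L a b c y0 z0 y' z' \<longrightarrow>
                (\<forall>t\<ge>0. ae_eq L (y t) (y' t) \<and> z t = z' t)))
       \<and> (\<forall>(y0 :: real \<Rightarrow> real) (z0 :: real). L2 L y0 \<longrightarrow>
            (\<exists>y z. mild_sol L a b c y0 z0 y z) \<and>
            (\<forall>y z y' z'. mild_sol L a b c y0 z0 y z \<and> mild_sol L a b c y0 z0 y' z' \<longrightarrow>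
                (\<forall>t\<ge>0. ae_eq L (y t) (y' t) \<and> z t = z' t)))"
proof (intro conjI allI impI)
  fix y0 z0 assume dom: "in_dom_A L a y0 z0"
  show "\<exists>y z. strong_sol L a b c y0 z0 y z" by (rule strong_sol_exists[OF assms dom])
  have y0: "L2 L y0" using in_dom_A_graph[OF assms dom] by blast
  fix y z y' z' and t :: real
  assume s: "strong_sol L a b c y0 z0 y z \<and> strong_sol L a b c y0 z0 y' z'" and t: "0 \<le> t"
  show "ae_eq L (y t) (y' t)" "z t = z' t"
    using strong_sol_unique[OF assms y0 conjunct1[OF s] conjunct2[OF s] t] by auto
next
  fix y0 :: "real \<Rightarrow> real" and z0 :: real assume y0: "L2 L y0"
  show "\<exists>y z. mild_sol L a b c y0 z0 y z" by (rule mild_sol_exists[OF assms y0])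
  fix y z y' z' and t :: real
  assume m: "mild_sol L a b c y0 z0 y z \<and> mild_sol L a b c y0 z0 y' z'" and t: "0 \<le> t"
  show "ae_eq L (y t) (y' t)" "z t = z' t"
    using mild_sol_unique[OF assms y0 conjunct1[OF m] conjunct2[OF m] t] by auto
qed

end
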